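(* Let $A$ be a Mackey complete continuous inverse algebra over $\mathbb{K}\in\{\mathbb{R},\mathbb{C}\}$, let $G$ be a (possibly infinite-dimensional) Lie group acting smoothly on $A$ by automorphisms via $\mu_A\colon G\to \mathrm{Aut}(A)$, and let $E$ be a finitely generated projective right $A$-module such that $\mu_A(G)\subseteq \mathrm{Aut}(A)_E$. Put $$\hat G:=\{(\phi,g)\in \Gamma L(E)\times G : \phi(s.a)=\phi(s).\mu_A(g)(a)\ \text{ for all } s\in E,\ a\in A\},\qquad q\colon \hat G\to G,\ q(\phi,g)=g .$$ Then $\mathrm{GL}_A(E)$ and $\hat G$ carry natural Lie group structures such that the short exact sequence $$\mathbf 1\to \mathrm{GL}_A(E)\to \hat G\xrightarrow{\ q\ } G\to \mathbf 1,$$ where $\mathrm{GL}_A(E)\to\hat G$ is $\phi\mapsto(\phi,\mathbf 1)$, defines a Lie group extension of $G$ by $\mathrm{GL}_A(E)$.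
   Context: A continuous inverse algebra (CIA) is a unital associative locally convex topological algebra $A$ over $\mathbb{K}$ whose unit group $A^\times$ is open and whose inversion $A^\times\to A$ is continuous. A locally convex space is Mackey complete if every smooth curve $[0,1]\to E$ has a (weak) integral in $E$. Lie groups are groups with a smooth manifold structure modeled on a locally convex space with smooth group operations. $\mathrm{Aut}(A)$ is the group of topological algebra automorphisms of $A$; a smooth action $\mu_A$ of $G$ on $A$ means a homomorphism $\mu_A\colon G\to\mathrm{Aut}(A)$ such that $G\times A\to A$, $(g,a)\mapsto \mu_A(g)(a)$, is smooth. A finitely generated projective right $A$-module $E$ is isomorphic to $pA^n$ for some $n$ and some idempotent $p=p^2\in M_n(A)$, and is topologized as the subspace $pA^n\subseteq A^n$. $\mathrm{End}_A(E)$ is the algebra of continuous $A$-linear endomorphisms and $\mathrm{GL}_A(E)=\mathrm{End}_A(E)^\times$. The group of semilinear automorphisms is $$\Gamma L(E)=\{\phi\in \mathrm{GL}_{\mathbb K}(E): (\exists \phi_A\in\mathrm{Aut}(A))(\forall s\in E)(\forall a\in A)\ \phi(s.a)=\phi(s).\phi_A(a)\},$$ where $\mathrm{GL}_{\mathbb K}(E)$ is the group of continuous $\mathbb{K}$-linear automorphisms of $E$ with continuous inverse. $\mathrm{Aut}(A)_E$ is the set of all $\psi\in\mathrm{Aut}(A)$ for which there is $\phi\in\mathrm{GL}_{\mathbb K}(E)$ with $\phi(s.a)=\phi(s).\psi(a)$ for all $s\in E$, $a\in A$. The natural structure on $\mathrm{GL}_A(E)$: $\mathrm{End}_A(E)\cong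 pM_n(A)p$ (matrices acting by left multiplication on $pA^n\cong E$) is given the topology of $pM_n(A)p$; it is a CIA, and $\mathrm{GL}_A(E)$ is an open subset of it. The natural structure on $\hat G$: identify $E$ with $pA^n$, let $g*x$ and $g\sharp s$ denote the entrywise actions of $g\in G$ (via $\mu_A$) on $x\in M_n(A)$ and $s\in A^n$, put $\gamma(g)=p\,(g*p)+(\mathbf 1-p)(\mathbf 1-g*p)$, $U_G=\{g\in G:\gamma(g)\in \mathrm{GL}_n(A)\}$, $S_E(g)(s)=\gamma(g)\cdot(g\sharp s)$ and $\sigma(g)=(S_E(g),g)\in\hat G$ for $g\in U_G$. The structure on $\hat G$ is the one for which $\mathrm{GL}_A(E)\times U_G\to q^{-1}(U_G)$, $(\phi,g)\mapsto \phi\,\sigma(g)$, is a diffeomorphism onto an open subset of $\hat G$. An extension of Lie groups is a short exact sequence $\mathbf 1\to N\xrightarrow{\iota}\hat G\xrightarrow{q}G\to\mathbf 1$ of Lie group morphisms for which $\hat G$ is a smooth locally trivial principal $N$-bundle over $G$ with respect to the right action $(\hat g,n)\mapsto \hat g\,\iota(n)$. *)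

theory Defs
  imports "HOL-Analysis.Analysis" "HOL-Algebra.Coset"
begin

section \<open>The ground field\<close>

text \<open>The ground field is \<open>\<real>\<close> or \<open>\<complex>\<close>: a type in this class comes with an isometric field
  embedding into \<^typ>\<open>complex\<close> whose image is either the real line or everything.\<close>

class real_or_complex = real_normed_field +
  fixes to_complex :: "'a \<Rightarrow> complex"
  assumes to_complex_add: "to_complex (x + y) = to_complex x + to_complex y"
    and to_complex_mult: "to_complex (x * y) = to_complex x * to_complex y"
    and norm_to_complex: "cmod (to_complex x) = norm x"
    and range_to_complex: "range to_complex = \<real> \<or> range to_complex = UNIV"

instantiation real :: real_or_complex
begin
definition to_complex_real :: "real \<Rightarrow> complex" where "to_complex_real = complex_of_real"
instance by standard (auto simp: to_complex_real_def Reals_def)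
end

instantiation complex :: real_or_complex
begin
definition to_complex_complex :: "complex \<Rightarrow> complex" where "to_complex_complex = id"
instance by standard (auto simp: to_complex_complex_def)
end


section \<open>Locally convex spaces and smooth maps\<close>

text \<open>The library has the following three instances only for metric spaces.\<close>

instance vec :: (t0_space, finite) t0_space
proof
  fix x y :: "'a ^ 'b"
  assume "x \<noteq> y"
  then obtain i where "x $ i \<noteq> y $ i"
    by (auto simp: vec_eq_iff)
  then obtain U where U: "open U" "\<not> (x $ i \<in> U \<longleftrightarrow> y $ i \<in> U)"
    using t0_space_class.t0_space by metis
  moreover have "open ((\<lambda>z :: 'a ^ 'b. z $ i) -` U)"
    using U by (simp add: open_vimage_vec_nth)
  ultimately show "\<exists>U. open U \<and> \<not> (x \<in> U \<longleftrightarrow> y \<in> U)"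
    by (metis vimage_eq)
qed

instance vec :: (t1_space, finite) t1_space
proof
  fix x y :: "'a ^ 'b"
  assume "x \<noteq> y"
  then obtain i where "x $ i \<noteq> y $ i"
    by (auto simp: vec_eq_iff)
  then obtain U where U: "open U" "x $ i \<in> U" "y $ i \<notin> U"
    using t1_space_class.t1_space by metis
  moreover have "open ((\<lambda>z :: 'a ^ 'b. z $ i) -` U)"
    using U by (simp add: open_vimage_vec_nth)
  ultimately show "\<exists>U. open U \<and> x \<in> U \<and> y \<notin> U"
    by (metis vimage_eq)
qed

instance vec :: (t2_space, finite) t2_space
proof
  fix x y :: "'a ^ 'b"
  assume "x \<noteq> y"
  then obtain i where "x $ i \<noteq> y $ i"
    by (auto simp: vec_eq_iff)
  then obtain U V where UV: "open U" "open V" "x $ i \<in> U" "y $ i \<in> V" "U \<inter> V = {}"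
    using hausdorff by metis
  let ?pre = "\<lambda>W. (\<lambda>z :: 'a ^ 'b. z $ i) -` W"
  have "open (?pre U)" "open (?pre V)"
    using UV by (simp_all add: open_vimage_vec_nth)
  moreover have "x \<in> ?pre U" "y \<in> ?pre V" "?pre U \<inter> ?pre V = {}"
    using UV by auto
  ultimately show "\<exists>U V. open U \<and> open V \<and> x \<in> U \<and> y \<in> V \<and> U \<inter> V = {}"
    by blast
qed

text \<open>Locally convex spaces occur as linear subspaces \<open>V\<close> of a type, with the subspace topology
  \<^term>\<open>top_of_set V\<close>. The Hausdorff property is provided by the class \<^class>\<open>t2_space\<close>.
  All calculus is over the reals, also when the ground field of the algebra is complex.\<close>

definition locally_convex_space :: "'v::{real_vector,t2_space} set \<Rightarrow> bool" where
  "locally_convex_space V \<longleftrightarrow>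
     subspace V \<and>
     continuous_on (V \<times> V) (\<lambda>(x, y). x + y) \<and>
     continuous_on (UNIV \<times> V) (\<lambda>(r::real, x). r *\<^sub>R x) \<and>
     (\<forall>U. openin (top_of_set V) U \<and> 0 \<in> U \<longrightarrow>
        (\<exists>W. openin (top_of_set V) W \<and> convex W \<and> 0 \<in> W \<and> W \<subseteq> U))"

text \<open>Iterated directional derivatives:
  \<open>iter_deriv f k h x = (D\<^bsub>h (k - 1)\<^esub> \<dots> D\<^bsub>h 0\<^esub> f) x\<close>.\<close>

definition diff_quot :: "('v::real_vector \<Rightarrow> 'w::real_vector) \<Rightarrow> 'v \<Rightarrow> 'v \<Rightarrow> real \<Rightarrow> 'w" where
  "diff_quot f x h t = (f (x + t *\<^sub>R h) - f x) /\<^sub>R t"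

primrec iter_deriv ::
  "('v::real_vector \<Rightarrow> 'w::{real_vector,t2_space}) \<Rightarrow> nat \<Rightarrow> (nat \<Rightarrow> 'v) \<Rightarrow> 'v \<Rightarrow> 'w" where
  "iter_deriv f 0 h x = f x"
| "iter_deriv f (Suc k) h x = Lim (at 0) (diff_quot (iter_deriv f k h) x (h k))"

text \<open>Smoothness in the sense of Michal--Bastiani, for a map from an open subset \<open>U\<close> of the
  locally convex space \<open>V\<close> to the locally convex space \<open>W\<close>: all iterated directional derivatives
  exist and define continuous maps \<open>U \<times> V\<^sup>k \<rightarrow> W\<close>.\<close>

definition smooth_on ::
  "'v::{real_vector,t2_space} set \<Rightarrow> 'v set \<Rightarrow> 'w::{real_vector,t2_space} set \<Rightarrow> ('v \<Rightarrow> 'w) \<Rightarrow> bool"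
where
  "smooth_on V U W f \<longleftrightarrow>
     openin (top_of_set V) U \<and>
     (\<forall>k. (\<forall>x\<in>U. \<forall>h\<in>{..k} \<rightarrow> V. \<exists>y\<in>W. (diff_quot (iter_deriv f k h) x (h k) \<longlongrightarrow> y) (at 0)) \<and>
          continuous_map
            (prod_topology (top_of_set U) (product_topology (\<lambda>_. top_of_set V) {..<k}))
            (top_of_set W) (\<lambda>(x, h). iter_deriv f k h x))"

text \<open>Smooth curves on \<open>[0,1]\<close>, with one-sided derivatives at the end points; \<open>d k\<close> is the
  \<open>k\<close>-th derivative.\<close>

definition smooth_curve :: "(real \<Rightarrow> 'v::{real_vector,t2_space}) \<Rightarrow> bool" where
  "smooth_curve c \<longleftrightarrow>
     (\<exists>d :: nat \<Rightarrow> real \<Rightarrow> 'v. (\<forall>t\<in>{0..1}. d 0 t = c t) \<and>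
        (\<forall>k. \<forall>t\<in>{0..1}.
           ((\<lambda>s. (d k s - d k t) /\<^sub>R (s - t)) \<longlongrightarrow> d (Suc k) t) (at t within {0..1})))"

definition has_weak_integral :: "(real \<Rightarrow> 'v::{real_vector,t2_space}) \<Rightarrow> 'v \<Rightarrow> bool" where
  "has_weak_integral c y \<longleftrightarrow>
     (\<forall>l :: 'v \<Rightarrow> real. linear l \<and> continuous_on UNIV l \<longrightarrow>
        ((\<lambda>t. l (c t)) has_integral l y) {0..1})"

definition mackey_complete :: "'v::{real_vector,t2_space} itself \<Rightarrow> bool" where
  "mackey_complete _ \<longleftrightarrow> (\<forall>c :: real \<Rightarrow> 'v. smooth_curve c \<longrightarrow> (\<exists>y. has_weak_integral c y))"


section \<open>Continuous inverse algebras\<close>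

definition alg_units :: "'a::monoid_mult set" where
  "alg_units = {a. \<exists>b. a * b = 1 \<and> b * a = 1}"

definition alg_inverse :: "'a::monoid_mult \<Rightarrow> 'a" where
  "alg_inverse a = (THE b. a * b = 1 \<and> b * a = 1)"

locale continuous_inverse_algebra = vector_space scaleK
  for scaleK :: "'k::real_or_complex \<Rightarrow> 'a::{real_algebra_1,t2_space} \<Rightarrow> 'a" +
  assumes scaleK_of_real: "scaleK (of_real r) a = r *\<^sub>R a"
    and scaleK_mult_left: "scaleK c a * b = scaleK c (a * b)"
    and scaleK_mult_right: "a * scaleK c b = scaleK c (a * b)"
    and locally_convex: "locally_convex_space (UNIV :: 'a set)"
    and continuous_scaleK: "continuous_on UNIV (\<lambda>(c, a). scaleK c a)"
    and continuous_mult: "continuous_on UNIV (\<lambda>(a :: 'a, b). a * b)"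
    and open_units: "open (alg_units :: 'a set)"
    and continuous_inverse: "continuous_on alg_units (alg_inverse :: 'a \<Rightarrow> 'a)"

definition Aut_alg :: "('k::real_or_complex \<Rightarrow> 'a::{real_algebra_1,t2_space} \<Rightarrow> 'a) \<Rightarrow> ('a \<Rightarrow> 'a) monoid"
where
  "Aut_alg scaleK =
     \<lparr>carrier = {\<psi>. Vector_Spaces.linear scaleK scaleK \<psi> \<and> (\<forall>a b. \<psi> (a * b) = \<psi> a * \<psi> b) \<and>
                     \<psi> 1 = 1 \<and> homeomorphic_map euclidean euclidean \<psi>},
      monoid.mult = (\<circ>), one = id\<rparr>"


section \<open>Manifolds and Lie groups\<close>

text \<open>A manifold on the set \<^term>\<open>topspace (mtop M)\<close>, modeled on the locally convex space
  \<^term>\<open>model M\<close>, is given by its topology and a (not necessarily maximal) atlas of pairs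
  (domain, chart).\<close>

record ('x, 'v) manifold =
  mtop :: "'x topology"
  atlas :: "('x set \<times> ('x \<Rightarrow> 'v)) set"
  model :: "'v set"

definition smooth_manifold :: "('x, 'v::{real_vector,t2_space}) manifold \<Rightarrow> bool" where
  "smooth_manifold M \<longleftrightarrow>
     locally_convex_space (model M) \<and>
     Hausdorff_space (mtop M) \<and>
     topspace (mtop M) = (\<Union>(U, \<phi>)\<in>atlas M. U) \<and>
     (\<forall>(U, \<phi>)\<in>atlas M.
        openin (mtop M) U \<and> openin (top_of_set (model M)) (\<phi> ` U) \<and>
        homeomorphic_map (subtopology (mtop M) U) (top_of_set (\<phi> ` U)) \<phi>) \<and>
     (\<forall>(U, \<phi>)\<in>atlas M. \<forall>(U', \<phi>')\<in>atlas M.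
        smooth_on (model M) (\<phi> ` (U \<inter> U')) (model M) (\<phi>' \<circ> inv_into U \<phi>))"

definition smooth_map ::
  "('x, 'v::{real_vector,t2_space}) manifold \<Rightarrow> ('y, 'w::{real_vector,t2_space}) manifold \<Rightarrow>
   ('x \<Rightarrow> 'y) \<Rightarrow> bool" where
  "smooth_map M N f \<longleftrightarrow>
     continuous_map (mtop M) (mtop N) f \<and>
     (\<forall>(U, \<phi>)\<in>atlas M. \<forall>(W, \<psi>)\<in>atlas N.
        smooth_on (model M) (\<phi> ` (U \<inter> f -` W)) (model N) (\<psi> \<circ> f \<circ> inv_into U \<phi>))"

definition diffeomorphism ::
  "('x, 'v::{real_vector,t2_space}) manifold \<Rightarrow> ('y, 'w::{real_vector,t2_space}) manifold \<Rightarrow>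
   ('x \<Rightarrow> 'y) \<Rightarrow> bool" where
  "diffeomorphism M N f \<longleftrightarrow>
     bij_betw f (topspace (mtop M)) (topspace (mtop N)) \<and>
     smooth_map M N f \<and> smooth_map N M (inv_into (topspace (mtop M)) f)"

definition vector_manifold :: "'v::{real_vector,t2_space} set \<Rightarrow> ('v, 'v) manifold" where
  "vector_manifold V = \<lparr>mtop = top_of_set V, atlas = {(V, id)}, model = V\<rparr>"

definition prod_manifold :: "('x, 'v) manifold \<Rightarrow> ('y, 'w) manifold \<Rightarrow> ('x \<times> 'y, 'v \<times> 'w) manifold"
where
  "prod_manifold M N =
     \<lparr>mtop = prod_topology (mtop M) (mtop N),
      atlas = {(U \<times> W, map_prod \<phi> \<psi>) | U \<phi> W \<psi>. (U, \<phi>) \<in> atlas M \<and> (W, \<psi>) \<in> atlas N},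
      model = model M \<times> model N\<rparr>"

definition open_submanifold :: "('x, 'v) manifold \<Rightarrow> 'x set \<Rightarrow> ('x, 'v) manifold" where
  "open_submanifold M X =
     \<lparr>mtop = subtopology (mtop M) X, atlas = {(U \<inter> X, \<phi>) | U \<phi>. (U, \<phi>) \<in> atlas M}, model = model M\<rparr>"

definition lie_group :: "('x, 'b) monoid_scheme \<Rightarrow> ('x, 'v::{real_vector,t2_space}) manifold \<Rightarrow> bool"
where
  "lie_group G M \<longleftrightarrow>
     group G \<and> smooth_manifold M \<and> topspace (mtop M) = carrier G \<and>
     smooth_map (prod_manifold M M) M (\<lambda>(x, y). x \<otimes>\<^bsub>G\<^esub> y) \<and>
     smooth_map M M (m_inv G)"

definition lie_group_morphism ::
  "('x, 'b) monoid_scheme \<Rightarrow> ('x, 'v::{real_vector,t2_space}) manifold \<Rightarrow>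
   ('y, 'c) monoid_scheme \<Rightarrow> ('y, 'w::{real_vector,t2_space}) manifold \<Rightarrow> ('x \<Rightarrow> 'y) \<Rightarrow> bool" where
  "lie_group_morphism G M H N f \<longleftrightarrow> f \<in> hom G H \<and> smooth_map M N f"

text \<open>\<open>q : P \<rightarrow> B\<close> is a smooth locally trivial principal bundle for the right action \<open>act\<close> of the
  Lie group \<open>N\<close> on \<open>P\<close>: over small open sets there are equivariant trivializations.\<close>

definition principal_bundle ::
  "('n, 'b) monoid_scheme \<Rightarrow> ('n, 'u::{real_vector,t2_space}) manifold \<Rightarrow>
   ('p, 'v::{real_vector,t2_space}) manifold \<Rightarrow> ('p \<Rightarrow> 'n \<Rightarrow> 'p) \<Rightarrow>
   ('x, 'w::{real_vector,t2_space}) manifold \<Rightarrow> ('p \<Rightarrow> 'x) \<Rightarrow> bool" where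
  "principal_bundle N MN P act B q \<longleftrightarrow>
     lie_group N MN \<and> smooth_manifold P \<and> smooth_manifold B \<and> smooth_map P B q \<and>
     smooth_map (prod_manifold P MN) P (\<lambda>(x, n). act x n) \<and>
     (\<forall>x\<in>topspace (mtop P). act x \<one>\<^bsub>N\<^esub> = x) \<and>
     (\<forall>x\<in>topspace (mtop P). \<forall>n\<in>carrier N. \<forall>n'\<in>carrier N. act x (n \<otimes>\<^bsub>N\<^esub> n') = act (act x n) n') \<and>
     (\<forall>b\<in>topspace (mtop B). \<exists>U \<tau>. openin (mtop B) U \<and> b \<in> U \<and>
        diffeomorphism (prod_manifold (open_submanifold B U) MN)
          (open_submanifold P {x \<in> topspace (mtop P). q x \<in> U}) \<tau> \<and>
        (\<forall>u\<in>U. \<forall>n\<in>carrier N. q (\<tau> (u, n)) = u) \<and>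
        (\<forall>u\<in>U. \<forall>n\<in>carrier N. \<forall>n'\<in>carrier N. \<tau> (u, n \<otimes>\<^bsub>N\<^esub> n') = act (\<tau> (u, n)) n'))"

definition lie_group_extension ::
  "('n, 'b) monoid_scheme \<Rightarrow> ('n, 'u::{real_vector,t2_space}) manifold \<Rightarrow> ('n \<Rightarrow> 'h) \<Rightarrow>
   ('h, 'c) monoid_scheme \<Rightarrow> ('h, 'v::{real_vector,t2_space}) manifold \<Rightarrow> ('h \<Rightarrow> 'g) \<Rightarrow>
   ('g, 'd) monoid_scheme \<Rightarrow> ('g, 'w::{real_vector,t2_space}) manifold \<Rightarrow> bool" where
  "lie_group_extension N MN \<iota> H MH q G MG \<longleftrightarrow>
     lie_group N MN \<and> lie_group H MH \<and> lie_group G MG \<and>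
     lie_group_morphism N MN H MH \<iota> \<and> lie_group_morphism H MH G MG q \<and>
     inj_on \<iota> (carrier N) \<and> \<iota> ` carrier N = kernel H G q \<and> q ` carrier H = carrier G \<and>
     principal_bundle N MN MH (\<lambda>h n. h \<otimes>\<^bsub>H\<^esub> \<iota> n) MG q"

definition smooth_action ::
  "('k::real_or_complex \<Rightarrow> 'a::{real_algebra_1,t2_space} \<Rightarrow> 'a) \<Rightarrow> ('g, 'b) monoid_scheme \<Rightarrow>
   ('g, 'v::{real_vector,t2_space}) manifold \<Rightarrow> ('g \<Rightarrow> 'a \<Rightarrow> 'a) \<Rightarrow> bool" where
  "smooth_action scaleK G MG \<mu> \<longleftrightarrow>
     \<mu> \<in> hom G (Aut_alg scaleK) \<and>
     smooth_map (prod_manifold MG (vector_manifold UNIV)) (vector_manifold UNIV) (\<lambda>(g, a). \<mu> g a)"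


section \<open>Finitely generated projective modules\<close>

definition right_module :: "('e::ab_group_add \<Rightarrow> 'a::ring_1 \<Rightarrow> 'e) \<Rightarrow> bool" where
  "right_module act \<longleftrightarrow>
     (\<forall>s t a. act (s + t) a = act s a + act t a) \<and>
     (\<forall>s a b. act s (a + b) = act s a + act s b) \<and>
     (\<forall>s a b. act s (a * b) = act (act s a) b) \<and>
     (\<forall>s. act s 1 = s)"

text \<open>The scalar multiplication of a module induced by the central embedding \<open>c \<mapsto> c \<cdot> 1\<close>
  of the ground field into the algebra.\<close>

definition scale_module :: "('k \<Rightarrow> 'a::one \<Rightarrow> 'a) \<Rightarrow> ('e \<Rightarrow> 'a \<Rightarrow> 'e) \<Rightarrow> 'k \<Rightarrow> 'e \<Rightarrow> 'e" where
  "scale_module scaleK act c s = act s (scaleK c 1)"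

text \<open>\<open>\<theta>\<close> identifies the right module \<open>E\<close> with \<open>pA\<^sup>n\<close>, where \<open>p\<close> is an idempotent matrix, as a
  module and as a topological space.\<close>

definition fg_projective_via ::
  "('e::{ab_group_add,topological_space} \<Rightarrow> 'a::{ring_1,topological_space} \<Rightarrow> 'e) \<Rightarrow>
   'a^'n^'n \<Rightarrow> ('e \<Rightarrow> 'a^'n) \<Rightarrow> bool" where
  "fg_projective_via act p \<theta> \<longleftrightarrow>
     right_module act \<and> p ** p = p \<and>
     (\<forall>s t. \<theta> (s + t) = \<theta> s + \<theta> t) \<and>
     (\<forall>s a. \<theta> (act s a) = (\<chi> i. \<theta> s $ i * a)) \<and>
     homeomorphic_map euclidean (top_of_set (range (\<lambda>x. p *v x))) \<theta>"

definition End_mod ::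
  "('e::{ab_group_add,topological_space} \<Rightarrow> 'a \<Rightarrow> 'e) \<Rightarrow> ('e \<Rightarrow> 'e) monoid" where
  "End_mod act =
     \<lparr>carrier = {\<phi>. (\<forall>s t. \<phi> (s + t) = \<phi> s + \<phi> t) \<and> (\<forall>s a. \<phi> (act s a) = act (\<phi> s) a) \<and>
                     continuous_on UNIV \<phi>},
      monoid.mult = (\<circ>), one = id\<rparr>"

definition GL_mod ::
  "('e::{ab_group_add,topological_space} \<Rightarrow> 'a \<Rightarrow> 'e) \<Rightarrow> ('e \<Rightarrow> 'e) monoid" where
  "GL_mod act = units_of (End_mod act)"

definition GL_K ::
  "('k::real_or_complex \<Rightarrow> 'a::one \<Rightarrow> 'a) \<Rightarrow>
   ('e::{ab_group_add,topological_space} \<Rightarrow> 'a \<Rightarrow> 'e) \<Rightarrow> ('e \<Rightarrow> 'e) set" where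
  "GL_K scaleK act =
     {\<phi>. Vector_Spaces.linear (scale_module scaleK act) (scale_module scaleK act) \<phi> \<and>
          homeomorphic_map euclidean euclidean \<phi>}"

definition GammaL ::
  "('k::real_or_complex \<Rightarrow> 'a::{real_algebra_1,t2_space} \<Rightarrow> 'a) \<Rightarrow>
   ('e::{ab_group_add,topological_space} \<Rightarrow> 'a \<Rightarrow> 'e) \<Rightarrow> ('e \<Rightarrow> 'e) monoid" where
  "GammaL scaleK act =
     \<lparr>carrier = {\<phi> \<in> GL_K scaleK act.
         \<exists>\<psi>\<in>carrier (Aut_alg scaleK). \<forall>s a. \<phi> (act s a) = act (\<phi> s) (\<psi> a)},
      monoid.mult = (\<circ>), one = id\<rparr>"

definition Aut_alg_mod ::
  "('k::real_or_complex \<Rightarrow> 'a::{real_algebra_1,t2_space} \<Rightarrow> 'a) \<Rightarrow>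
   ('e::{ab_group_add,topological_space} \<Rightarrow> 'a \<Rightarrow> 'e) \<Rightarrow> ('a \<Rightarrow> 'a) set" where
  "Aut_alg_mod scaleK act =
     {\<psi> \<in> carrier (Aut_alg scaleK). \<exists>\<phi>\<in>GL_K scaleK act. \<forall>s a. \<phi> (act s a) = act (\<phi> s) (\<psi> a)}"


section \<open>The groups and structures of the extension\<close>

definition G_hat ::
  "('k::real_or_complex \<Rightarrow> 'a::{real_algebra_1,t2_space} \<Rightarrow> 'a) \<Rightarrow>
   ('e::{ab_group_add,topological_space} \<Rightarrow> 'a \<Rightarrow> 'e) \<Rightarrow>
   ('g, 'b) monoid_scheme \<Rightarrow> ('g \<Rightarrow> 'a \<Rightarrow> 'a) \<Rightarrow> (('e \<Rightarrow> 'e) \<times> 'g) monoid" where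
  "G_hat scaleK act G \<mu> =
     (GammaL scaleK act \<times>\<times> G)
       \<lparr>carrier := {(\<phi>, g). \<phi> \<in> carrier (GammaL scaleK act) \<and> g \<in> carrier G \<and>
                      (\<forall>s a. \<phi> (act s a) = act (\<phi> s) (\<mu> g a))}\<rparr>"

text \<open>\<^term>\<open>corner p\<close> is \<open>pM\<^sub>n(A)p\<close>; its elements act by left multiplication on \<open>E \<cong> pA\<^sup>n\<close>.\<close>

definition corner :: "'a::ring_1^'n^'n \<Rightarrow> ('a^'n^'n) set" where
  "corner p = range (\<lambda>x. p ** x ** p)"

definition end_of_matrix :: "('e \<Rightarrow> 'a::ring_1^'n) \<Rightarrow> 'a^'n^'n \<Rightarrow> 'e \<Rightarrow> 'e" where
  "end_of_matrix \<theta> x s = inv_into UNIV \<theta> (x *v \<theta> s)"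

text \<open>The natural structure on \<open>GL\<^sub>A(E)\<close>, with the identification
  \<open>End\<^sub>A(E) \<cong> pM\<^sub>n(A)p\<close> as its only chart.\<close>

definition GL_mod_manifold ::
  "('e::{ab_group_add,topological_space} \<Rightarrow> 'a::{ring_1,topological_space} \<Rightarrow> 'e) \<Rightarrow>
   'a^'n^'n \<Rightarrow> ('e \<Rightarrow> 'a^'n) \<Rightarrow> ('e \<Rightarrow> 'e, 'a^'n^'n) manifold" where
  "GL_mod_manifold act p \<theta> =
     (let \<kappa> = inv_into (corner p) (end_of_matrix \<theta>) in
      \<lparr>mtop = pullback_topology (carrier (GL_mod act)) \<kappa> (top_of_set (corner p)),
       atlas = {(carrier (GL_mod act), \<kappa>)},
       model = corner p\<rparr>)"

text \<open>\<^term>\<open>map_matrix (\<mu> g) p\<close> is \<open>g * p\<close>.\<close>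

definition gamma_mat :: "('g \<Rightarrow> 'a::ring_1 \<Rightarrow> 'a) \<Rightarrow> 'a^'n^'n \<Rightarrow> 'g \<Rightarrow> 'a^'n^'n" where
  "gamma_mat \<mu> p g =
     p ** map_matrix (\<mu> g) p + (mat 1 - p) ** (mat 1 - map_matrix (\<mu> g) p)"

definition U_G :: "('g, 'b) monoid_scheme \<Rightarrow> ('g \<Rightarrow> 'a::ring_1 \<Rightarrow> 'a) \<Rightarrow> 'a^'n^'n \<Rightarrow> 'g set" where
  "U_G G \<mu> p = {g \<in> carrier G. invertible (gamma_mat \<mu> p g)}"

definition S_E :: "('g \<Rightarrow> 'a::ring_1 \<Rightarrow> 'a) \<Rightarrow> 'a^'n^'n \<Rightarrow> ('e \<Rightarrow> 'a^'n) \<Rightarrow> 'g \<Rightarrow> 'e \<Rightarrow> 'e" where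
  "S_E \<mu> p \<theta> g s = inv_into UNIV \<theta> (gamma_mat \<mu> p g *v (\<chi> i. \<mu> g (\<theta> s $ i)))"

definition sigma_section ::
  "('g \<Rightarrow> 'a::ring_1 \<Rightarrow> 'a) \<Rightarrow> 'a^'n^'n \<Rightarrow> ('e \<Rightarrow> 'a^'n) \<Rightarrow> 'g \<Rightarrow> ('e \<Rightarrow> 'e) \<times> 'g" where
  "sigma_section \<mu> p \<theta> g = (S_E \<mu> p \<theta> g, g)"

text \<open>The property characterizing the natural structure \<open>MH\<close> on \<^const>\<open>G_hat\<close>: the map
  \<open>GL\<^sub>A(E) \<times> U\<^sub>G \<rightarrow> q\<^sup>-\<^sup>1(U\<^sub>G)\<close>, \<open>(\<phi>, g) \<mapsto> \<phi> \<sigma>(g)\<close>, is a diffeomorphism onto an open subset.\<close>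

definition natural_structure_G_hat ::
  "('k::real_or_complex \<Rightarrow> 'a::{real_algebra_1,t2_space} \<Rightarrow> 'a) \<Rightarrow>
   ('e::{ab_group_add,topological_space} \<Rightarrow> 'a \<Rightarrow> 'e) \<Rightarrow> 'a^'n^'n \<Rightarrow> ('e \<Rightarrow> 'a^'n) \<Rightarrow>
   ('g, 'b) monoid_scheme \<Rightarrow> ('g, 'm::{real_vector,t2_space}) manifold \<Rightarrow> ('g \<Rightarrow> 'a \<Rightarrow> 'a) \<Rightarrow>
   (('e \<Rightarrow> 'e) \<times> 'g, ('a^'n^'n) \<times> 'm) manifold \<Rightarrow> bool" where
  "natural_structure_G_hat scaleK act p \<theta> G MG \<mu> MH \<longleftrightarrow>
     (let U = U_G G \<mu> p; Q = {h \<in> carrier (G_hat scaleK act G \<mu>). snd h \<in> U} in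
      openin (mtop MG) U \<and> openin (mtop MH) Q \<and>
      diffeomorphism
        (prod_manifold (GL_mod_manifold act p \<theta>) (open_submanifold MG U))
        (open_submanifold MH Q)
        (\<lambda>(\<phi>, g). (\<phi>, \<one>\<^bsub>G\<^esub>) \<otimes>\<^bsub>G_hat scaleK act G \<mu>\<^esub> sigma_section \<mu> p \<theta> g))"

end

theory Submission
  imports Defs
begin

text \<open>The whole structure is read off from matrices. Identify \<open>E\<close> with \<open>pA\<^sup>n\<close>. A semilinear
  automorphism \<open>\<phi>\<close> over \<open>g\<close> is \<open>v \<mapsto> X (g \<sharp> v)\<close> for the matrix \<open>X\<close> whose columns are the images under
  \<open>\<phi>\<close> of the columns of \<open>p\<close>. The matrices that occur over \<open>g\<close> are those with \<open>pX = X = X (g * p)\<close> that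
  have a counterpart \<open>Y = (g * p) Y = Y p\<close> with \<open>XY = p\<close> and \<open>YX = g * p\<close>, and composition becomes
  \<open>(X, g)(X', g') = (X (g * X'), g g')\<close>. So the extension group is a subset of \<open>M\<^sub>n(A) \<times> G\<close>, and it gets
  the topology of this product.

  It remains to find charts, that is, to identify the sets of matrices over different \<open>g\<close>, which
  lie in the varying spaces \<open>p M\<^sub>n(A) (g * p)\<close>. This is the classical argument for neighbouring
  idempotents: if \<open>g\<close> is close to \<open>g\<^sub>0\<close>, then \<open>\<gamma> = (g\<^sub>0 * p)(g * p) + (1 - g\<^sub>0 * p)(1 - g * p)\<close> is close to
  \<open>1\<close>, hence invertible, and it intertwines \<open>g * p\<close> with \<open>g\<^sub>0 * p\<close>. Fix an element over \<open>g\<^sub>0\<close> with matrix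
  \<open>X\<^sub>0\<close> and counterpart \<open>Y\<^sub>0\<close>; there is one because \<open>\<mu> g\<^sub>0\<close> lifts to \<open>E\<close>. Then \<open>X\<^sub>0 (g * p)\<close> is a matrix
  over \<open>g\<close>, with counterpart \<open>\<gamma>\<^sup>-\<^sup>1 Y\<^sub>0\<close>. It depends smoothly on \<open>g\<close>, and \<open>X \<mapsto> X \<gamma>\<^sup>-\<^sup>1 Y\<^sub>0\<close> maps the matrices
  over \<open>g\<close> onto the unit group of \<open>p M\<^sub>n(A) p\<close>, which is the same for all \<open>g\<close> and is a model of \<open>GL\<^sub>A(E)\<close>.
  Together with the charts of \<open>G\<close> these maps form the atlas. For \<open>g\<^sub>0 = 1\<close> and the identity of \<open>E\<close> one
  gets the section \<open>\<sigma>\<close> over \<open>U\<^sub>G\<close>.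

  Changes of charts, group operations, sections and trivializations are now composed of the
  product and the inversion of matrices and of the action of \<open>G\<close> on matrices, so they are smooth.
  The theorem \<open>smooth_map_into_induced\<close> makes this precise: a map into such a subset is smooth as
  soon as its composition with the inclusion is. That both maps of each trivialization are inverse
  to each other is then a computation in the group alone.

  Two analytic facts carry this. The first is the chain rule \<open>smooth_on_compose\<close> for smooth maps
  between locally convex spaces. It rests on the mean value theorem \<open>mean_value_convex\<close>, which makes
  difference quotients jointly continuous, and on the criterion \<open>smooth_on_familyI\<close>: a map is smooth
  if it belongs to a set of maps with parameters that is closed under directional derivatives. The
  second is \<open>smooth_on_matrix_inv\<close>: the invertible matrices form an open set on which inversion is
  smooth. Near the identity the inverse is found by eliminating one row after the other, which
  needs only the inverses of elements of \<open>A\<close> close to \<open>1\<close>. So inversion is continuous, and it is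
  smooth because its derivative \<open>h \<mapsto> - x\<^sup>-\<^sup>1 h x\<^sup>-\<^sup>1\<close> is again polynomial in \<open>x\<^sup>-\<^sup>1\<close>.\<close>

section \<open>Convergence in locally convex spaces\<close>

text \<open>The directions of iterated derivatives are drawn from one infinite sequence of vectors, so
  that derivatives of all orders have the same type.\<close>

abbreviation sequences_in :: "'v set \<Rightarrow> (nat \<Rightarrow> 'v) set" where
  "sequences_in V \<equiv> UNIV \<rightarrow> V"

lemma tendsto_coordinatewise:
  fixes P :: "'c \<Rightarrow> 'i \<Rightarrow> 'v::topological_space"
  assumes "\<And>i. ((\<lambda>z. P z i) \<longlongrightarrow> p i) F"
  shows "(P \<longlongrightarrow> p) F"
proof -
  have "limitin (product_topology (\<lambda>_. euclidean) UNIV) P p F"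
    unfolding limitin_componentwise using assms by auto
  then show ?thesis
    by (simp add: euclidean_product_topology)
qed

lemma lcs_subspace: "locally_convex_space V \<Longrightarrow> subspace V"
  by (simp add: locally_convex_space_def)

text \<open>A locally convex space carries the subspace topology of an ambient type whose own addition
  need not be continuous. So the usual limit laws hold only for maps that eventually stay in the
  space.\<close>

lemma tendsto_add_lcs:
  assumes "locally_convex_space V" "(f \<longlongrightarrow> a) F" "(g \<longlongrightarrow> b) F"
    and "\<forall>\<^sub>F z in F. f z \<in> V" "\<forall>\<^sub>F z in F. g z \<in> V" "a \<in> V" "b \<in> V"
  shows "((\<lambda>z. f z + g z) \<longlongrightarrow> a + b) F"
proof -
  have "continuous_on (V \<times> V) (\<lambda>(x, y). x + y)"
    using assms by (simp add: locally_convex_space_def)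
  moreover have "((\<lambda>z. (f z, g z)) \<longlongrightarrow> (a, b)) F"
    by (intro tendsto_Pair assms)
  moreover have "\<forall>\<^sub>F z in F. (f z, g z) \<in> V \<times> V"
    using assms(4,5) by eventually_elim simp
  ultimately show ?thesis
    using continuous_on_tendsto_compose[of "V \<times> V" "\<lambda>(x, y). x + y" "\<lambda>z. (f z, g z)" "(a, b)" F] assms
    by simp
qed

lemma tendsto_scaleR_lcs:
  assumes "locally_convex_space V" "(f \<longlongrightarrow> a) F" "(r \<longlongrightarrow> c) F"
    and "\<forall>\<^sub>F z in F. f z \<in> V" "a \<in> V"
  shows "((\<lambda>z. r z *\<^sub>R f z) \<longlongrightarrow> c *\<^sub>R a) F"
proof -
  have "continuous_on (UNIV \<times> V) (\<lambda>(r::real, x). r *\<^sub>R x)"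
    using assms by (simp add: locally_convex_space_def)
  moreover have "((\<lambda>z. (r z, f z)) \<longlongrightarrow> (c, a)) F"
    by (intro tendsto_Pair assms)
  moreover have "\<forall>\<^sub>F z in F. (r z, f z) \<in> UNIV \<times> V"
    using assms(4) by eventually_elim simp
  ultimately show ?thesis
    using continuous_on_tendsto_compose[of "UNIV \<times> V" "\<lambda>(x, y). x *\<^sub>R y" "\<lambda>z. (r z, f z)" "(c, a)" F] assms
    by simp
qed

lemma tendsto_diff_lcs:
  assumes "locally_convex_space V" "(f \<longlongrightarrow> a) F" "(g \<longlongrightarrow> b) F"
    and "\<forall>\<^sub>F z in F. f z \<in> V" "\<forall>\<^sub>F z in F. g z \<in> V" "a \<in> V" "b \<in> V"
  shows "((\<lambda>z. f z - g z) \<longlongrightarrow> a - b) F"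
proof -
  note V = lcs_subspace[OF assms(1)]
  have "((\<lambda>z. (-1) *\<^sub>R g z) \<longlongrightarrow> (-1) *\<^sub>R b) F"
    using assms by (intro tendsto_scaleR_lcs[OF assms(1)] tendsto_const) auto
  then have "((\<lambda>z. f z + (-1) *\<^sub>R g z) \<longlongrightarrow> a + (-1) *\<^sub>R b) F"
    using assms V
    by (intro tendsto_add_lcs[OF assms(1)] assms(4) eventually_mono[OF assms(5)])
      (auto intro: subspace_scale subspace_neg)
  then show ?thesis by simp
qed

lemma tendsto_sum_lcs:
  assumes V: "locally_convex_space V" and "finite J"
    and "\<And>j. j \<in> J \<Longrightarrow> (f j \<longlongrightarrow> a j) F"
    and "\<And>j. j \<in> J \<Longrightarrow> \<forall>\<^sub>F z in F. f j z \<in> V" "\<And>j. j \<in> J \<Longrightarrow> a j \<in> V"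
  shows "((\<lambda>z. \<Sum>j\<in>J. f j z) \<longlongrightarrow> (\<Sum>j\<in>J. a j)) F"
  using assms(2-)
proof (induction J rule: finite_induct)
  case empty then show ?case by simp
next
  case (insert j J)
  have ev: "\<forall>\<^sub>F z in F. \<forall>i\<in>J. f i z \<in> V"
    using insert by (intro eventually_ball_finite) auto
  then have "\<forall>\<^sub>F z in F. (\<Sum>i\<in>J. f i z) \<in> V"
    by eventually_elim (auto intro: subspace_sum[OF lcs_subspace[OF V]])
  with insert have "((\<lambda>z. f j z + (\<Sum>j\<in>J. f j z)) \<longlongrightarrow> a j + (\<Sum>j\<in>J. a j)) F"
    by (intro tendsto_add_lcs[OF V]) (auto intro: subspace_sum[OF lcs_subspace[OF V]])
  then show ?case using insert by simp
qed

lemma openin_lcs_translate: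
  assumes V: "locally_convex_space V" and "a \<in> V" "openin (top_of_set V) S"
  shows "openin (top_of_set V) {x \<in> V. x + a \<in> S}"
proof -
  have "continuous_on V (\<lambda>x. x + a)"
    unfolding continuous_on_def
    by (auto intro!: tendsto_add_lcs[OF V] tendsto_ident_at simp: assms eventually_at_filter)
  moreover have "(\<lambda>x. x + a) \<in> V \<rightarrow> V"
    using assms lcs_subspace[OF V] by (auto intro: subspace_add)
  ultimately have "openin (top_of_set V) (V \<inter> (\<lambda>x. x + a) -` S)"
    using assms(3) by (rule continuous_openin_preimage)
  then show ?thesis by (simp add: Int_def vimage_def)
qed

text \<open>The definition provides convex neighbourhoods of zero only; translations are
  homeomorphisms.\<close>

lemma lcs_convex_neighbourhood:
  assumes V: "locally_convex_space V" and "a \<in> S" "openin (top_of_set V) S"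
  obtains N where "openin (top_of_set V) N" "convex N" "a \<in> N" "N \<subseteq> S"
proof -
  have aV: "a \<in> V" using assms(2,3) openin_imp_subset by blast
  note sV = lcs_subspace[OF V]
  have "0 \<in> {x \<in> V. x + a \<in> S}" using assms sV by (simp add: subspace_0)
  moreover have "\<forall>U. openin (top_of_set V) U \<and> 0 \<in> U \<longrightarrow>
      (\<exists>W. openin (top_of_set V) W \<and> convex W \<and> 0 \<in> W \<and> W \<subseteq> U)"
    using V unfolding locally_convex_space_def by (elim conjE)
  ultimately obtain W where W: "openin (top_of_set V) W" "convex W" "0 \<in> W" "W \<subseteq> {x \<in> V. x + a \<in> S}"
    using openin_lcs_translate[OF V aV assms(3)] by (auto dest!: spec[of _ "{x \<in> V. x + a \<in> S}"])
  have WV: "W \<subseteq> V" using W(1) openin_imp_subset by blast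
  let ?N = "{x \<in> V. x + - a \<in> W}"
  have "?N = (\<lambda>w. a + w) ` W"
  proof
    show "?N \<subseteq> (\<lambda>w. a + w) ` W"
      by (auto intro: image_eqI[where x = "x - a" for x])
    show "(\<lambda>w. a + w) ` W \<subseteq> ?N"
      using WV aV by (auto intro: subspace_add[OF sV])
  qed
  moreover have "openin (top_of_set V) ?N"
    using aV sV by (intro openin_lcs_translate[OF V _ W(1)]) (rule subspace_neg)
  moreover have "convex ((\<lambda>w. a + w) ` W)" using W(2) by (simp add: convex_translation_eq)
  ultimately show ?thesis
    using W(3,4) that[of ?N] aV by (auto simp: add.commute)
qed

lemma tendsto_lcsI:
  assumes V: "locally_convex_space V" and "a \<in> V"
    and ev: "\<And>N. openin (top_of_set V) N \<Longrightarrow> convex N \<Longrightarrow> a \<in> N \<Longrightarrow> \<forall>\<^sub>F z in F. f z \<in> N"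
  shows "(f \<longlongrightarrow> a) F"
proof (rule topological_tendstoI)
  fix S assume S: "open S" "a \<in> S"
  then have "openin (top_of_set V) (V \<inter> S)" by auto
  then obtain N where "openin (top_of_set V) N" "convex N" "a \<in> N" "N \<subseteq> V \<inter> S"
    using lcs_convex_neighbourhood[OF V, of a "V \<inter> S"] assms S by auto
  with ev[of N] show "\<forall>\<^sub>F z in F. f z \<in> S"
    by (auto elim!: eventually_mono)
qed

lemma eventually_openin:
  assumes "(f \<longlongrightarrow> a) F" "openin (top_of_set V) N" "a \<in> N" "\<forall>\<^sub>F z in F. f z \<in> V"
  shows "\<forall>\<^sub>F z in F. f z \<in> N"
proof -
  obtain T where T: "open T" "N = V \<inter> T" using assms(2) by (auto simp: openin_open)
  then have "\<forall>\<^sub>F z in F. f z \<in> T" using assms by (intro topological_tendstoD[OF assms(1)]) auto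
  with assms(4) show ?thesis by eventually_elim (simp add: T)
qed

text \<open>Bisection replaces integrals and continuous functionals. The slope of \<open>c\<close> over an interval
  is a convex combination of the slopes over its parts. So if the slope over \<open>[0, 1]\<close> were not
  in \<open>N\<close>, then neither would be the slopes over some nested sequence of intervals. But all
  slopes over short intervals around the common point \<open>s\<close> of these intervals are convex
  combinations of slopes that start or end at \<open>s\<close>, and those are close to the derivative, hence
  in the open set \<open>N\<close>.\<close>

lemma mean_value_convex:
  fixes c :: "real \<Rightarrow> 'w::{real_vector,t2_space}"
  assumes W: "subspace W" and N: "openin (top_of_set W) N" "convex N"
    and cW: "\<And>s. s \<in> {0..1} \<Longrightarrow> c s \<in> W"
    and der: "\<And>s. s \<in> {0..1} \<Longrightarrow> ((\<lambda>r. (c (s + r) - c s) /\<^sub>R r) \<longlongrightarrow> c' s) (at 0)"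
    and c'N: "\<And>s. s \<in> {0..1} \<Longrightarrow> c' s \<in> N"
  shows "c 1 - c 0 \<in> N"
proof -
  define P where "P = (\<lambda>a b. 0 \<le> a \<and> a < b \<and> b \<le> 1 \<longrightarrow> (c b - c a) /\<^sub>R (b - a) \<in> N)"
  have avg: "(c b - c a) /\<^sub>R (b - a) \<in> N"
    if "a < s" "s < b" "(c s - c a) /\<^sub>R (s - a) \<in> N" "(c b - c s) /\<^sub>R (b - s) \<in> N" for a b s
  proof -
    \<comment> \<open>The slope over the whole interval is the mean of the two others, weighted by the lengths.\<close>
    let ?u = "(s - a) / (b - a)" and ?v = "(b - s) / (b - a)"
    have "?u + ?v = 1"
      using that by (simp flip: add_divide_distrib)
    then have "?u *\<^sub>R ((c s - c a) /\<^sub>R (s - a)) + ?v *\<^sub>R ((c b - c s) /\<^sub>R (b - s)) \<in> N"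
      using that by (intro convexD[OF N(2)]) auto
    also have "?u *\<^sub>R ((c s - c a) /\<^sub>R (s - a)) + ?v *\<^sub>R ((c b - c s) /\<^sub>R (b - s))
      = (c s - c a) /\<^sub>R (b - a) + (c b - c s) /\<^sub>R (b - a)"
      using that by (simp only: scaleR_scaleR times_divide_eq_left) (simp add: inverse_eq_divide)
    also have "\<dots> = (c b - c a) /\<^sub>R (b - a)"
      by (simp flip: scaleR_right_distrib)
    finally show ?thesis .
  qed
  from zero_le_one have "P 0 1"
  proof (induction rule: Bolzano)
    case (trans a b d)
    show ?case
    proof (cases "a < b \<and> b < d")
      case True
      with trans show ?thesis
        unfolding P_def using avg[of a b d] by auto
    next
      case False
      with trans show ?thesis by (cases "a = b"; cases "b = d") auto
    qed
  next
    case (local x)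
    then have x: "x \<in> {0..1}" by simp
    obtain T where T: "open T" "N = W \<inter> T" using N by (auto simp: openin_open)
    have "\<forall>\<^sub>F r in at 0. (c (x + r) - c x) /\<^sub>R r \<in> T"
      using T c'N[OF x] by (intro topological_tendstoD[OF der[OF x]]) auto
    then obtain d where d: "d > 0" "\<And>r. r \<noteq> 0 \<Longrightarrow> \<bar>r\<bar> < d \<Longrightarrow> (c (x + r) - c x) /\<^sub>R r \<in> T"
      unfolding eventually_at by (auto simp: dist_real_def)
    have slope: "(c y - c x) /\<^sub>R (y - x) \<in> N" if "y \<noteq> x" "\<bar>y - x\<bar> < d" "y \<in> {0..1}" for y
      using d(2)[of "y - x"] that x cW W by (auto simp: T intro!: subspace_scale subspace_diff)
    have slope': "(c x - c y) /\<^sub>R (x - y) \<in> N" if "y \<noteq> x" "\<bar>y - x\<bar> < d" "y \<in> {0..1}" for y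
    proof -
      have "(c x - c y) /\<^sub>R (x - y) = (c y - c x) /\<^sub>R (y - x)"
        by (metis (no_types) minus_diff_eq scaleR_minus_left scaleR_minus_right inverse_minus_eq)
      then show ?thesis using slope that by simp
    qed
    have "P a b" if bounds: "a \<le> x" "x \<le> b" "b - a < d" for a b
      unfolding P_def
    proof clarify
      assume ab: "0 \<le> a" "a < b" "b \<le> 1"
      consider "a = x" | "b = x" | "a < x" "x < b" using bounds(1,2) by linarith
      then show "(c b - c a) /\<^sub>R (b - a) \<in> N"
      proof cases
        case 1 then show ?thesis using slope[of b] bounds ab by auto
      next
        case 2 then show ?thesis using slope'[of a] bounds ab by auto
      next
        case 3 then show ?thesis
          using avg[of a x b] slope[of b] slope'[of a] bounds ab by auto
      qed
    qed
    then show ?case using d(1) by blast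
  qed
  then show ?thesis by (simp add: P_def)
qed

section \<open>Smooth families\<close>

lemma iter_deriv_cong_directions:
  "(\<And>i. i < k \<Longrightarrow> h i = h' i) \<Longrightarrow> iter_deriv f k h x = iter_deriv f k h' x"
proof (induction k arbitrary: x)
  case 0 then show ?case by simp
next
  case (Suc k)
  then have "iter_deriv f k h = iter_deriv f k h'" by (intro ext Suc.IH) auto
  then show ?case using Suc.prems by simp
qed

text \<open>The map \<open>\<phi>\<close> depends on a point and on a sequence of directions; only the point moves.\<close>

abbreviation derivative_along ::
  "'v::{real_vector,t2_space} set \<Rightarrow> 'v set \<Rightarrow> nat \<Rightarrow> ('v \<Rightarrow> (nat \<Rightarrow> 'v) \<Rightarrow> 'w::{real_vector,t2_space}) \<Rightarrow>
   ('v \<Rightarrow> (nat \<Rightarrow> 'v) \<Rightarrow> 'w) \<Rightarrow> bool"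
where
  "derivative_along V U n \<phi> \<phi>' \<equiv>
     \<forall>x\<in>U. \<forall>p\<in>sequences_in V. (diff_quot (\<lambda>y. \<phi> y p) x (p n) \<longlongrightarrow> \<phi>' x p) (at 0)"

text \<open>A set of continuous maps \<open>\<phi> x p\<close> that is closed under derivatives with respect to \<open>x\<close> in
  the directions \<open>p n\<close>. A map is smooth if and only if it belongs to such a family. The families
  of most maps below are given by simple closure conditions, and no formula for their higher
  derivatives is needed.\<close>

definition smooth_family ::
  "'v::{real_vector,t2_space} set \<Rightarrow> 'v set \<Rightarrow> 'w::{real_vector,t2_space} set \<Rightarrow>
   ('v \<Rightarrow> (nat \<Rightarrow> 'v) \<Rightarrow> 'w) set \<Rightarrow> bool"
where
  "smooth_family V U W S \<longleftrightarrow>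
     (\<forall>\<phi>\<in>S. continuous_on (U \<times> sequences_in V) (\<lambda>(x, p). \<phi> x p) \<and>
        (\<forall>x\<in>U. \<forall>p\<in>sequences_in V. \<phi> x p \<in> W) \<and>
        (\<forall>n. \<exists>\<phi>'\<in>S. derivative_along V U n \<phi> \<phi>'))"

lemma smooth_onD:
  assumes "smooth_on V U W f" and V: "subspace V"
  shows smooth_on_openin: "openin (top_of_set V) U"
    and smooth_on_continuous_sequences:
      "continuous_on (U \<times> sequences_in V) (\<lambda>(x, p). iter_deriv f k p x)"
    and iter_deriv_in: "x \<in> U \<Longrightarrow> p \<in> sequences_in V \<Longrightarrow> iter_deriv f k p x \<in> W"
    and tendsto_iter_deriv: "x \<in> U \<Longrightarrow> p \<in> sequences_in V \<Longrightarrow>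
      (diff_quot (iter_deriv f k p) x (p k) \<longlongrightarrow> iter_deriv f (Suc k) p x) (at 0)"
proof -
  show "openin (top_of_set V) U" using assms(1) unfolding smooth_on_def by blast
  let ?X = "prod_topology (top_of_set U) (product_topology (\<lambda>_. top_of_set V) {..<k})"
  have smooth: "\<forall>x\<in>U. \<forall>h\<in>{..k} \<rightarrow> V. \<exists>y\<in>W. (diff_quot (iter_deriv f k h) x (h k) \<longlongrightarrow> y) (at 0)"
    and cont: "continuous_map ?X (top_of_set W) (\<lambda>(x, h). iter_deriv f k h x)"
    using assms(1) unfolding smooth_on_def by (blast+)
  have "continuous_map (top_of_set (U \<times> sequences_in V)) ?X (\<lambda>(x, p). (x, restrict p {..<k}))"
    unfolding case_prod_unfold
  proof (intro continuous_map_pairedI)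
    show "continuous_map (top_of_set (U \<times> sequences_in V)) (top_of_set U) fst"
      by (auto intro: continuous_on_fst[OF continuous_on_id])
    have "continuous_on (U \<times> sequences_in V) (\<lambda>x. snd x i)" for i
      by (rule continuous_on_product_then_coordinatewise[OF continuous_on_snd[OF continuous_on_id]])
    then show "continuous_map (top_of_set (U \<times> sequences_in V))
      (product_topology (\<lambda>_. top_of_set V) {..<k}) (\<lambda>x. restrict (snd x) {..<k})"
      unfolding continuous_map_componentwise by auto
  qed
  then have "continuous_map (top_of_set (U \<times> sequences_in V)) (top_of_set W)
      ((\<lambda>(x, h). iter_deriv f k h x) \<circ> (\<lambda>(x, p). (x, restrict p {..<k})))"
    using cont by (rule continuous_map_compose)
  moreover have "(\<lambda>(x, h). iter_deriv f k h x) \<circ> (\<lambda>(x, p). (x, restrict p {..<k}))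
      = (\<lambda>(x, p). iter_deriv f k p x)"
    by (auto simp: fun_eq_iff intro!: iter_deriv_cong_directions)
  ultimately have *: "continuous_map (top_of_set (U \<times> sequences_in V)) (top_of_set W)
      (\<lambda>(x, p). iter_deriv f k p x)" by simp
  then show "continuous_on (U \<times> sequences_in V) (\<lambda>(x, p). iter_deriv f k p x)"
    unfolding continuous_map_subtopology_eu by (elim conjE)
  show "iter_deriv f k p x \<in> W" if "x \<in> U" "p \<in> sequences_in V"
  proof -
    have "(\<lambda>(x, p). iter_deriv f k p x) \<in> U \<times> sequences_in V \<rightarrow> W"
      using * unfolding continuous_map_subtopology_eu by (elim conjE)
    from funcset_mem[OF this, of "(x, p)"] that show ?thesis by simp
  qed
  show "(diff_quot (iter_deriv f k p) x (p k) \<longlongrightarrow> iter_deriv f (Suc k) p x) (at 0)"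
    if "x \<in> U" "p \<in> sequences_in V"
  proof -
    have p: "p \<in> {..k} \<rightarrow> V" using that(2) by auto
    from bspec[OF bspec[OF smooth that(1)] p]
    obtain y where "(diff_quot (iter_deriv f k p) x (p k) \<longlongrightarrow> y) (at 0)"
      by (elim bexE)
    then show ?thesis by (simp add: tendsto_Lim)
  qed
qed

text \<open>The reindexing \<open>\<tau>\<close> makes the family closed: the direction of the next derivative of
  \<open>iter_deriv f k\<close> is always the one with number \<open>k\<close>, but it may be any of the given directions.\<close>

lemma smooth_family_iter_deriv:
  assumes f: "smooth_on V U W f" and V: "subspace V"
  shows "smooth_family V U W {\<lambda>x p. iter_deriv f k (p \<circ> \<tau>) x | k (\<tau> :: nat \<Rightarrow> nat). True}"
  unfolding smooth_family_def
proof (intro ballI conjI allI)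
  fix \<phi> assume "\<phi> \<in> {\<lambda>x p. iter_deriv f k (p \<circ> \<tau>) x | k (\<tau> :: nat \<Rightarrow> nat). True}"
  then obtain k and \<tau> :: "nat \<Rightarrow> nat" where \<phi>: "\<phi> = (\<lambda>x p. iter_deriv f k (p \<circ> \<tau>) x)" by blast
  have "continuous_on (U \<times> sequences_in V) (\<lambda>x. snd x (\<tau> i))" for i
    by (rule continuous_on_product_then_coordinatewise[OF continuous_on_snd[OF continuous_on_id]])
  then have "continuous_on (U \<times> sequences_in V) (\<lambda>(x, p). (x, p \<circ> \<tau>))"
    unfolding case_prod_unfold
    by (intro continuous_on_Pair continuous_on_fst continuous_on_id
      continuous_on_coordinatewise_then_product) simp
  then have "continuous_on (U \<times> sequences_in V) ((\<lambda>(x, p). iter_deriv f k p x) \<circ> (\<lambda>(x, p). (x, p \<circ> \<tau>)))"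
    by (rule continuous_on_compose)
      (auto intro!: continuous_on_subset[OF smooth_on_continuous_sequences[OF assms]])
  then show "continuous_on (U \<times> sequences_in V) (\<lambda>(x, p). \<phi> x p)"
    by (simp add: \<phi> o_def case_prod_unfold)
  show "\<phi> x p \<in> W" if "x \<in> U" "p \<in> sequences_in V" for x p
    unfolding \<phi> using that by (intro iter_deriv_in[OF assms]) auto
  fix n
  let ?\<phi>' = "\<lambda>x p. iter_deriv f (Suc k) (p \<circ> \<tau>(k := n)) x"
  have "(diff_quot (\<lambda>y. \<phi> y p) x (p n) \<longlongrightarrow> ?\<phi>' x p) (at 0)" if "x \<in> U" "p \<in> sequences_in V" for x p
  proof -
    have "iter_deriv f k (p \<circ> \<tau>) = iter_deriv f k (p \<circ> \<tau>(k := n))"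
      by (intro ext iter_deriv_cong_directions) auto
    moreover have "p \<circ> \<tau>(k := n) \<in> sequences_in V" using that by auto
    ultimately show ?thesis
      using tendsto_iter_deriv[OF assms that(1), of "p \<circ> \<tau>(k := n)" k] by (simp add: \<phi> del: iter_deriv.simps)
  qed
  then show "\<exists>\<phi>'\<in>{\<lambda>x p. iter_deriv f k (p \<circ> \<tau>) x | k (\<tau> :: nat \<Rightarrow> nat). True}. derivative_along V U n \<phi> \<phi>'"
    by (intro bexI[of _ ?\<phi>'] ballI CollectI exI[of _ "Suc k"] exI[of _ "\<tau>(k := n)"]) simp_all
qed

lemma eventually_line_in:
  assumes V: "locally_convex_space V" and "openin (top_of_set V) U" "x \<in> U" "h \<in> V"
  shows "\<forall>\<^sub>F t in at 0. x + t *\<^sub>R h \<in> U"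
proof -
  have xV: "x \<in> V" using assms(2,3) openin_imp_subset by blast
  have "((\<lambda>t. x + t *\<^sub>R h) \<longlongrightarrow> x + 0 *\<^sub>R h) (at 0)"
    by (rule tendsto_add_lcs[OF V tendsto_const tendsto_scaleR_lcs[OF V tendsto_const tendsto_ident_at]])
      (use assms xV subspace_scale[OF lcs_subspace[OF V]] subspace_0[OF lcs_subspace[OF V]] in auto)
  then have "((\<lambda>t. x + t *\<^sub>R h) \<longlongrightarrow> x) (at 0)" by simp
  from this assms(2,3) show ?thesis
    by (rule eventually_openin)
      (use assms xV subspace_add[OF lcs_subspace[OF V]] subspace_scale[OF lcs_subspace[OF V]] in auto)
qed

lemma tendsto_diff_quot_cong:
  assumes V: "locally_convex_space V" and "openin (top_of_set V) U" "x \<in> U" "h \<in> V"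
    and "\<And>y. y \<in> U \<Longrightarrow> f y = g y"
  shows "(diff_quot f x h \<longlongrightarrow> l) (at 0) \<longleftrightarrow> (diff_quot g x h \<longlongrightarrow> l) (at 0)"
proof (rule tendsto_cong)
  show "\<forall>\<^sub>F t in at 0. diff_quot f x h t = diff_quot g x h t"
    using eventually_line_in[OF assms(1-4)] by eventually_elim (simp add: diff_quot_def assms)
qed

text \<open>By induction, each iterated derivative of \<open>f\<close> agrees on \<open>U\<close> with a member of the family.\<close>

lemma smooth_on_familyI:
  assumes V: "locally_convex_space V" and U: "openin (top_of_set V) U"
    and S: "smooth_family V U W S"
    and f: "\<phi>\<^sub>0 \<in> S" "\<And>x p. x \<in> U \<Longrightarrow> p \<in> sequences_in V \<Longrightarrow> f x = \<phi>\<^sub>0 x p"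
  shows "smooth_on V U W f"
proof -
  note sV = lcs_subspace[OF V]
  have *: "\<exists>\<phi>\<in>S. \<forall>x\<in>U. \<forall>p\<in>sequences_in V. iter_deriv f k p x = \<phi> x p" for k
  proof (induction k)
    case 0 show ?case using f by (intro bexI[of _ \<phi>\<^sub>0]) simp_all
  next
    case (Suc k)
    then obtain \<phi> where \<phi>: "\<phi> \<in> S" "\<And>x p. x \<in> U \<Longrightarrow> p \<in> sequences_in V \<Longrightarrow> iter_deriv f k p x = \<phi> x p"
      by blast
    with S obtain \<phi>' where \<phi>': "\<phi>' \<in> S"
      "\<And>x p. x \<in> U \<Longrightarrow> p \<in> sequences_in V \<Longrightarrow> (diff_quot (\<lambda>y. \<phi> y p) x (p k) \<longlongrightarrow> \<phi>' x p) (at 0)"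
      unfolding smooth_family_def by metis
    have "iter_deriv f (Suc k) p x = \<phi>' x p" if "x \<in> U" "p \<in> sequences_in V" for x p
    proof -
      have "(diff_quot (iter_deriv f k p) x (p k) \<longlongrightarrow> \<phi>' x p) (at 0)"
        using that by (intro iffD2[OF tendsto_diff_quot_cong[OF V U that(1)] \<phi>'(2)[OF that]] \<phi>(2)) auto
      then show ?thesis by (simp add: tendsto_Lim)
    qed
    with \<phi>' show ?case by blast
  qed
  show ?thesis unfolding smooth_on_def
  proof (intro conjI allI ballI U)
    fix k
    obtain \<phi> where \<phi>: "\<phi> \<in> S" "\<And>x p. x \<in> U \<Longrightarrow> p \<in> sequences_in V \<Longrightarrow> iter_deriv f k p x = \<phi> x p"
      using *[of k] by blast
    have \<phi>S: "continuous_on (U \<times> sequences_in V) (\<lambda>(x, p). \<phi> x p)"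
      "\<And>x p. x \<in> U \<Longrightarrow> p \<in> sequences_in V \<Longrightarrow> \<phi> x p \<in> W"
      using S \<phi>(1) unfolding smooth_family_def by auto
    {
      fix x h assume x: "x \<in> U" and h: "h \<in> {..k} \<rightarrow> V"
      \<comment> \<open>The derivative looks at the first directions only, and the others may lie outside of
        \<open>V\<close>.\<close>
      define p where "p = (\<lambda>i. if i \<le> k then h i else 0)"
      have p: "p \<in> sequences_in V" using h sV by (auto simp: p_def subspace_0)
      obtain \<phi>' where \<phi>': "\<phi>' \<in> S"
        "(diff_quot (\<lambda>y. \<phi> y p) x (p k) \<longlongrightarrow> \<phi>' x p) (at 0)"
        using S \<phi>(1) x p unfolding smooth_family_def by metis
      have "\<phi>' x p \<in> W" using S \<phi>'(1) x p unfolding smooth_family_def by blast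
      moreover have "iter_deriv f k h = iter_deriv f k p"
        by (intro ext iter_deriv_cong_directions) (auto simp: p_def)
      then have "(diff_quot (iter_deriv f k h) x (h k) \<longlongrightarrow> \<phi>' x p) (at 0)"
        using iffD2[OF tendsto_diff_quot_cong[OF V U x, of "p k", OF _ \<phi>(2)[OF _ p]] \<phi>'(2)] p
        by (simp add: Pi_iff) (simp add: p_def)
      ultimately show "\<exists>y\<in>W. (diff_quot (iter_deriv f k h) x (h k) \<longlongrightarrow> y) (at 0)"
        by (intro bexI)
    }
    let ?X = "prod_topology (top_of_set U) (product_topology (\<lambda>_. top_of_set V) {..<k})"
    \<comment> \<open>Points of the finite product are undefined outside of the index set. Filling up with zero
      embeds it continuously into the product over all indices.\<close>
    let ?e = "\<lambda>(x, h). (x, \<lambda>i. if i < k then h i else 0)"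
    have e: "continuous_map ?X (top_of_set (U \<times> sequences_in V)) ?e"
    proof -
      have "continuous_map ?X euclidean (\<lambda>z. if i < k then snd z i else 0)" for i
      proof (cases "i < k")
        case True
        then have "continuous_map (product_topology (\<lambda>_. top_of_set V) {..<k}) (top_of_set V) (\<lambda>h. h i)"
          by (intro continuous_map_product_projection) simp
        then have "continuous_map ?X (top_of_set V) ((\<lambda>h. h i) \<circ> snd)"
          using continuous_map_snd continuous_map_compose by blast
        with True show ?thesis
          by (simp add: continuous_map_in_subtopology o_def)
      qed simp
      then have "continuous_map ?X euclidean (\<lambda>z. (\<lambda>i. if i < k then snd z i else 0))"
        unfolding euclidean_product_topology[symmetric] continuous_map_componentwise_UNIV by blast
      moreover have "continuous_map ?X euclidean fst"
        by (metis continuous_map_fst continuous_map_in_subtopology)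
      ultimately have "continuous_map ?X (prod_topology euclidean euclidean) ?e"
        unfolding case_prod_unfold by (intro continuous_map_pairedI) auto
      then have "continuous_map ?X euclidean ?e"
        unfolding prod_topology_euclidean .
      moreover have "?e \<in> topspace ?X \<rightarrow> U \<times> sequences_in V"
      proof
        fix z assume "z \<in> topspace ?X"
        then have "fst z \<in> U" "snd z \<in> {..<k} \<rightarrow>\<^sub>E V" by (simp_all add: mem_Times_iff)
        then show "?e z \<in> U \<times> sequences_in V"
          using subspace_0[OF sV] by (simp add: case_prod_unfold PiE_iff Pi_iff)
      qed
      ultimately show ?thesis
        unfolding continuous_map_in_subtopology by (intro conjI)
    qed
    have "continuous_map (top_of_set (U \<times> sequences_in V)) (top_of_set W) (\<lambda>(x, p). \<phi> x p)"
      unfolding continuous_map_subtopology_eu by (intro conjI \<phi>S(1)) (use \<phi>S(2) in \<open>simp add: Pi_iff split_paired_all\<close>)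
    from continuous_map_compose[OF e this]
    show "continuous_map ?X (top_of_set W) (\<lambda>(x, h). iter_deriv f k h x)"
    proof (rule continuous_map_eq)
      fix z assume "z \<in> topspace ?X"
      then obtain x h where z: "z = (x, h)" "x \<in> U" "h \<in> {..<k} \<rightarrow>\<^sub>E V" by auto
      define h0 where "h0 = (\<lambda>i. if i < k then h i else 0)"
      have "h0 \<in> sequences_in V"
        using z(3) subspace_0[OF sV] by (simp add: h0_def PiE_iff Pi_iff)
      then have "iter_deriv f k h0 x = \<phi> x h0"
        using z(2) by (intro \<phi>(2))
      moreover have "iter_deriv f k h x = iter_deriv f k h0 x"
        by (rule iter_deriv_cong_directions) (simp add: h0_def)
      ultimately show "((\<lambda>(x, p). \<phi> x p) \<circ> ?e) z = (\<lambda>(x, h). iter_deriv f k h x) z"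
        by (simp add: z(1) h0_def)
    qed
  qed
qed

section \<open>The chain rule\<close>

text \<open>Strict differentiability: base point, directions and step may all vary. By continuity, the
  derivatives along the whole segment from \<open>X z\<close> to \<open>X z + T z *\<^sub>R P z k\<close> are close to the
  limit, uniformly in the position \<open>s \<in> [0, 1]\<close> on the segment; by the mean value theorem so is
  the difference quotient.\<close>

lemma tendsto_diff_quot_iter_deriv:
  fixes f :: "'v::{real_vector,t2_space} \<Rightarrow> 'w::{real_vector,t2_space}"
  assumes V: "locally_convex_space V" and W: "locally_convex_space W" and f: "smooth_on V U W f"
    and X: "(X \<longlongrightarrow> x) F" "x \<in> U" "\<forall>\<^sub>F z in F. X z \<in> V"
    and P: "\<And>i. ((\<lambda>z. P z i) \<longlongrightarrow> p i) F" "p \<in> sequences_in V" "\<forall>\<^sub>F z in F. P z \<in> sequences_in V"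
    and T: "(T \<longlongrightarrow> 0) F" "\<forall>\<^sub>F z in F. T z \<noteq> 0"
  shows "((\<lambda>z. diff_quot (iter_deriv f k (P z)) (X z) (P z k) (T z)) \<longlongrightarrow> iter_deriv f (Suc k) p x) F"
proof (rule tendsto_lcsI[OF W])
  note sV = lcs_subspace[OF V] and sW = lcs_subspace[OF W]
  note fD = smooth_onD[OF f sV]
  note U = fD(1)
  have UV: "U \<subseteq> V" using U openin_imp_subset by blast
  show "iter_deriv f (Suc k) p x \<in> W" by (rule fD(3)[OF X(2) P(2)])
  fix N assume N: "openin (top_of_set W) N" "convex N" "iter_deriv f (Suc k) p x \<in> N"
  \<comment> \<open>The product with this principal filter expresses uniformity in the position on the segment.\<close>
  let ?I = "principal {0..1::real}"
  let ?G = "F \<times>\<^sub>F ?I"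
  have evG: "\<forall>\<^sub>F zs in ?G. Q (fst zs)" if "\<forall>\<^sub>F z in F. Q z" for Q
    using that filterlim_fst[of F ?I] by (rule eventually_compose_filterlim)
  have limG: "((\<lambda>zs. Y (fst zs)) \<longlongrightarrow> y) ?G" if "(Y \<longlongrightarrow> y) F" for Y :: "_ \<Rightarrow> 'c::topological_space" and y
    using that filterlim_fst[of F ?I] by (rule filterlim_compose)
  have s01: "\<forall>\<^sub>F zs in ?G. snd zs \<in> {0..1}"
    by (rule eventually_compose_filterlim[OF _ filterlim_snd]) (simp add: eventually_principal)
  have sT: "((\<lambda>zs. snd zs * T (fst zs)) \<longlongrightarrow> 0) ?G"
  proof (rule Lim_null_comparison)
    show "((\<lambda>zs. norm (T (fst zs))) \<longlongrightarrow> 0) ?G"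
      by (rule tendsto_norm_zero[OF limG[OF T(1)]])
    show "\<forall>\<^sub>F zs in ?G. norm (snd zs * T (fst zs)) \<le> norm (T (fst zs))"
      using s01 by eventually_elim (simp add: abs_mult mult_left_le_one_le)
  qed
  let ?Y = "\<lambda>zs. X (fst zs) + (snd zs * T (fst zs)) *\<^sub>R P (fst zs) k"
  have PV: "\<forall>\<^sub>F zs in ?G. P (fst zs) k \<in> V"
    using evG[OF P(3)] by eventually_elim (simp add: Pi_iff)
  have YV: "\<forall>\<^sub>F zs in ?G. ?Y zs \<in> V"
    using PV evG[OF X(3)] by eventually_elim (intro subspace_add[OF sV] subspace_scale[OF sV])
  have pV: "p i \<in> V" for i using P(2) by (simp add: Pi_iff)
  have "(?Y \<longlongrightarrow> x + 0 *\<^sub>R p k) ?G"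
    by (rule tendsto_add_lcs[OF V limG[OF X(1)] tendsto_scaleR_lcs[OF V limG[OF P(1)] sT]])
      (use X(2) UV PV pV evG[OF X(3)] subspace_0[OF sV] in \<open>auto elim: eventually_mono intro: subspace_scale[OF sV]\<close>)
  then have Y: "(?Y \<longlongrightarrow> x) ?G" by simp
  have YU: "\<forall>\<^sub>F zs in ?G. ?Y zs \<in> U"
    by (rule eventually_openin[OF Y U X(2) YV])
  have PG: "((\<lambda>zs. P (fst zs)) \<longlongrightarrow> p) ?G"
    by (rule tendsto_coordinatewise) (rule limG[OF P(1)])
  have "((\<lambda>zs. (\<lambda>(x, p). iter_deriv f (Suc k) p x) (?Y zs, P (fst zs)))
      \<longlongrightarrow> (\<lambda>(x, p). iter_deriv f (Suc k) p x) (x, p)) ?G"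
  proof (rule continuous_on_tendsto_compose[OF fD(2)[of "Suc k"] tendsto_Pair[OF Y PG]])
    show "(x, p) \<in> U \<times> sequences_in V" using X P by simp
    show "\<forall>\<^sub>F zs in ?G. (?Y zs, P (fst zs)) \<in> U \<times> sequences_in V"
      using YU evG[OF P(3)] by eventually_elim simp
  qed
  then have lim: "((\<lambda>zs. iter_deriv f (Suc k) (P (fst zs)) (?Y zs)) \<longlongrightarrow> iter_deriv f (Suc k) p x) ?G"
    unfolding prod.case .
  have inW: "\<forall>\<^sub>F zs in ?G. iter_deriv f (Suc k) (P (fst zs)) (?Y zs) \<in> W"
    using YU evG[OF P(3)] by eventually_elim (rule fD(3))
  have "\<forall>\<^sub>F zs in ?G. ?Y zs \<in> U \<and> iter_deriv f (Suc k) (P (fst zs)) (?Y zs) \<in> N"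
    using YU eventually_openin[OF lim N(1,3) inW] by eventually_elim (rule conjI)
  then obtain A B where AB: "eventually A F" "eventually B ?I"
    "\<And>z s. A z \<Longrightarrow> B s \<Longrightarrow> ?Y (z, s) \<in> U \<and> iter_deriv f (Suc k) (P z) (?Y (z, s)) \<in> N"
    unfolding eventually_prod_filter by fastforce
  have key: "X z + (s * T z) *\<^sub>R P z k \<in> U" "iter_deriv f (Suc k) (P z) (X z + (s * T z) *\<^sub>R P z k) \<in> N"
    if "A z" "s \<in> {0..1}" for z s
    using AB(3)[OF that(1), of s] AB(2) that(2) by (simp_all add: eventually_principal)
  from AB(1) P(3) T(2)
  show "\<forall>\<^sub>F z in F. diff_quot (iter_deriv f k (P z)) (X z) (P z k) (T z) \<in> N"
  proof eventually_elim
    case (elim z)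
    define c where "c = (\<lambda>s. iter_deriv f k (P z) (X z + (s * T z) *\<^sub>R P z k) /\<^sub>R T z)"
    have "c 1 - c 0 \<in> N"
    proof (rule mean_value_convex[OF sW N(1,2)])
      fix s :: real assume s: "s \<in> {0..1}"
      let ?y = "X z + (s * T z) *\<^sub>R P z k"
      show "c s \<in> W"
        unfolding c_def by (intro subspace_scale[OF sW] fD(3) key elim s)
      show "iter_deriv f (Suc k) (P z) ?y \<in> N"
        by (rule key[OF elim(1) s])
      have "((\<lambda>r. r * T z) \<longlongrightarrow> 0 * T z) (at 0)"
        by (intro tendsto_intros)
      then have "filterlim (\<lambda>r. r * T z) (at 0) (at 0)"
        using elim(3) by (intro filterlim_atI) (auto simp: eventually_at_filter)
      from filterlim_compose[OF fD(4)[OF key(1)[OF elim(1) s] elim(2)] this]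
      have "((\<lambda>r. diff_quot (iter_deriv f k (P z)) ?y (P z k) (r * T z))
          \<longlongrightarrow> iter_deriv f (Suc k) (P z) ?y) (at 0)" .
      moreover have "(\<lambda>r. diff_quot (iter_deriv f k (P z)) ?y (P z k) (r * T z))
        = (\<lambda>r. (c (s + r) - c s) /\<^sub>R r)"
        by (simp add: fun_eq_iff c_def diff_quot_def algebra_simps flip: scaleR_diff_right)
      ultimately show "((\<lambda>r. (c (s + r) - c s) /\<^sub>R r) \<longlongrightarrow> iter_deriv f (Suc k) (P z) ?y) (at 0)"
        by simp
    qed
    moreover have "c 1 - c 0 = diff_quot (iter_deriv f k (P z)) (X z) (P z k) (T z)"
      by (simp add: c_def diff_quot_def scaleR_diff_right)
    ultimately show ?case by simp
  qed
qed

text \<open>The increment along \<open>a + b\<close> is the increment along \<open>a\<close> plus the increment along \<open>b\<close> at a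
  moving base point, and the latter converges by strict differentiability.\<close>

lemma iter_deriv_add_last:
  assumes V: "locally_convex_space V" and W: "locally_convex_space W" and f: "smooth_on V U W f"
    and x: "x \<in> U" and p: "p \<in> sequences_in V" and ab: "a \<in> V" "b \<in> V"
  shows "iter_deriv f (Suc k) (p(k := a + b)) x
    = iter_deriv f (Suc k) (p(k := a)) x + iter_deriv f (Suc k) (p(k := b)) x"
proof (rule tendsto_unique)
  note sV = lcs_subspace[OF V]
  note fD = smooth_onD[OF f sV]
  have UV: "U \<subseteq> V" using fD(1) openin_imp_subset by blast
  have upd: "p(k := c) \<in> sequences_in V" if "c \<in> V" for c
    using p that by (simp add: Pi_iff)
  let ?D = "\<lambda>c. iter_deriv f (Suc k) (p(k := c)) x" and ?g = "iter_deriv f k p"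
  have g: "iter_deriv f k (p(k := c)) = ?g" for c
    by (intro ext iter_deriv_cong_directions) simp
  show "(diff_quot ?g x (a + b) \<longlongrightarrow> ?D (a + b)) (at 0)"
    using fD(4)[OF x upd[OF subspace_add[OF sV ab]], of k] by (simp only: g fun_upd_same)
  have a: "(diff_quot ?g x a \<longlongrightarrow> ?D a) (at 0)"
    using fD(4)[OF x upd[OF ab(1)], of k] by (simp only: g fun_upd_same)
  have "((\<lambda>t. x + t *\<^sub>R a) \<longlongrightarrow> x + 0 *\<^sub>R a) (at 0)"
    by (rule tendsto_add_lcs[OF V tendsto_const tendsto_scaleR_lcs[OF V tendsto_const tendsto_ident_at]])
      (use ab x UV subspace_scale[OF sV] subspace_0[OF sV] in auto)
  then have X: "((\<lambda>t. x + t *\<^sub>R a) \<longlongrightarrow> x) (at 0)" by simp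
  have b: "((\<lambda>t. diff_quot (iter_deriv f k (p(k := b))) (x + t *\<^sub>R a) ((p(k := b)) k) t) \<longlongrightarrow> ?D b) (at 0)"
    by (rule tendsto_diff_quot_iter_deriv[OF V W f X x _ tendsto_const upd[OF ab(2)] _ tendsto_ident_at])
      (use upd[OF ab(2)] ab x UV subspace_add[OF sV] subspace_scale[OF sV] in \<open>auto simp: eventually_at_filter\<close>)
  have W_ev: "\<forall>\<^sub>F t in at 0. ?g (x + t *\<^sub>R a + t *\<^sub>R b) \<in> W \<and> ?g (x + t *\<^sub>R a) \<in> W \<and> ?g x \<in> W"
    using eventually_line_in[OF V fD(1) x ab(1)] eventually_line_in[OF V fD(1) x subspace_add[OF sV ab]]
    by eventually_elim (auto intro!: fD(3) p x simp: algebra_simps)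
  have "((\<lambda>t. diff_quot ?g (x + t *\<^sub>R a) b t + diff_quot ?g x a t) \<longlongrightarrow> ?D b + ?D a) (at 0)"
    using W_ev
    by (intro tendsto_add_lcs[OF W b[unfolded g fun_upd_same] a] fD(3)[OF x upd] ab)
      (auto elim!: eventually_mono simp: diff_quot_def
        intro!: subspace_scale[OF lcs_subspace[OF W]] subspace_diff[OF lcs_subspace[OF W]])
  moreover have "(\<lambda>t. diff_quot ?g (x + t *\<^sub>R a) b t + diff_quot ?g x a t) = diff_quot ?g x (a + b)"
    by (simp add: fun_eq_iff diff_quot_def scaleR_diff_right scaleR_add_right add.assoc)
  ultimately show "(diff_quot ?g x (a + b) \<longlongrightarrow> ?D a + ?D b) (at 0)"
    by (simp add: add.commute)
qed simp

lemma iter_deriv_scale_last: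
  assumes V: "locally_convex_space V" and f: "smooth_on V U W f"
    and x: "x \<in> U" and p: "p \<in> sequences_in V" and a: "a \<in> V" and W: "locally_convex_space W"
  shows "iter_deriv f (Suc k) (p(k := r *\<^sub>R a)) x = r *\<^sub>R iter_deriv f (Suc k) (p(k := a)) x"
proof (rule tendsto_unique)
  note sV = lcs_subspace[OF V]
  note fD = smooth_onD[OF f sV]
  have upd: "p(k := c) \<in> sequences_in V" if "c \<in> V" for c
    using p that by (simp add: Pi_iff)
  let ?D = "\<lambda>c. iter_deriv f (Suc k) (p(k := c)) x" and ?g = "iter_deriv f k p"
  have g: "iter_deriv f k (p(k := c)) = ?g" for c
    by (intro ext iter_deriv_cong_directions) simp
  show "(diff_quot ?g x (r *\<^sub>R a) \<longlongrightarrow> ?D (r *\<^sub>R a)) (at 0)"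
    using fD(4)[OF x upd[OF subspace_scale[OF sV a]], of k] by (simp only: g fun_upd_same)
  show "(diff_quot ?g x (r *\<^sub>R a) \<longlongrightarrow> r *\<^sub>R ?D a) (at 0)"
  proof (cases "r = 0")
    case True
    then show ?thesis by (simp add: diff_quot_def[abs_def])
  next
    case False
    have a': "(diff_quot ?g x a \<longlongrightarrow> ?D a) (at 0)"
      using fD(4)[OF x upd[OF a], of k] by (simp only: g fun_upd_same)
    have "((\<lambda>t. t * r) \<longlongrightarrow> 0 * r) (at 0)"
      by (intro tendsto_intros)
    then have "filterlim (\<lambda>t. t * r) (at 0) (at 0)"
      using False by (intro filterlim_atI) (auto simp: eventually_at_filter)
    from filterlim_compose[OF a' this]
    have l: "((\<lambda>t. diff_quot ?g x a (t * r)) \<longlongrightarrow> ?D a) (at 0)" .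
    have ev: "\<forall>\<^sub>F t in at 0. diff_quot ?g x a (t * r) \<in> W"
      using eventually_line_in[OF V fD(1) x subspace_scale[OF sV a, of r]]
      by eventually_elim (auto simp: diff_quot_def
        intro!: subspace_scale[OF lcs_subspace[OF W]] subspace_diff[OF lcs_subspace[OF W]] fD(3) p x)
    have "((\<lambda>t. r *\<^sub>R diff_quot ?g x a (t * r)) \<longlongrightarrow> r *\<^sub>R ?D a) (at 0)"
      by (rule tendsto_scaleR_lcs[OF W l tendsto_const ev fD(3)[OF x upd[OF a]]])
    moreover have "(\<lambda>t. r *\<^sub>R diff_quot ?g x a (t * r)) = diff_quot ?g x (r *\<^sub>R a)"
      using False by (simp add: fun_eq_iff diff_quot_def)
    ultimately show ?thesis by simp
  qed
qed simp

text \<open>Linearity in the last direction is passed on to all later derivatives as a limit.\<close>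

lemma iter_deriv_linear_direction:
  assumes V: "locally_convex_space V" and W: "locally_convex_space W" and f: "smooth_on V U W f"
    and ab: "a \<in> V" "b \<in> V"
  shows "x \<in> U \<Longrightarrow> p \<in> sequences_in V \<Longrightarrow> j < k \<Longrightarrow>
     iter_deriv f k (p(j := a + r *\<^sub>R b)) x = iter_deriv f k (p(j := a)) x + r *\<^sub>R iter_deriv f k (p(j := b)) x"
proof (induction k arbitrary: x)
  case 0 then show ?case by simp
next
  case (Suc k)
  note sV = lcs_subspace[OF V] and sW = lcs_subspace[OF W]
  note fD = smooth_onD[OF f sV]
  have upd: "p(j := c) \<in> sequences_in V" if "c \<in> V" for c
    using Suc.prems that by (simp add: Pi_iff)
  show ?case
  proof (cases "j = k")
    case True
    then show ?thesis
      using iter_deriv_add_last[OF V W f Suc.prems(1,2) ab(1) subspace_scale[OF sV ab(2)], of k r]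
        iter_deriv_scale_last[OF V f Suc.prems(1,2) ab(2) W, of k r] by (simp only: True)
  next
    case False
    then have j: "j < k" using Suc.prems by simp
    let ?g = "\<lambda>c. iter_deriv f k (p(j := c))" and ?D = "\<lambda>c. iter_deriv f (Suc k) (p(j := c)) x"
    have pk: "p k \<in> V" using Suc.prems by (simp add: Pi_iff)
    have lim: "(diff_quot (?g c) x (p k) \<longlongrightarrow> ?D c) (at 0)" if "c \<in> V" for c
      using fD(4)[OF Suc.prems(1) upd[OF that], of k] False by (simp del: iter_deriv.simps)
    have ev: "\<forall>\<^sub>F t in at 0. diff_quot (?g c) x (p k) t \<in> W" if "c \<in> V" for c
      using eventually_line_in[OF V fD(1) Suc.prems(1) pk]
      by eventually_elim (auto simp: diff_quot_def intro!: upd that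
        subspace_scale[OF sW] subspace_diff[OF sW] fD(3) Suc.prems)
    have evs: "\<forall>\<^sub>F t in at 0. r *\<^sub>R diff_quot (?g b) x (p k) t \<in> W"
      using ev[OF ab(2)] by eventually_elim (rule subspace_scale[OF sW])
    have "((\<lambda>t. diff_quot (?g a) x (p k) t + r *\<^sub>R diff_quot (?g b) x (p k) t)
        \<longlongrightarrow> ?D a + r *\<^sub>R ?D b) (at 0)"
      by (rule tendsto_add_lcs[OF W lim[OF ab(1)]
            tendsto_scaleR_lcs[OF W lim[OF ab(2)] tendsto_const ev[OF ab(2)] fD(3)] ev[OF ab(1)] evs
            fD(3) subspace_scale[OF sW fD(3)]])
        (intro Suc.prems upd ab)+
    moreover have "\<forall>\<^sub>F t in at 0. diff_quot (?g a) x (p k) t + r *\<^sub>R diff_quot (?g b) x (p k) t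
        = diff_quot (?g (a + r *\<^sub>R b)) x (p k) t"
      using eventually_line_in[OF V fD(1) Suc.prems(1) pk]
    proof eventually_elim
      case (elim t)
      have "(a1 - a0) /\<^sub>R t + r *\<^sub>R ((b1 - b0) /\<^sub>R t) = ((a1 + r *\<^sub>R b1) - (a0 + r *\<^sub>R b0)) /\<^sub>R t"
        for a0 a1 b0 b1 :: 'b
        by (simp add: algebra_simps)
      then show ?case
        unfolding diff_quot_def Suc.IH[OF elim Suc.prems(2) j] Suc.IH[OF Suc.prems(1,2) j] .
    qed
    ultimately have "(diff_quot (?g (a + r *\<^sub>R b)) x (p k) \<longlongrightarrow> ?D a + r *\<^sub>R ?D b) (at 0)"
      by (rule Lim_transform_eventually)
    then show ?thesis
      using lim[OF subspace_add[OF sV ab(1) subspace_scale[OF sV ab(2)]]] tendsto_unique[OF at_neq_bot]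
      by blast
  qed
qed

lemma tendsto_from_quotient:
  fixes Y :: "real \<Rightarrow> 'v::{real_vector,t2_space}"
  assumes V: "locally_convex_space V" and lim: "((\<lambda>t. (Y t - y) /\<^sub>R t) \<longlongrightarrow> v) (at 0)"
    and "v \<in> V" "y \<in> V" "\<forall>\<^sub>F t in at 0. Y t \<in> V"
  shows "(Y \<longlongrightarrow> y) (at 0)"
proof -
  note sV = lcs_subspace[OF V]
  have ev: "\<forall>\<^sub>F t in at 0. (Y t - y) /\<^sub>R t \<in> V"
    using assms(5) by eventually_elim (intro subspace_scale[OF sV] subspace_diff[OF sV] assms(4))
  have ev': "\<forall>\<^sub>F t in at 0. t *\<^sub>R ((Y t - y) /\<^sub>R t) \<in> V"
    using ev by eventually_elim (rule subspace_scale[OF sV])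
  have "((\<lambda>t. y + t *\<^sub>R ((Y t - y) /\<^sub>R t)) \<longlongrightarrow> y + 0 *\<^sub>R v) (at 0)"
    by (rule tendsto_add_lcs[OF V tendsto_const tendsto_scaleR_lcs[OF V lim tendsto_ident_at ev assms(3)]])
      (use assms ev' subspace_0[OF sV] in auto)
  then have "((\<lambda>t. y + t *\<^sub>R ((Y t - y) /\<^sub>R t)) \<longlongrightarrow> y) (at 0)" by simp
  moreover have "\<forall>\<^sub>F t in at 0. y + t *\<^sub>R ((Y t - y) /\<^sub>R t) = Y t"
    by (auto simp: eventually_at_filter)
  ultimately show ?thesis
    by (rule Lim_transform_eventually)
qed

text \<open>The chain rule for a derivative \<open>iter_deriv g k\<close> whose base point and whose directions
  depend on \<open>t\<close>. Moving the base point contributes a derivative of one order more. Since the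
  derivative is linear in each direction, moving the direction number \<open>j\<close> replaces it by its
  derivative \<open>u j\<close>.\<close>

lemma tendsto_iter_deriv_quotient:
  fixes g :: "'v::{real_vector,t2_space} \<Rightarrow> 'w::{real_vector,t2_space}"
  assumes V: "locally_convex_space V" and W: "locally_convex_space W" and g: "smooth_on V U W g"
    and y: "y \<in> U" and w: "w \<in> sequences_in V"
    and Y: "((\<lambda>t. (Y t - y) /\<^sub>R t) \<longlongrightarrow> v) (at 0)" "v \<in> V" "\<forall>\<^sub>F t in at 0. Y t \<in> U"
    and P: "\<And>j. ((\<lambda>t. (P t j - w j) /\<^sub>R t) \<longlongrightarrow> u j) (at 0)" "u \<in> sequences_in V"
      "\<forall>\<^sub>F t in at 0. P t \<in> sequences_in V"
  shows "((\<lambda>t. (iter_deriv g k (P t) (Y t) - iter_deriv g k w y) /\<^sub>R t) \<longlongrightarrow>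
    iter_deriv g (Suc k) (w(k := v)) y + (\<Sum>j<k. iter_deriv g k (w(j := u j)) y)) (at 0)"
proof -
  note sV = lcs_subspace[OF V] and sW = lcs_subspace[OF W]
  note gD = smooth_onD[OF g sV]
  have UV: "U \<subseteq> V" using gD(1) openin_imp_subset by blast
  let ?v = "\<lambda>t. (Y t - y) /\<^sub>R t" and ?u = "\<lambda>t j. (P t j - w j) /\<^sub>R t"
  have wV: "w j \<in> V" and uV: "u j \<in> V" for j using w P(2) by (simp_all add: Pi_iff)
  have PV: "\<forall>\<^sub>F t in at 0. P t j \<in> V" for j
    using P(3) by eventually_elim (simp add: Pi_iff)
  have vV: "\<forall>\<^sub>F t in at 0. ?v t \<in> V"
    using Y(3) by eventually_elim (use y UV in \<open>auto intro!: subspace_scale[OF sV] subspace_diff[OF sV]\<close>)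
  have limP: "((\<lambda>t. P t j) \<longlongrightarrow> w j) (at 0)" for j
    by (rule tendsto_from_quotient[OF V P(1) uV wV PV])
  have upd: "q(j := c) \<in> sequences_in V" if "q \<in> sequences_in V" "c \<in> V" for q c j
    using that by (simp add: Pi_iff)

  let ?A = "\<lambda>t. diff_quot (iter_deriv g k ((P t)(k := ?v t))) y (((P t)(k := ?v t)) k) t"
  have A: "(?A \<longlongrightarrow> iter_deriv g (Suc k) (w(k := v)) y) (at 0)"
  proof (rule tendsto_diff_quot_iter_deriv[OF V W g tendsto_const y _ _ upd[OF w Y(2)]])
    show "((\<lambda>t. ((P t)(k := ?v t)) i) \<longlongrightarrow> (w(k := v)) i) (at 0)" for i
      using limP Y(1) by (cases "i = k") simp_all
    show "\<forall>\<^sub>F t in at 0. (P t)(k := ?v t) \<in> sequences_in V"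
      using P(3) vV by eventually_elim (rule upd)
  qed (use y UV in \<open>auto simp: eventually_at_filter\<close>)

  \<comment> \<open>The directions are changed one at a time.\<close>
  define Q where "Q = (\<lambda>t m i. if i < m then P t i else w i)"
  have QV: "\<forall>\<^sub>F t in at 0. Q t m \<in> sequences_in V" for m
    using P(3) by eventually_elim (use wV in \<open>simp add: Q_def Pi_iff\<close>)
  have limQ: "((\<lambda>t. Q t m i) \<longlongrightarrow> w i) (at 0)" for m i
    using limP by (cases "i < m") (simp_all add: Q_def)
  have u'V: "\<forall>\<^sub>F t in at 0. ?u t m \<in> V" for m
    using PV[of m] by eventually_elim (intro subspace_scale[OF sV] subspace_diff[OF sV] wV)
  let ?B = "\<lambda>m t. iter_deriv g k ((Q t m)(m := ?u t m)) y"
  have BV: "\<forall>\<^sub>F t in at 0. (Q t m)(m := ?u t m) \<in> sequences_in V" for m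
    using QV[of m] u'V[of m] by eventually_elim (rule upd)
  have B: "(?B m \<longlongrightarrow> iter_deriv g k (w(m := u m)) y) (at 0)" for m
  proof -
    have "((\<lambda>t. (y, (Q t m)(m := ?u t m))) \<longlongrightarrow> (y, w(m := u m))) (at 0)"
    proof (intro tendsto_Pair tendsto_const tendsto_coordinatewise)
      show "((\<lambda>t. ((Q t m)(m := ?u t m)) i) \<longlongrightarrow> (w(m := u m)) i) (at 0)" for i
        using limQ[of m i] P(1)[of m] by (cases "i = m") simp_all
    qed
    moreover have "\<forall>\<^sub>F t in at 0. (y, (Q t m)(m := ?u t m)) \<in> U \<times> sequences_in V"
      using BV[of m] by eventually_elim (use y in simp)
    moreover have "(y, w(m := u m)) \<in> U \<times> sequences_in V"
      using y upd[OF w uV] by simp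
    ultimately have "((\<lambda>t. (\<lambda>(x, p). iter_deriv g k p x) (y, (Q t m)(m := ?u t m)))
        \<longlongrightarrow> (\<lambda>(x, p). iter_deriv g k p x) (y, w(m := u m))) (at 0)"
      by (intro continuous_on_tendsto_compose[OF gD(2)[of k]])
    then show ?thesis by simp
  qed
  have BW: "\<forall>\<^sub>F t in at 0. ?B m t \<in> W" for m
    using BV[of m] by eventually_elim (rule gD(3)[OF y])
  have sumB: "((\<lambda>t. \<Sum>m<k. ?B m t) \<longlongrightarrow> (\<Sum>m<k. iter_deriv g k (w(m := u m)) y)) (at 0)"
    by (rule tendsto_sum_lcs[OF W]) (auto intro!: B BW gD(3)[OF y] upd[OF w] uV)
  have sumBW: "\<forall>\<^sub>F t in at 0. (\<Sum>m<k. ?B m t) \<in> W"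
  proof -
    have "\<forall>\<^sub>F t in at 0. \<forall>m\<in>{..<k}. ?B m t \<in> W"
      by (rule eventually_ball_finite) (auto intro: BW)
    then show ?thesis by eventually_elim (auto intro: subspace_sum[OF sW])
  qed
  have AW: "\<forall>\<^sub>F t in at 0. ?A t \<in> W"
    using Y(3) P(3) vV eventually_neq_at_within[of 0]
  proof eventually_elim
    case (elim t)
    then have "y + t *\<^sub>R ?v t = Y t" by simp
    moreover have "(P t)(k := ?v t) \<in> sequences_in V" using elim by (intro upd)
    ultimately show ?case
      using elim y by (auto simp: diff_quot_def intro!: subspace_scale[OF sW] subspace_diff[OF sW] gD(3))
  qed
  have "((\<lambda>t. ?A t + (\<Sum>m<k. ?B m t)) \<longlongrightarrow>
      iter_deriv g (Suc k) (w(k := v)) y + (\<Sum>j<k. iter_deriv g k (w(j := u j)) y)) (at 0)"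
    by (rule tendsto_add_lcs[OF W A sumB AW sumBW])
      (auto intro!: subspace_sum[OF sW] gD(3)[OF y] upd[OF w] uV Y(2) simp del: iter_deriv.simps)
  moreover have "\<forall>\<^sub>F t in at 0. ?A t + (\<Sum>m<k. ?B m t) =
      (iter_deriv g k (P t) (Y t) - iter_deriv g k w y) /\<^sub>R t"
    using P(3) eventually_neq_at_within[of 0]
  proof eventually_elim
    case (elim t)
    let ?g = "\<lambda>q. iter_deriv g k q"
    have "?g ((P t)(k := ?v t)) = ?g (P t)"
      by (intro ext iter_deriv_cong_directions) simp
    then have 1: "?A t = (?g (P t) (Y t) - ?g (P t) y) /\<^sub>R t"
      using elim by (simp add: diff_quot_def)
    have "?g (Q t (Suc m)) y - ?g (Q t m) y = t *\<^sub>R ?B m t" if "m < k" for m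
    proof -
      have "Q t (Suc m) = (Q t m)(m := w m + t *\<^sub>R ?u t m)"
        using elim by (auto simp: Q_def fun_eq_iff less_Suc_eq)
      moreover have "(Q t m)(m := w m) = Q t m"
        by (auto simp: Q_def fun_eq_iff)
      moreover have "?u t m \<in> V"
        using elim(1) wV by (intro subspace_scale[OF sV] subspace_diff[OF sV]) (simp_all add: Pi_iff)
      moreover have "Q t m \<in> sequences_in V"
        using elim(1) wV by (simp add: Q_def Pi_iff)
      ultimately show ?thesis
        using iter_deriv_linear_direction[OF V W g wV[of m] _ y _ that, of "?u t m" "Q t m" t]
        by simp
    qed
    then have "(\<Sum>m<k. t *\<^sub>R ?B m t) = (\<Sum>m<k. ?g (Q t (Suc m)) y - ?g (Q t m) y)"
      by (intro sum.cong) simp_all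
    also have "\<dots> = ?g (Q t k) y - ?g (Q t 0) y"
      by (rule sum_lessThan_telescope)
    also have "?g (Q t k) y = ?g (P t) y"
      by (rule iter_deriv_cong_directions) (simp add: Q_def)
    also have "?g (Q t 0) y = ?g w y"
      by (rule iter_deriv_cong_directions) (simp add: Q_def)
    finally have sum: "t *\<^sub>R (\<Sum>m<k. ?B m t) = ?g (P t) y - ?g w y"
      unfolding scaleR_sum_right .
    have 2: "(\<Sum>m<k. ?B m t) = (?g (P t) y - ?g w y) /\<^sub>R t"
      unfolding sum[symmetric] scaleR_scaleR left_inverse[OF elim(2)] scaleR_one ..
    show ?case unfolding 1 2 scaleR_add_right[symmetric] by (rule arg_cong[where f = "scaleR _"]) simp
  qed
  ultimately show ?thesis
    by (rule Lim_transform_eventually)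
qed

text \<open>The derivatives of a composition \<open>g \<circ> f\<close> are sums of derivatives of \<open>g\<close> at \<open>f x\<close> in
  directions that are themselves derivatives of \<open>f\<close>, taken from a family \<open>S\<close>. This closure
  property is all that is needed of the formula of Faa di Bruno.\<close>

inductive_set chain_family ::
  "('w::{real_vector,t2_space} \<Rightarrow> 'z::{real_vector,t2_space}) \<Rightarrow> ('v::{real_vector,t2_space} \<Rightarrow> 'w) \<Rightarrow>
   ('v \<Rightarrow> (nat \<Rightarrow> 'v) \<Rightarrow> 'w) set \<Rightarrow> ('v \<Rightarrow> (nat \<Rightarrow> 'v) \<Rightarrow> 'z) set" for g f S where
  deriv: "(\<And>i. F i \<in> S) \<Longrightarrow> (\<lambda>x p. iter_deriv g k (\<lambda>i. F i x p) (f x)) \<in> chain_family g f S"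
| zero: "(\<lambda>x p. 0) \<in> chain_family g f S"
| add: "\<phi> \<in> chain_family g f S \<Longrightarrow> \<psi> \<in> chain_family g f S \<Longrightarrow> (\<lambda>x p. \<phi> x p + \<psi> x p) \<in> chain_family g f S"

lemma chain_family_sum:
  "(\<And>j. j < (k :: nat) \<Longrightarrow> \<phi> j \<in> chain_family g f S) \<Longrightarrow> (\<lambda>x p. \<Sum>j<k. \<phi> j x p) \<in> chain_family g f S"
  by (induction k) (auto intro: chain_family.zero chain_family.add)

lemma smooth_familyD:
  assumes "smooth_family V U W S" "\<phi> \<in> S"
  shows "continuous_on (U \<times> sequences_in V) (\<lambda>(x, p). \<phi> x p)"
    and "x \<in> U \<Longrightarrow> p \<in> sequences_in V \<Longrightarrow> \<phi> x p \<in> W"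
    and "\<exists>\<phi>'\<in>S. derivative_along V U n \<phi> \<phi>'"
  using assms unfolding smooth_family_def by blast+

lemma continuous_on_add_lcs:
  assumes V: "locally_convex_space V" and "continuous_on X f" "continuous_on X g" "f \<in> X \<rightarrow> V" "g \<in> X \<rightarrow> V"
  shows "continuous_on X (\<lambda>x. f x + g x)"
  unfolding continuous_on_def
proof
  fix x assume x: "x \<in> X"
  have "\<forall>\<^sub>F z in at x within X. z \<in> X" by (simp add: eventually_at_filter)
  then show "((\<lambda>x. f x + g x) \<longlongrightarrow> f x + g x) (at x within X)"
    using assms x by (intro tendsto_add_lcs[OF V]) (auto simp: continuous_on_def elim!: eventually_mono)
qed

lemma tendsto_diff_quot_add_lcs:
  assumes V: "locally_convex_space V" and W: "locally_convex_space W"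
    and U: "openin (top_of_set V) U" "x \<in> U" "h \<in> V"
    and f: "(diff_quot f x h \<longlongrightarrow> a) (at 0)" "a \<in> W" "\<And>y. y \<in> U \<Longrightarrow> f y \<in> W"
    and g: "(diff_quot g x h \<longlongrightarrow> b) (at 0)" "b \<in> W" "\<And>y. y \<in> U \<Longrightarrow> g y \<in> W"
  shows "(diff_quot (\<lambda>y. f y + g y) x h \<longlongrightarrow> a + b) (at 0)"
proof -
  have "\<forall>\<^sub>F t in at 0. diff_quot \<phi> x h t \<in> W" if "\<And>y. y \<in> U \<Longrightarrow> \<phi> y \<in> W" for \<phi>
    using eventually_line_in[OF V U] by eventually_elim
      (auto simp: diff_quot_def intro!: that U(2)
        subspace_scale[OF lcs_subspace[OF W]] subspace_diff[OF lcs_subspace[OF W]])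
  then have "((\<lambda>t. diff_quot f x h t + diff_quot g x h t) \<longlongrightarrow> a + b) (at 0)"
    using f g by (intro tendsto_add_lcs[OF W]) auto
  moreover have "(\<lambda>t. diff_quot f x h t + diff_quot g x h t) = diff_quot (\<lambda>y. f y + g y) x h"
    by (simp add: fun_eq_iff diff_quot_def algebra_simps)
  ultimately show ?thesis by simp
qed

lemma smooth_family_chain_family:
  assumes V: "locally_convex_space V" and W: "locally_convex_space W" and Z: "locally_convex_space Z"
    and U: "openin (top_of_set V) U"
    and S: "smooth_family V U W S" and f: "(\<lambda>x p. f x) \<in> S" "f ` U \<subseteq> U'"
    and g: "smooth_on W U' Z g"
  shows "smooth_family V U Z (chain_family g f S)"
  unfolding smooth_family_def
proof
  note sW = lcs_subspace[OF W]
  note gD = smooth_onD[OF g sW]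
  note SD = smooth_familyD[OF S]
  have fU: "f x \<in> U'" if "x \<in> U" for x using f that by auto
  have inZ: "\<phi> x p \<in> Z" if "\<phi> \<in> chain_family g f S" "x \<in> U" "p \<in> sequences_in V" for \<phi> x p
    using that(1)
  proof induction
    case (deriv F k)
    show ?case
      using SD(2)[OF deriv that(2,3)] by (intro gD(3) fU that) (simp add: Pi_iff)
  qed (auto intro: subspace_0[OF lcs_subspace[OF Z]] subspace_add[OF lcs_subspace[OF Z]])
  fix \<phi> assume "\<phi> \<in> chain_family g f S"
  then show "continuous_on (U \<times> sequences_in V) (\<lambda>(x, p). \<phi> x p) \<and>
        (\<forall>x\<in>U. \<forall>p\<in>sequences_in V. \<phi> x p \<in> Z) \<and>
        (\<forall>n. \<exists>\<phi>'\<in>chain_family g f S. derivative_along V U n \<phi> \<phi>')"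
  proof induction
    case (deriv F k)
    have FW: "(\<lambda>i. F i x p) \<in> sequences_in W" if "x \<in> U" "p \<in> sequences_in V" for x p
      using SD(2)[OF deriv that] by (simp add: Pi_iff)
    have "continuous_on (U \<times> sequences_in V) (\<lambda>z. (f (fst z), \<lambda>i. F i (fst z) (snd z)))"
    proof (intro continuous_on_Pair continuous_on_coordinatewise_then_product)
      show "continuous_on (U \<times> sequences_in V) (\<lambda>z. F i (fst z) (snd z))" for i
        using SD(1)[OF deriv] by (simp add: case_prod_unfold)
      show "continuous_on (U \<times> sequences_in V) (\<lambda>z. f (fst z))"
        using SD(1)[OF f(1)] by (simp add: case_prod_unfold)
    qed
    then have "continuous_on (U \<times> sequences_in V)
        (\<lambda>z. (\<lambda>(x, p). iter_deriv g k p x) (f (fst z), \<lambda>i. F i (fst z) (snd z)))"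
      by (rule continuous_on_compose2[OF gD(2)]) (use fU SD(2)[OF deriv] in \<open>auto simp: Pi_iff\<close>)
    then have 1: "continuous_on (U \<times> sequences_in V) (\<lambda>(x, p). iter_deriv g k (\<lambda>i. F i x p) (f x))"
      by (simp add: case_prod_unfold)
    have 2: "\<forall>x\<in>U. \<forall>p\<in>sequences_in V. iter_deriv g k (\<lambda>i. F i x p) (f x) \<in> Z"
      using gD(3)[OF fU FW] by blast
    have "\<exists>\<phi>'\<in>chain_family g f S. \<forall>x\<in>U. \<forall>p\<in>sequences_in V.
        (diff_quot (\<lambda>y. iter_deriv g k (\<lambda>i. F i y p) (f y)) x (p n) \<longlongrightarrow> \<phi>' x p) (at 0)" for n
    proof -
      obtain f' where f': "f' \<in> S"
        "\<And>x p. x \<in> U \<Longrightarrow> p \<in> sequences_in V \<Longrightarrow> (diff_quot f x (p n) \<longlongrightarrow> f' x p) (at 0)"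
        using SD(3)[OF f(1), of n] by blast
      have "\<forall>i. \<exists>\<phi>'\<in>S. \<forall>x\<in>U. \<forall>p\<in>sequences_in V. (diff_quot (\<lambda>y. F i y p) x (p n) \<longlongrightarrow> \<phi>' x p) (at 0)"
        using SD(3)[OF deriv, of _ n] by blast
      then obtain F' where F': "\<And>i. F' i \<in> S"
        "\<And>i x p. x \<in> U \<Longrightarrow> p \<in> sequences_in V \<Longrightarrow> (diff_quot (\<lambda>y. F i y p) x (p n) \<longlongrightarrow> F' i x p) (at 0)"
        by metis
      let ?\<phi> = "\<lambda>x p. iter_deriv g (Suc k) (\<lambda>i. (F(k := f')) i x p) (f x) +
        (\<Sum>j<k. iter_deriv g k (\<lambda>i. (F(j := F' j)) i x p) (f x))"
      have "?\<phi> \<in> chain_family g f S"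
        by (intro chain_family.add chain_family_sum chain_family.deriv) (use deriv f' F' in auto)
      moreover have "(diff_quot (\<lambda>y. iter_deriv g k (\<lambda>i. F i y p) (f y)) x (p n) \<longlongrightarrow> ?\<phi> x p) (at 0)"
        if x: "x \<in> U" and p: "p \<in> sequences_in V" for x p
      proof -
        have pn: "p n \<in> V" using p by (simp add: Pi_iff)
        note line = eventually_line_in[OF V U x pn]
        have u1: "(\<lambda>i. (F(k := f')) i x p) = (\<lambda>i. F i x p)(k := f' x p)"
          and u2: "(\<lambda>i. (F(j := F' j)) i x p) = (\<lambda>i. F i x p)(j := F' j x p)" for j
          by (auto simp: fun_eq_iff)
        have "((\<lambda>t. (iter_deriv g k (\<lambda>i. F i (x + t *\<^sub>R p n) p) (f (x + t *\<^sub>R p n)) -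
            iter_deriv g k (\<lambda>i. F i x p) (f x)) /\<^sub>R t) \<longlongrightarrow>
            iter_deriv g (Suc k) ((\<lambda>i. F i x p)(k := f' x p)) (f x) +
            (\<Sum>j<k. iter_deriv g k ((\<lambda>i. F i x p)(j := F' j x p)) (f x))) (at 0)"
        proof (rule tendsto_iter_deriv_quotient[OF W Z g fU[OF x] FW[OF x p]])
          show "((\<lambda>t. (f (x + t *\<^sub>R p n) - f x) /\<^sub>R t) \<longlongrightarrow> f' x p) (at 0)"
            using f'(2)[OF x p] by (simp add: diff_quot_def[abs_def])
          show "((\<lambda>t. (F j (x + t *\<^sub>R p n) p - F j x p) /\<^sub>R t) \<longlongrightarrow> F' j x p) (at 0)" for j
            using F'(2)[OF x p, of j] by (simp add: diff_quot_def[abs_def])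
          show "f' x p \<in> W" by (rule SD(2)[OF f'(1) x p])
          show "(\<lambda>j. F' j x p) \<in> sequences_in W" using SD(2)[OF F'(1) x p] by (simp add: Pi_iff)
          show "\<forall>\<^sub>F t in at 0. f (x + t *\<^sub>R p n) \<in> U'"
            using line by eventually_elim (rule fU)
          show "\<forall>\<^sub>F t in at 0. (\<lambda>i. F i (x + t *\<^sub>R p n) p) \<in> sequences_in W"
            using line by eventually_elim (rule FW[OF _ p])
        qed
        then show ?thesis unfolding u1 u2 by (simp add: diff_quot_def[abs_def] del: iter_deriv.simps)
      qed
      ultimately show ?thesis by (intro bexI[of _ ?\<phi>] ballI)
    qed
    with 1 2 show ?case by (intro conjI allI)
  next
    case zero
    have "\<exists>\<phi>'\<in>chain_family g f S. \<forall>x\<in>U. \<forall>p\<in>sequences_in V.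
        (diff_quot (\<lambda>y. 0) x (p n) \<longlongrightarrow> \<phi>' x p) (at 0)" for n
      by (intro bexI[OF _ chain_family.zero] ballI) (simp add: diff_quot_def[abs_def])
    then show ?case
      using subspace_0[OF lcs_subspace[OF Z]] by (simp add: case_prod_unfold)
  next
    case (add \<phi> \<psi>)
    note \<phi> = conjunct1[OF add.IH(1)] conjunct1[OF conjunct2[OF add.IH(1)]] conjunct2[OF conjunct2[OF add.IH(1)]]
    note \<psi> = conjunct1[OF add.IH(2)] conjunct1[OF conjunct2[OF add.IH(2)]] conjunct2[OF conjunct2[OF add.IH(2)]]
    have "continuous_on (U \<times> sequences_in V) (\<lambda>z. (\<lambda>(x, p). \<phi> x p) z + (\<lambda>(x, p). \<psi> x p) z)"
      by (rule continuous_on_add_lcs[OF Z \<phi>(1) \<psi>(1)]) (auto intro: inZ add.hyps)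
    then have 1: "continuous_on (U \<times> sequences_in V) (\<lambda>(x, p). \<phi> x p + \<psi> x p)"
      by (simp add: case_prod_unfold)
    have 2: "\<forall>x\<in>U. \<forall>p\<in>sequences_in V. \<phi> x p + \<psi> x p \<in> Z"
      using subspace_add[OF lcs_subspace[OF Z] inZ[OF add.hyps(1)] inZ[OF add.hyps(2)]] by blast
    have "\<exists>\<eta>\<in>chain_family g f S. \<forall>x\<in>U. \<forall>p\<in>sequences_in V.
        (diff_quot (\<lambda>y. \<phi> y p + \<psi> y p) x (p n) \<longlongrightarrow> \<eta> x p) (at 0)" for n
    proof -
      obtain \<phi>' where \<phi>': "\<phi>' \<in> chain_family g f S"
        "\<And>x p. x \<in> U \<Longrightarrow> p \<in> sequences_in V \<Longrightarrow> (diff_quot (\<lambda>y. \<phi> y p) x (p n) \<longlongrightarrow> \<phi>' x p) (at 0)"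
        using \<phi>(3) by metis
      obtain \<psi>' where \<psi>': "\<psi>' \<in> chain_family g f S"
        "\<And>x p. x \<in> U \<Longrightarrow> p \<in> sequences_in V \<Longrightarrow> (diff_quot (\<lambda>y. \<psi> y p) x (p n) \<longlongrightarrow> \<psi>' x p) (at 0)"
        using \<psi>(3) by metis
      have "(diff_quot (\<lambda>y. \<phi> y p + \<psi> y p) x (p n) \<longlongrightarrow> \<phi>' x p + \<psi>' x p) (at 0)"
        if x: "x \<in> U" and p: "p \<in> sequences_in V" for x p
        by (rule tendsto_diff_quot_add_lcs[OF V Z U x _ \<phi>'(2)[OF x p] inZ[OF \<phi>'(1) x p] inZ[OF add.hyps(1) _ p]
              \<psi>'(2)[OF x p] inZ[OF \<psi>'(1) x p] inZ[OF add.hyps(2) _ p]])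
          (use p in \<open>simp add: Pi_iff\<close>)
      then show ?thesis
        by (intro bexI[OF _ chain_family.add[OF \<phi>'(1) \<psi>'(1)]] ballI)
    qed
    with 1 2 show ?case by (intro conjI allI)
  qed
qed

text \<open>The chain rule turns any smooth family of \<open>f\<close> into one of \<open>g \<circ> f\<close>.\<close>

theorem smooth_on_compose:
  assumes V: "locally_convex_space V" and W: "locally_convex_space W" and Z: "locally_convex_space Z"
    and f: "smooth_on V U W f" and g: "smooth_on W U' Z g" and "f ` U \<subseteq> U'"
  shows "smooth_on V U Z (\<lambda>x. g (f x))"
proof -
  note sV = lcs_subspace[OF V]
  let ?S = "{\<lambda>x p. iter_deriv f k (p \<circ> \<tau>) x | k (\<tau> :: nat \<Rightarrow> nat). True}"
  note U = smooth_on_openin[OF f sV]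
  have fS: "(\<lambda>x p. f x) \<in> ?S"
    by (intro CollectI exI[of _ 0] exI[of _ id]) simp
  show ?thesis
  proof (rule smooth_on_familyI[OF V U])
    show "smooth_family V U Z (chain_family g f ?S)"
      by (rule smooth_family_chain_family[OF V W Z U smooth_family_iter_deriv[OF f sV] fS assms(6) g])
    show "(\<lambda>x p. g (f x)) \<in> chain_family g f ?S"
      using chain_family.deriv[of "\<lambda>_ x p. f x" ?S g 0 f] fS by simp
  qed (rule refl)
qed

section \<open>Constructions of smooth maps\<close>

lemma smooth_family_mono:
  assumes "smooth_family V U W S" "U' \<subseteq> U" "W \<subseteq> W'"
  shows "smooth_family V U' W' S"
  unfolding smooth_family_def
proof (intro ballI conjI allI)
  fix \<phi> assume \<phi>: "\<phi> \<in> S"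
  note D = smooth_familyD[OF assms(1) \<phi>]
  show "continuous_on (U' \<times> sequences_in V) (\<lambda>(x, p). \<phi> x p)"
    by (rule continuous_on_subset[OF D(1)]) (use assms in auto)
  show "\<phi> x p \<in> W'" if "x \<in> U'" "p \<in> sequences_in V" for x p
    using D(2) assms that by blast
  show "\<exists>\<phi>'\<in>S. derivative_along V U' n \<phi> \<phi>'" for n
    using D(3)[of n] assms(2) by (elim bexE) (intro bexI, auto)
qed

lemma smooth_on_mono_cong:
  assumes V: "locally_convex_space V" and f: "smooth_on V U W f"
    and "openin (top_of_set V) U'" "U' \<subseteq> U" "W \<subseteq> W'" "\<And>x. x \<in> U' \<Longrightarrow> g x = f x"
  shows "smooth_on V U' W' g"
proof -
  note S = smooth_family_mono[OF smooth_family_iter_deriv[OF f lcs_subspace[OF V]] assms(4,5)]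
  show ?thesis
    by (rule smooth_on_familyI[OF V assms(3) S, of "\<lambda>x p. iter_deriv f 0 (p \<circ> id) x"])
      (auto intro: exI[of _ 0] exI[of _ id] simp: assms(6))
qed

lemmas smooth_on_cong = smooth_on_mono_cong[OF _ _ _ order_refl order_refl]
lemmas smooth_on_subset = smooth_on_mono_cong[OF _ _ _ _ order_refl refl]

lemma smooth_on_superset_target:
  assumes "locally_convex_space V" "smooth_on V U W f" "W \<subseteq> W'"
  shows "smooth_on V U W' f"
  using smooth_on_mono_cong[OF assms(1,2) smooth_on_openin[OF assms(2)] order_refl assms(3) refl]
    lcs_subspace[OF assms(1)] by blast

lemma smooth_on_local:
  assumes V: "locally_convex_space V" and U: "openin (top_of_set V) U"
    and loc: "\<And>x. x \<in> U \<Longrightarrow> \<exists>U'. x \<in> U' \<and> smooth_on V U' W f"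
  shows "smooth_on V U W f"
proof -
  note sV = lcs_subspace[OF V]
  let ?S = "{\<lambda>x p. iter_deriv f k (p \<circ> \<tau>) x | k (\<tau> :: nat \<Rightarrow> nat). True}"
  have "smooth_family V U W ?S"
    unfolding smooth_family_def
  proof (intro ballI conjI allI)
    fix \<phi> assume "\<phi> \<in> ?S"
    then obtain k and \<tau> :: "nat \<Rightarrow> nat" where \<phi>: "\<phi> = (\<lambda>x p. iter_deriv f k (p \<circ> \<tau>) x)" by blast
    have \<phi>S: "\<phi> \<in> ?S" unfolding \<phi> by blast
    show "\<phi> x p \<in> W" if x: "x \<in> U" and p: "p \<in> sequences_in V" for x p
    proof -
      obtain U' where "x \<in> U'" "smooth_on V U' W f" using loc[OF x] by blast
      then show ?thesis
        using smooth_familyD(2)[OF smooth_family_iter_deriv[OF _ sV] \<phi>S] p by blast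
    qed
    show "continuous_on (U \<times> sequences_in V) (\<lambda>(x, p). \<phi> x p)"
      unfolding continuous_on_def
    proof
      fix z assume z: "z \<in> U \<times> sequences_in V"
      then obtain U' where U': "fst z \<in> U'" "smooth_on V U' W f" using loc[of "fst z"] by auto
      obtain T where T: "open T" "U' = V \<inter> T"
        using smooth_on_openin[OF U'(2) sV] by (auto simp: openin_open)
      have "continuous_on (U' \<times> sequences_in V) (\<lambda>(x, p). \<phi> x p)"
        by (rule smooth_familyD(1)[OF smooth_family_iter_deriv[OF U'(2) sV] \<phi>S])
      then have "((\<lambda>(x, p). \<phi> x p) \<longlongrightarrow> (\<lambda>(x, p). \<phi> x p) z) (at z within (U' \<times> sequences_in V))"
        unfolding continuous_on_def using z U'(1) by (cases z) auto
      then have *: "((\<lambda>(x, p). \<phi> x p) \<longlongrightarrow> (\<lambda>(x, p). \<phi> x p) z) (at z within ((U' \<inter> U) \<times> sequences_in V))"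
        by (rule tendsto_within_subset) auto
      have UV: "U \<subseteq> V" using U openin_imp_subset by blast
      have "at z within (U \<times> sequences_in V) = at z within ((U' \<inter> U) \<times> sequences_in V)"
        by (rule at_within_nhd[of _ "T \<times> UNIV"]) (use U'(1) T UV in \<open>auto simp: mem_Times_iff intro: open_Times\<close>)
      with * show "((\<lambda>(x, p). \<phi> x p) \<longlongrightarrow> (\<lambda>(x, p). \<phi> x p) z) (at z within (U \<times> sequences_in V))"
        by simp
    qed
    fix n
    let ?\<phi>' = "\<lambda>x p. iter_deriv f (Suc k) (p \<circ> \<tau>(k := n)) x"
    have "(diff_quot (\<lambda>y. \<phi> y p) x (p n) \<longlongrightarrow> ?\<phi>' x p) (at 0)" if x: "x \<in> U" and p: "p \<in> sequences_in V" for x p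
    proof -
      obtain U' where U': "x \<in> U'" "smooth_on V U' W f" using loc[OF x] by blast
      have "iter_deriv f k (p \<circ> \<tau>) = iter_deriv f k (p \<circ> \<tau>(k := n))"
        by (intro ext iter_deriv_cong_directions) auto
      moreover have "p \<circ> \<tau>(k := n) \<in> sequences_in V" using p by auto
      ultimately show ?thesis
        using tendsto_iter_deriv[OF U'(2) sV U'(1), of "p \<circ> \<tau>(k := n)" k] by (simp add: \<phi> del: iter_deriv.simps)
    qed
    then show "\<exists>\<phi>'\<in>?S. derivative_along V U n \<phi> \<phi>'"
      by (intro bexI[of _ ?\<phi>'] ballI CollectI exI[of _ "Suc k"] exI[of _ "\<tau>(k := n)"]) simp_all
  qed
  then show ?thesis
    by (rule smooth_on_familyI[OF V U, of _ _ "\<lambda>x p. iter_deriv f 0 (p \<circ> id) x"])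
      (auto intro: exI[of _ 0] exI[of _ id])
qed

lemma smooth_on_Pair:
  assumes V: "locally_convex_space V" and f: "smooth_on V U W f" and g: "smooth_on V U Z g"
  shows "smooth_on V U (W \<times> Z) (\<lambda>x. (f x, g x))"
proof -
  note sV = lcs_subspace[OF V]
  define F where "F = {\<lambda>x p. iter_deriv f k (p \<circ> \<tau>) x | k (\<tau> :: nat \<Rightarrow> nat). True}"
  define G where "G = {\<lambda>x p. iter_deriv g k (p \<circ> \<tau>) x | k (\<tau> :: nat \<Rightarrow> nat). True}"
  let ?S = "{\<lambda>x p. (\<phi> x p, \<psi> x p) | \<phi> \<psi>. \<phi> \<in> F \<and> \<psi> \<in> G}"
  note FD = smooth_familyD[OF smooth_family_iter_deriv[OF f sV, folded F_def]]
  note GD = smooth_familyD[OF smooth_family_iter_deriv[OF g sV, folded G_def]]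
  have "smooth_family V U (W \<times> Z) ?S"
    unfolding smooth_family_def
  proof (intro ballI conjI allI)
    fix \<eta> assume "\<eta> \<in> ?S"
    then obtain \<phi> \<psi> where \<eta>: "\<eta> = (\<lambda>x p. (\<phi> x p, \<psi> x p))" and \<phi>: "\<phi> \<in> F" and \<psi>: "\<psi> \<in> G"
      by blast
    show "continuous_on (U \<times> sequences_in V) (\<lambda>(x, p). \<eta> x p)"
      using continuous_on_Pair[OF FD(1)[OF \<phi>] GD(1)[OF \<psi>]] by (simp add: \<eta> case_prod_unfold)
    show "\<eta> x p \<in> W \<times> Z" if "x \<in> U" "p \<in> sequences_in V" for x p
      unfolding \<eta> by (intro SigmaI FD(2)[OF \<phi> that] GD(2)[OF \<psi> that])
    fix n
    from FD(3)[OF \<phi>, of n] obtain \<phi>' where \<phi>': "\<phi>' \<in> F"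
      "derivative_along V U n \<phi> \<phi>'" by (elim bexE)
    from GD(3)[OF \<psi>, of n] obtain \<psi>' where \<psi>': "\<psi>' \<in> G"
      "derivative_along V U n \<psi> \<psi>'" by (elim bexE)
    have "(diff_quot (\<lambda>y. \<eta> y p) x (p n) \<longlongrightarrow> (\<phi>' x p, \<psi>' x p)) (at 0)"
      if "x \<in> U" "p \<in> sequences_in V" for x p
      using tendsto_Pair[OF \<phi>'(2)[rule_format, OF that] \<psi>'(2)[rule_format, OF that]]
      by (simp add: \<eta> diff_quot_def[abs_def])
    then show "\<exists>\<phi>'\<in>?S. derivative_along V U n \<eta> \<phi>'"
      by (intro bexI[of _ "\<lambda>x p. (\<phi>' x p, \<psi>' x p)"] ballI CollectI exI[of _ \<phi>'] exI[of _ \<psi>'] conjI refl \<phi>'(1) \<psi>'(1))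
  qed
  then show ?thesis
  proof (rule smooth_on_familyI[OF V smooth_on_openin[OF f sV]])
    have "(\<lambda>x p. iter_deriv f 0 (p \<circ> id) x) \<in> F" "(\<lambda>x p. iter_deriv g 0 (p \<circ> id) x) \<in> G"
      unfolding F_def G_def by blast+
    then show "(\<lambda>x p. (iter_deriv f 0 (p \<circ> id) x, iter_deriv g 0 (p \<circ> id) x)) \<in> ?S"
      by (intro CollectI exI[of _ "\<lambda>x p. iter_deriv f 0 (p \<circ> id) x"]
          exI[of _ "\<lambda>x p. iter_deriv g 0 (p \<circ> id) x"] conjI refl)
  qed simp
qed

lemma smooth_on_vec:
  fixes f :: "'v::{real_vector,t2_space} \<Rightarrow> 'w::{real_vector,t2_space} ^ 'n"
  assumes V: "locally_convex_space V" and f: "\<And>i. smooth_on V U UNIV (\<lambda>x. f x $ i)"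
  shows "smooth_on V U UNIV f"
proof -
  note sV = lcs_subspace[OF V]
  define F where "F = (\<lambda>i. {\<lambda>x p. iter_deriv (\<lambda>x. f x $ i) k (p \<circ> \<tau>) x | k (\<tau> :: nat \<Rightarrow> nat). True})"
  let ?S = "{\<lambda>x p. (\<chi> i. \<phi> i x p) | \<phi>. \<forall>i. \<phi> i \<in> F i}"
  have FD: "smooth_family V U UNIV (F i)" for i
    unfolding F_def by (rule smooth_family_iter_deriv[OF f sV])
  note FD = smooth_familyD[OF FD]
  have "smooth_family V U UNIV ?S"
    unfolding smooth_family_def
  proof (intro ballI conjI allI)
    fix \<eta> assume "\<eta> \<in> ?S"
    then obtain \<phi> where \<eta>: "\<eta> = (\<lambda>x p. (\<chi> i. \<phi> i x p))" and \<phi>: "\<And>i. \<phi> i \<in> F i"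
      by blast
    show "continuous_on (U \<times> sequences_in V) (\<lambda>(x, p). \<eta> x p)"
      using FD(1)[OF \<phi>] by (simp add: \<eta> case_prod_unfold continuous_on_vec_lambda)
    fix n
    from FD(3)[OF \<phi>, of _ n] have "\<forall>i. \<exists>\<phi>'. \<phi>' \<in> F i \<and>
      (\<forall>x\<in>U. \<forall>p\<in>sequences_in V. (diff_quot (\<lambda>y. \<phi> i y p) x (p n) \<longlongrightarrow> \<phi>' x p) (at 0))" by blast
    from choice[OF this] obtain \<phi>' where \<phi>': "\<And>i. \<phi>' i \<in> F i"
      "\<And>i. \<forall>x\<in>U. \<forall>p\<in>sequences_in V. (diff_quot (\<lambda>y. \<phi> i y p) x (p n) \<longlongrightarrow> \<phi>' i x p) (at 0)" by blast
    have "(diff_quot (\<lambda>y. \<eta> y p) x (p n) \<longlongrightarrow> (\<chi> i. \<phi>' i x p)) (at 0)"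
      if "x \<in> U" "p \<in> sequences_in V" for x p
      using \<phi>'(2)[rule_format, OF that]
      by (intro vec_tendstoI) (simp add: \<eta> diff_quot_def[abs_def])
    then show "\<exists>\<phi>'\<in>?S. derivative_along V U n \<eta> \<phi>'"
      by (intro bexI[of _ "\<lambda>x p. (\<chi> i. \<phi>' i x p)"] ballI CollectI exI[of _ \<phi>'] conjI refl allI \<phi>'(1))
  qed simp
  then show ?thesis
  proof (rule smooth_on_familyI[OF V smooth_on_openin[OF f sV]])
    have "(\<lambda>x p. iter_deriv (\<lambda>x. f x $ i) 0 (p \<circ> id) x) \<in> F i" for i
      unfolding F_def by blast
    then show "(\<lambda>x p. (\<chi> i. iter_deriv (\<lambda>x. f x $ i) 0 (p \<circ> id) x)) \<in> ?S"
      by (intro CollectI exI[of _ "\<lambda>i x p. iter_deriv (\<lambda>x. f x $ i) 0 (p \<circ> id) x"] conjI allI refl)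
  qed (simp add: vec_eq_iff)
qed

lemma smooth_on_const:
  assumes V: "locally_convex_space V" and "openin (top_of_set V) U" and W: "locally_convex_space W" and "c \<in> W"
  shows "smooth_on V U W (\<lambda>_. c)"
proof (rule smooth_on_familyI[OF assms(1,2)])
  have d: "(diff_quot (\<lambda>_. b) x h \<longlongrightarrow> 0) (at 0)" for b :: 'b and x h :: 'a
    by (simp add: diff_quot_def[abs_def])
  show "smooth_family V U W {\<lambda>x p. c, \<lambda>x p. 0}"
    unfolding smooth_family_def using subspace_0[OF lcs_subspace[OF W]] assms(4)
    by (auto simp: d case_prod_unfold)
qed auto

lemma smooth_on_linear:
  assumes V: "locally_convex_space V" and W: "locally_convex_space W"
    and add: "\<And>x y. x \<in> V \<Longrightarrow> y \<in> V \<Longrightarrow> L (x + y) = L x + L y"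
    and scale: "\<And>r x. x \<in> V \<Longrightarrow> L (r *\<^sub>R x) = r *\<^sub>R L x"
    and cont: "continuous_on V L" and LW: "\<And>x. x \<in> V \<Longrightarrow> L x \<in> W"
  shows "smooth_on V V W L"
proof -
  note sV = lcs_subspace[OF V]
  let ?S = "{\<lambda>x p. L x, \<lambda>x p. 0} \<union> {\<lambda>x p. L (p n) | n :: nat. True}"
  have d0: "(diff_quot (\<lambda>_. b) x h \<longlongrightarrow> 0) (at 0)" for b :: 'b and x h :: 'a
    by (simp add: diff_quot_def[abs_def])
  have dL: "(diff_quot L x h \<longlongrightarrow> L h) (at 0)" if "x \<in> V" "h \<in> V" for x h
  proof (rule Lim_transform_eventually[OF tendsto_const])
    show "\<forall>\<^sub>F t in at 0. L h = diff_quot L x h t"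
      using that sV by (auto simp: eventually_at_filter diff_quot_def add scale subspace_scale)
  qed
  have "smooth_family V V W ?S"
    unfolding smooth_family_def
  proof
    fix \<phi> assume "\<phi> \<in> ?S"
    then consider "\<phi> = (\<lambda>x p. L x)" | "\<phi> = (\<lambda>x p. 0)" | n where "\<phi> = (\<lambda>x p. L (p n))" by blast
    then show "continuous_on (V \<times> sequences_in V) (\<lambda>(x, p). \<phi> x p) \<and>
        (\<forall>x\<in>V. \<forall>p\<in>sequences_in V. \<phi> x p \<in> W) \<and>
        (\<forall>n. \<exists>\<phi>'\<in>?S. derivative_along V V n \<phi> \<phi>')"
    proof cases
      case 1
      have "continuous_on (V \<times> sequences_in V) (\<lambda>z. L (fst z))"
        by (rule continuous_on_compose2[OF cont continuous_on_fst[OF continuous_on_id]]) auto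
      moreover have "\<exists>\<phi>'\<in>?S. \<forall>x\<in>V. \<forall>p\<in>sequences_in V. (diff_quot L x (p n) \<longlongrightarrow> \<phi>' x p) (at 0)" for n
        by (rule bexI[of _ "\<lambda>x p. L (p n)"]) (auto intro!: dL)
      ultimately show ?thesis using LW by (simp add: 1 case_prod_unfold)
    next
      case 2
      have "\<exists>\<phi>'\<in>?S. \<forall>x\<in>V. \<forall>p\<in>sequences_in V. (diff_quot (\<lambda>y. 0::'b) x (p n) \<longlongrightarrow> \<phi>' x p) (at 0)" for n
        by (rule bexI[of _ "\<lambda>x p. 0"]) (auto intro!: d0)
      then show ?thesis using subspace_0[OF lcs_subspace[OF W]] by (simp add: 2 case_prod_unfold)
    next
      case (3 m)
      have "continuous_on (V \<times> sequences_in V) (\<lambda>z. L (snd z m))"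
        by (rule continuous_on_compose2[OF cont
            continuous_on_product_then_coordinatewise[OF continuous_on_snd[OF continuous_on_id]]]) auto
      moreover have "\<exists>\<phi>'\<in>?S. \<forall>x\<in>V. \<forall>p\<in>sequences_in V. (diff_quot (\<lambda>y. L (p m)) x (p n) \<longlongrightarrow> \<phi>' x p) (at 0)" for n
        by (rule bexI[of _ "\<lambda>x p. 0"]) (auto intro!: d0)
      ultimately show ?thesis using LW by (simp add: 3 case_prod_unfold Pi_iff)
    qed
  qed
  then show ?thesis
    by (rule smooth_on_familyI[OF V openin_subtopology_self, of _ _ "\<lambda>x p. L x"]) auto
qed

text \<open>The third derivative of a bilinear map vanishes, so a smooth family can be listed.\<close>

lemma smooth_on_bilinear:
  fixes b :: "'u::{real_vector,t2_space} \<Rightarrow> 'v::{real_vector,t2_space} \<Rightarrow> 'w::{real_vector,t2_space}"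
  assumes U: "locally_convex_space (UNIV :: 'u set)" and V: "locally_convex_space (UNIV :: 'v set)"
    and UV: "locally_convex_space (UNIV :: ('u \<times> 'v) set)" and W: "locally_convex_space (UNIV :: 'w set)"
    and add: "\<And>x x' y. b (x + x') y = b x y + b x' y" "\<And>x y y'. b x (y + y') = b x y + b x y'"
    and scale: "\<And>r x y. b (r *\<^sub>R x) y = r *\<^sub>R b x y" "\<And>r x y. b x (r *\<^sub>R y) = r *\<^sub>R b x y"
    and cont: "continuous_on UNIV (\<lambda>(x, y). b x y)"
  shows "smooth_on UNIV UNIV UNIV (\<lambda>(x, y). b x y)"
proof -
  let ?B = "\<lambda>x h. b (fst x) (snd h) + b (fst h) (snd x)"
  let ?S = "{\<lambda>x p. b (fst x) (snd x), \<lambda>x p. 0} \<union> {\<lambda>x p. ?B x (p i) | i :: nat. True} \<union> {\<lambda>x p. ?B (p j) (p i) | (i :: nat) (j :: nat). True}"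
  have d0: "(diff_quot (\<lambda>_. b) x h \<longlongrightarrow> 0) (at 0)" for b :: 'w and x h :: "'u \<times> 'v"
    by (simp add: diff_quot_def[abs_def])
  have db: "(diff_quot (\<lambda>x. b (fst x) (snd x)) x h \<longlongrightarrow> ?B x h) (at 0)" for x h
  proof (rule Lim_transform_eventually)
    have "((\<lambda>t. ?B x h + t *\<^sub>R b (fst h) (snd h)) \<longlongrightarrow> ?B x h + 0 *\<^sub>R b (fst h) (snd h)) (at 0)"
      by (intro tendsto_add_lcs[OF W tendsto_const tendsto_scaleR_lcs[OF W tendsto_const tendsto_ident_at]]) auto
    then show "((\<lambda>t. ?B x h + t *\<^sub>R b (fst h) (snd h)) \<longlongrightarrow> ?B x h) (at 0)" by simp
    show "\<forall>\<^sub>F t in at 0. ?B x h + t *\<^sub>R b (fst h) (snd h) = diff_quot (\<lambda>x. b (fst x) (snd x)) x h t"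
      by (auto simp: eventually_at_filter diff_quot_def add scale scaleR_add_right)
  qed
  have dB: "(diff_quot (\<lambda>x. ?B x h) x k \<longlongrightarrow> ?B k h) (at 0)" for x h k
  proof (rule Lim_transform_eventually[OF tendsto_const])
    show "\<forall>\<^sub>F t in at 0. ?B k h = diff_quot (\<lambda>x. ?B x h) x k t"
      by (auto simp: eventually_at_filter diff_quot_def add scale scaleR_add_right scaleR_diff_right)
  qed
  have cB: "continuous_on X (\<lambda>z. ?B (f z) (g z))" if "continuous_on X f" "continuous_on X g"
    for X and f g :: "('u \<times> 'v) \<times> (nat \<Rightarrow> 'u \<times> 'v) \<Rightarrow> 'u \<times> 'v"
    using continuous_on_compose2[OF cont continuous_on_Pair[OF continuous_on_fst[OF that(1)] continuous_on_snd[OF that(2)]]]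
      continuous_on_compose2[OF cont continuous_on_Pair[OF continuous_on_fst[OF that(2)] continuous_on_snd[OF that(1)]]]
    by (intro continuous_on_add_lcs[OF W]) simp_all
  note c1 = continuous_on_fst[OF continuous_on_id]
  note c2 = continuous_on_product_then_coordinatewise[OF continuous_on_snd[OF continuous_on_id]]
  have "smooth_family UNIV UNIV UNIV ?S"
    unfolding smooth_family_def
  proof
    fix \<phi> assume "\<phi> \<in> ?S"
    then consider "\<phi> = (\<lambda>x p. b (fst x) (snd x))" | "\<phi> = (\<lambda>x p. 0)" | i where "\<phi> = (\<lambda>x p. ?B x (p i))"
      | i j where "\<phi> = (\<lambda>x p. ?B (p j) (p i))" by blast
    then show "continuous_on (UNIV \<times> sequences_in UNIV) (\<lambda>(x, p). \<phi> x p) \<and>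
        (\<forall>x\<in>UNIV. \<forall>p\<in>sequences_in UNIV. \<phi> x p \<in> UNIV) \<and>
        (\<forall>n. \<exists>\<phi>'\<in>?S. derivative_along UNIV UNIV n \<phi> \<phi>')"
    proof cases
      case 1
      have "continuous_on (UNIV \<times> sequences_in UNIV) (\<lambda>z :: ('u \<times> 'v) \<times> (nat \<Rightarrow> 'u \<times> 'v). b (fst (fst z)) (snd (fst z)))"
        using continuous_on_compose2[OF cont continuous_on_fst[OF continuous_on_id]] by (simp add: case_prod_unfold)
      moreover have "\<exists>\<phi>'\<in>?S. \<forall>x\<in>UNIV. \<forall>p\<in>sequences_in UNIV. (diff_quot (\<lambda>x. b (fst x) (snd x)) x (p n) \<longlongrightarrow> \<phi>' x p) (at 0)" for n
        by (rule bexI[of _ "\<lambda>x p. ?B x (p n)"]) (intro ballI db, blast)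
      ultimately show ?thesis by (simp add: 1 case_prod_unfold)
    next
      case 2
      have "\<exists>\<phi>'\<in>?S. \<forall>x\<in>UNIV. \<forall>p\<in>sequences_in UNIV. (diff_quot (\<lambda>y. 0::'w) x (p n) \<longlongrightarrow> \<phi>' x p) (at 0)" for n
        by (rule bexI[of _ "\<lambda>x p. 0"]) (auto intro!: d0)
      then show ?thesis by (simp add: 2 case_prod_unfold)
    next
      case (3 i)
      have "\<exists>\<phi>'\<in>?S. \<forall>x\<in>UNIV. \<forall>p\<in>sequences_in UNIV. (diff_quot (\<lambda>x. ?B x (p i)) x (p n) \<longlongrightarrow> \<phi>' x p) (at 0)" for n
        by (rule bexI[of _ "\<lambda>x p. ?B (p n) (p i)"]) (intro ballI dB, blast)
      then show ?thesis using cB[OF c1 c2[of _ i]] by (simp add: 3 case_prod_unfold)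
    next
      case (4 i j)
      have "\<exists>\<phi>'\<in>?S. \<forall>x\<in>UNIV. \<forall>p\<in>sequences_in UNIV. (diff_quot (\<lambda>x. ?B (p j) (p i)) x (p n) \<longlongrightarrow> \<phi>' x p) (at 0)" for n
        by (rule bexI[of _ "\<lambda>x p. 0"]) (auto intro!: d0)
      then show ?thesis using cB[OF c2[of _ j] c2[of _ i]] by (simp add: 4 case_prod_unfold)
    qed
  qed
  then show ?thesis
    by (rule smooth_on_familyI[OF UV openin_subtopology_self, of _ _ "\<lambda>x p. b (fst x) (snd x)"]) auto
qed

subsection \<open>Subspaces, products and powers of locally convex spaces\<close>

lemma locally_convex_spaceI:
  assumes "subspace V"
    and add: "\<And>x y. x \<in> V \<Longrightarrow> y \<in> V \<Longrightarrow>
      ((\<lambda>z. fst z + snd z) \<longlongrightarrow> x + y) (at (x, y) within V \<times> V)"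
    and scale: "\<And>r x. x \<in> V \<Longrightarrow> ((\<lambda>z. fst z *\<^sub>R snd z) \<longlongrightarrow> r *\<^sub>R x) (at (r, x) within UNIV \<times> V)"
    and nbhd: "\<And>U. openin (top_of_set V) U \<Longrightarrow> 0 \<in> U \<Longrightarrow>
      \<exists>W. openin (top_of_set V) W \<and> convex W \<and> 0 \<in> W \<and> W \<subseteq> U"
  shows "locally_convex_space V"
  unfolding locally_convex_space_def
  using assms by (auto simp: continuous_on_def case_prod_unfold)

lemma tendsto_minus_lcs:
  assumes V: "locally_convex_space V" and "(f \<longlongrightarrow> a) F" "\<forall>\<^sub>F z in F. f z \<in> V" "a \<in> V"
  shows "((\<lambda>z. - f z) \<longlongrightarrow> - a) F"
  using tendsto_diff_lcs[OF V tendsto_const assms(2) _ assms(3) _ assms(4), of 0]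
    subspace_0[OF lcs_subspace[OF V]] by simp

lemma locally_convex_space_subset:
  assumes V: "locally_convex_space V" and "subspace V'" "V' \<subseteq> V"
  shows "locally_convex_space V'"
  unfolding locally_convex_space_def
proof (intro conjI allI impI assms(2))
  have c: "continuous_on (V \<times> V) (\<lambda>(x, y). x + y)" "continuous_on (UNIV \<times> V) (\<lambda>(r::real, x). r *\<^sub>R x)"
    using V unfolding locally_convex_space_def by - (elim conjE, assumption)+
  show "continuous_on (V' \<times> V') (\<lambda>(x, y). x + y)"
    by (rule continuous_on_subset[OF c(1)]) (use assms in auto)
  show "continuous_on (UNIV \<times> V') (\<lambda>(r::real, x). r *\<^sub>R x)"
    by (rule continuous_on_subset[OF c(2)]) (use assms in auto)
  fix U assume U: "openin (top_of_set V') U \<and> 0 \<in> U"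
  then obtain T where T: "open T" "U = V' \<inter> T" by (auto simp: openin_open)
  then have "openin (top_of_set V) (V \<inter> T)" "0 \<in> V \<inter> T" using U assms by (auto simp: openin_open_Int)
  then obtain N where N: "openin (top_of_set V) N" "convex N" "0 \<in> N" "N \<subseteq> V \<inter> T"
    using lcs_convex_neighbourhood[OF V] by metis
  obtain T' where T': "open T'" "N = V \<inter> T'" using N(1) by (auto simp: openin_open)
  have "V' \<inter> N = V' \<inter> T'" using T' assms(3) by auto
  then have "openin (top_of_set V') (V' \<inter> N)" using T' by (simp add: openin_open_Int)
  moreover have "convex (V' \<inter> N)"
    by (intro convex_Int subspace_imp_convex assms N)
  ultimately show "\<exists>W. openin (top_of_set V') W \<and> convex W \<and> 0 \<in> W \<and> W \<subseteq> U"
    using N T subspace_0[OF assms(2)] by (intro exI[of _ "V' \<inter> N"]) auto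
qed

lemma locally_convex_space_Times:
  assumes V: "locally_convex_space V" and W: "locally_convex_space W"
  shows "locally_convex_space (V \<times> W)"
proof (rule locally_convex_spaceI)
  note sV = lcs_subspace[OF V] and sW = lcs_subspace[OF W]
  show "subspace (V \<times> W)" by (rule subspace_Times[OF sV sW])
  have ev: "\<forall>\<^sub>F z in at z0 within X. z \<in> X" for z0 :: "'c::topological_space" and X
    by (simp add: eventually_at_filter)
  have fsts: "((\<lambda>z. fst (fst z)) \<longlongrightarrow> fst (fst z0)) (at z0 within X)"
    "((\<lambda>z. snd (fst z)) \<longlongrightarrow> snd (fst z0)) (at z0 within X)"
    "((\<lambda>z. fst (snd z)) \<longlongrightarrow> fst (snd z0)) (at z0 within X)"
    "((\<lambda>z. snd (snd z)) \<longlongrightarrow> snd (snd z0)) (at z0 within X)" for z0 :: "('a \<times> 'b) \<times> ('a \<times> 'b)" and X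
    by (intro tendsto_fst tendsto_snd tendsto_ident_at)+
  have snds: "((\<lambda>z. fst z) \<longlongrightarrow> fst z0) (at z0 within X)"
    "((\<lambda>z. fst (snd z)) \<longlongrightarrow> fst (snd z0)) (at z0 within X)"
    "((\<lambda>z. snd (snd z)) \<longlongrightarrow> snd (snd z0)) (at z0 within X)" for z0 :: "real \<times> ('a \<times> 'b)" and X
    by (intro tendsto_fst tendsto_snd tendsto_ident_at)+
  {
    fix x y assume xy: "x \<in> V \<times> W" "y \<in> V \<times> W"
    let ?F = "at (x, y) within (V \<times> W) \<times> (V \<times> W)"
    have e: "\<forall>\<^sub>F z in ?F. fst (fst z) \<in> V" "\<forall>\<^sub>F z in ?F. snd (fst z) \<in> W"
      "\<forall>\<^sub>F z in ?F. fst (snd z) \<in> V" "\<forall>\<^sub>F z in ?F. snd (snd z) \<in> W"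
      using ev[of "(V \<times> W) \<times> (V \<times> W)" "(x, y)"] by (eventually_elim, auto)+
    have "((\<lambda>z. (fst (fst z) + fst (snd z), snd (fst z) + snd (snd z))) \<longlongrightarrow> (fst x + fst y, snd x + snd y)) ?F"
      using xy fsts[of "(x, y)"]
      by (intro tendsto_Pair tendsto_add_lcs[OF V _ _ e(1,3)] tendsto_add_lcs[OF W _ _ e(2,4)]) (simp_all add: mem_Times_iff)
    then show "((\<lambda>z. fst z + snd z) \<longlongrightarrow> x + y) ?F"
      by (simp add: plus_prod_def)
  next
    fix r :: real and x assume x: "x \<in> V \<times> W"
    let ?F = "at (r, x) within UNIV \<times> (V \<times> W)"
    have e: "\<forall>\<^sub>F z in ?F. fst (snd z) \<in> V" "\<forall>\<^sub>F z in ?F. snd (snd z) \<in> W"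
      using ev[of "UNIV \<times> (V \<times> W)" "(r, x)"] by (eventually_elim, auto)+
    have "((\<lambda>z. (fst z *\<^sub>R fst (snd z), fst z *\<^sub>R snd (snd z))) \<longlongrightarrow> (r *\<^sub>R fst x, r *\<^sub>R snd x)) ?F"
      using x snds[of "(r, x)"]
      by (intro tendsto_Pair tendsto_scaleR_lcs[OF V _ _ e(1)] tendsto_scaleR_lcs[OF W _ _ e(2)]) (simp_all add: mem_Times_iff)
    then show "((\<lambda>z. fst z *\<^sub>R snd z) \<longlongrightarrow> r *\<^sub>R x) ?F"
      by (simp add: scaleR_prod_def)
  next
    fix U assume "openin (top_of_set (V \<times> W)) U" "0 \<in> U"
    then have "openin (prod_topology (top_of_set V) (top_of_set W)) U" "(0, 0) \<in> U"
      by (simp_all add: zero_prod_def)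
    from openin_prod_topology_alt[THEN iffD1, rule_format, OF this]
    obtain A B where AB: "openin (top_of_set V) A" "openin (top_of_set W) B" "0 \<in> A" "0 \<in> B" "A \<times> B \<subseteq> U"
      by (elim exE conjE) (rule that)
    obtain A' where A': "openin (top_of_set V) A'" "convex A'" "0 \<in> A'" "A' \<subseteq> A"
      using lcs_convex_neighbourhood[OF V AB(3,1)] by blast
    obtain B' where B': "openin (top_of_set W) B'" "convex B'" "0 \<in> B'" "B' \<subseteq> B"
      using lcs_convex_neighbourhood[OF W AB(4,2)] by blast
    show "\<exists>N. openin (top_of_set (V \<times> W)) N \<and> convex N \<and> 0 \<in> N \<and> N \<subseteq> U"
      using A' B' AB(5) by (intro exI[of _ "A' \<times> B'"])
        (auto simp: convex_Times zero_prod_def openin_Times)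
  }
qed

lemma locally_convex_space_vec:
  assumes V: "locally_convex_space (UNIV :: 'v::{real_vector,t2_space} set)"
  shows "locally_convex_space (UNIV :: ('v ^ 'n) set)"
proof (rule locally_convex_spaceI)
  {
    fix x y :: "'v ^ 'n"
    show "((\<lambda>z. fst z + snd z) \<longlongrightarrow> x + y) (at (x, y) within UNIV \<times> UNIV)"
    proof (rule vec_tendstoI)
      fix i
      have "((\<lambda>z. fst z $ i + snd z $ i) \<longlongrightarrow> x $ i + y $ i) (at (x, y))"
        using tendsto_fst[OF tendsto_ident_at, of "(x, y)" UNIV] tendsto_snd[OF tendsto_ident_at, of "(x, y)" UNIV]
        by (intro tendsto_add_lcs[OF V] tendsto_vec_nth) simp_all
      then show "((\<lambda>z. (fst z + snd z) $ i) \<longlongrightarrow> (x + y) $ i) (at (x, y) within UNIV \<times> UNIV)"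
        by simp
    qed
  next
    fix r :: real and x :: "'v ^ 'n"
    show "((\<lambda>z. fst z *\<^sub>R snd z) \<longlongrightarrow> r *\<^sub>R x) (at (r, x) within UNIV \<times> UNIV)"
    proof (rule vec_tendstoI)
      fix i
      have "((\<lambda>z. fst z *\<^sub>R (snd z $ i)) \<longlongrightarrow> r *\<^sub>R (x $ i)) (at (r, x))"
        using tendsto_fst[OF tendsto_ident_at, of "(r, x)" UNIV] tendsto_snd[OF tendsto_ident_at, of "(r, x)" UNIV]
        by (intro tendsto_scaleR_lcs[OF V] tendsto_vec_nth) simp_all
      then show "((\<lambda>z. (fst z *\<^sub>R snd z) $ i) \<longlongrightarrow> (r *\<^sub>R x) $ i) (at (r, x) within UNIV \<times> UNIV)"
        by simp
    qed
  next
    fix U :: "('v ^ 'n) set" assume "openin (top_of_set UNIV) U" "0 \<in> U"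
    then have "open U" by simp
    with \<open>0 \<in> U\<close> obtain A where A: "\<And>i. open (A i)" "\<And>i. 0 \<in> A i" "\<And>y. (\<forall>i. y $ i \<in> A i) \<Longrightarrow> y \<in> U"
      unfolding open_vec_def by (metis zero_index)
    have "\<exists>N. open N \<and> convex N \<and> 0 \<in> N \<and> N \<subseteq> A i" for i
    proof -
      have "openin (top_of_set UNIV) (A i)" using A(1) by simp
      from lcs_convex_neighbourhood[OF V A(2) this]
      obtain N where "openin (top_of_set UNIV) N" "convex N" "0 \<in> N" "N \<subseteq> A i" .
      then show ?thesis by (intro exI[of _ N]) simp
    qed
    then obtain N where N: "\<And>i. open (N i)" "\<And>i. convex (N i)" "\<And>i. 0 \<in> N i" "\<And>i. N i \<subseteq> A i"
      by metis
    let ?N = "{y. \<forall>i. y $ i \<in> N i}"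
    have "open ?N" unfolding open_vec_def
      using N(1) by (auto intro!: exI[of _ N])
    moreover have "convex ?N"
      using N(2) by (auto simp: convex_def)
    ultimately show "\<exists>W. openin (top_of_set UNIV) W \<and> convex W \<and> 0 \<in> W \<and> W \<subseteq> U"
      using N(3,4) A(3) by (intro exI[of _ ?N]) (auto, blast)
  }
qed simp

section \<open>Matrices over a continuous inverse algebra\<close>

lemma matrix_inv_eqI: "A ** B = mat 1 \<Longrightarrow> B ** A = mat 1 \<Longrightarrow> matrix_inv A = B"
  for A B :: "'a::semiring_1 ^ 'n ^ 'n"
  unfolding matrix_inv_def
  by (rule some_equality) (auto, metis matrix_mul_assoc matrix_mul_rid)

lemma invertible_matrix_inv:
  fixes A :: "'a::semiring_1 ^ 'n ^ 'n"
  assumes "invertible A"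
  shows "A ** matrix_inv A = mat 1" "matrix_inv A ** A = mat 1"
  using someI_ex[OF assms[unfolded invertible_def]] unfolding matrix_inv_def by auto

lemma invertibleI: "A ** B = mat 1 \<Longrightarrow> B ** A = mat 1 \<Longrightarrow> invertible A"
  unfolding invertible_def by blast

lemma matrix_mult_add: 
  fixes A B C :: "'a::ring_1 ^ 'n ^ 'n"
  shows "A ** (B + C) = A ** B + A ** C" "(B + C) ** A = B ** A + C ** A"
    "A ** (B - C) = A ** B - A ** C" "(B - C) ** A = B ** A - C ** A"
    "(- B) ** A = - (B ** A)" "A ** (- B) = - (A ** B)" "A ** 0 = 0" "0 ** A = 0"
  by (simp_all add: vec_eq_iff matrix_matrix_mult_def algebra_simps sum.distrib sum_subtractf sum_negf)

lemma matrix_mult_scaleR: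
  fixes A B :: "'a::real_algebra_1 ^ 'n ^ 'n"
  shows "(r *\<^sub>R A) ** B = r *\<^sub>R (A ** B)" "A ** (r *\<^sub>R B) = r *\<^sub>R (A ** B)"
  by (simp_all add: vec_eq_iff matrix_matrix_mult_def scaleR_sum_right)

definition elimination_matrix :: "'n \<Rightarrow> ('n \<Rightarrow> 'a::zero_neq_one) \<Rightarrow> 'a ^ 'n ^ 'n" where
  "elimination_matrix k r = (\<chi> i j. if i = k then r j else if i = j then 1 else 0)"

lemma mult_elimination_matrix:
  fixes A :: "'a::ring_1 ^ 'n ^ 'n"
  shows "(A ** elimination_matrix k r) $ i $ j = A $ i $ k * r j + (if j = k then 0 else A $ i $ j)"
proof -
  have "(A ** elimination_matrix k r) $ i $ j =
      (\<Sum>m\<in>UNIV. A $ i $ m * (if m = k then r j else if m = j then 1 else 0))"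
    by (simp add: matrix_matrix_mult_def elimination_matrix_def)
  also have "\<dots> = A $ i $ k * r j + (\<Sum>m\<in>UNIV - {k}. A $ i $ m * (if m = k then r j else if m = j then 1 else 0))"
    by (subst sum.remove[of _ k]) auto
  also have "(\<Sum>m\<in>UNIV - {k}. A $ i $ m * (if m = k then r j else if m = j then 1 else 0))
      = (\<Sum>m\<in>UNIV - {k}. if m = j then A $ i $ m else 0)"
    by (rule sum.cong) auto
  finally show ?thesis by (simp add: sum.delta')
qed

text \<open>The hypotheses are the entries of row \<open>k\<close> of the product; its other rows are those of the
  identity matrix in any case.\<close>

lemma elimination_matrix_mult:
  fixes r s :: "'n::finite \<Rightarrow> 'a::ring_1"
  assumes "r k * s k = 1" "\<And>j. j \<noteq> k \<Longrightarrow> r k * s j + r j = 0"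
  shows "elimination_matrix k r ** elimination_matrix k s = mat 1"
  unfolding vec_eq_iff mult_elimination_matrix
  using assms by (auto simp: elimination_matrix_def mat_def)

lemma alg_inverse_unit:
  assumes "a \<in> alg_units"
  shows "a * alg_inverse a = 1" "alg_inverse a * a = 1"
proof -
  obtain b where b: "a * b = 1" "b * a = 1" using assms by (auto simp: alg_units_def)
  have "alg_inverse a = b"
    unfolding alg_inverse_def
  proof (rule the_equality)
    fix c assume "a * c = 1 \<and> c * a = 1"
    then show "c = b" by (metis b(2) mult.assoc mult_1_left mult_1_right)
  qed (use b in simp)
  then show "a * alg_inverse a = 1" "alg_inverse a * a = 1" using b by simp_all
qed

context continuous_inverse_algebra
begin

lemma tendsto_mult_cia:
  assumes "(f \<longlongrightarrow> a) F" "(g \<longlongrightarrow> b) F"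
  shows "((\<lambda>z. f z * g z :: 'a) \<longlongrightarrow> a * b) F"
  using continuous_on_tendsto_compose[OF continuous_mult tendsto_Pair[OF assms]] by simp

lemma tendsto_matrix_mult:
  fixes f g :: "'c \<Rightarrow> 'a ^ 'n ^ 'n"
  assumes "(f \<longlongrightarrow> A) F" "(g \<longlongrightarrow> B) F"
  shows "((\<lambda>z. f z ** g z) \<longlongrightarrow> A ** B) F"
proof (intro vec_tendstoI)
  fix i j
  have "((\<lambda>z. \<Sum>k\<in>UNIV. f z $ i $ k * g z $ k $ j) \<longlongrightarrow> (\<Sum>k\<in>UNIV. A $ i $ k * B $ k $ j)) F"
    by (intro tendsto_sum_lcs[OF locally_convex] tendsto_mult_cia tendsto_vec_nth assms) auto
  then show "((\<lambda>z. (f z ** g z) $ i $ j) \<longlongrightarrow> (A ** B) $ i $ j) F"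
    by (simp add: matrix_matrix_mult_def)
qed

lemma continuous_matrix_mult:
  "continuous_on UNIV (\<lambda>(A :: 'a ^ 'n ^ 'n, B :: 'a ^ 'n ^ 'n). A ** B)"
  unfolding continuous_on_def case_prod_unfold
  by (intro ballI tendsto_matrix_mult tendsto_fst tendsto_snd tendsto_ident_at)

lemma lcs_matrix: "locally_convex_space (UNIV :: ('a ^ 'n ^ 'm) set)"
  by (intro locally_convex_space_vec locally_convex)

text \<open>Induction on the set \<open>S\<close> of rows that differ from those of the identity matrix. Row \<open>k\<close> is
  eliminated by multiplication from the right with the inverse of the elimination matrix of this
  row. That inverse exists and is close to the identity because the diagonal entry is close to
  \<open>1\<close>. It changes no row that agrees with the identity matrix in column \<open>k\<close>, so the product
  differs from the identity in the rows \<open>S - {k}\<close> only.\<close>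

lemma eventually_invertible_near_one:
  fixes X :: "'c \<Rightarrow> 'a ^ 'n ^ 'n" and S :: "'n set"
  assumes "finite S"
    and "(X \<longlongrightarrow> mat 1) F" "\<forall>\<^sub>F z in F. \<forall>i. i \<notin> S \<longrightarrow> X z $ i = mat 1 $ i"
  shows "(\<forall>\<^sub>F z in F. invertible (X z)) \<and> ((\<lambda>z. matrix_inv (X z)) \<longlongrightarrow> mat 1) F"
  using assms
proof (induction S arbitrary: X rule: finite_induct)
  case empty
  then have *: "\<forall>\<^sub>F z in F. X z = mat 1" by (simp add: vec_eq_iff)
  have "matrix_inv (mat 1 :: 'a ^ 'n ^ 'n) = mat 1" by (rule matrix_inv_eqI) simp_all
  moreover have "invertible (mat 1 :: 'a ^ 'n ^ 'n)" by (rule invertibleI) simp_all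
  ultimately have "\<forall>\<^sub>F z in F. invertible (X z) \<and> mat 1 = matrix_inv (X z)"
    using * by (auto elim: eventually_mono)
  then show ?case
    by (auto simp: eventually_conj_iff intro: Lim_transform_eventually[OF tendsto_const])
next
  case (insert k S)
  define u where "u = (\<lambda>z. alg_inverse (X z $ k $ k))"
  define r where "r = (\<lambda>z j. X z $ k $ j)"
  \<comment> \<open>Row \<open>k\<close> of the inverse of the elimination matrix of the row \<open>r\<close>.\<close>
  define s where "s = (\<lambda>z j. if j = k then u z else - (u z * X z $ k $ j))"
  have one: "(1::'a) \<in> alg_units" by (auto simp: alg_units_def intro: exI[of _ 1])
  have lim: "((\<lambda>z. X z $ i $ j) \<longlongrightarrow> mat 1 $ i $ j) F" for i j
    by (intro tendsto_vec_nth insert.prems)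
  from this[of k k] have lim1: "((\<lambda>z. X z $ k $ k) \<longlongrightarrow> 1) F" by (simp add: mat_def)
  have unit: "\<forall>\<^sub>F z in F. X z $ k $ k \<in> alg_units"
    by (rule topological_tendstoD[OF lim1 open_units one])
  have "alg_inverse (1::'a) = 1" using alg_inverse_unit(1)[OF one] by simp
  then have limu: "(u \<longlongrightarrow> 1) F"
    using continuous_on_tendsto_compose[OF continuous_inverse lim1 one unit] by (simp add: u_def)
  have lims: "((\<lambda>z. s z j) \<longlongrightarrow> (if j = k then 1 else 0)) F" for j
  proof (cases "j = k")
    case False
    have "((\<lambda>z. 0 - u z * X z $ k $ j) \<longlongrightarrow> 0 - 1 * (mat 1 :: 'a ^ 'n ^ 'n) $ k $ j) F"
      by (intro tendsto_diff_lcs[OF locally_convex] tendsto_mult_cia lim limu) auto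
    with False show ?thesis by (simp add: s_def mat_def)
  qed (use limu in \<open>simp add: s_def\<close>)
  let ?E = "\<lambda>z. elimination_matrix k (s z)"
  have limE: "(?E \<longlongrightarrow> mat 1) F"
  proof (intro vec_tendstoI)
    show "((\<lambda>z. ?E z $ i $ j) \<longlongrightarrow> mat 1 $ i $ j) F" for i j
      using lims[of j] by (cases "i = k") (auto simp: elimination_matrix_def mat_def)
  qed
  have E: "\<forall>\<^sub>F z in F. elimination_matrix k (r z) ** ?E z = mat 1 \<and> ?E z ** elimination_matrix k (r z) = mat 1"
    using unit
  proof eventually_elim
    case (elim z)
    note u = alg_inverse_unit[OF elim, folded u_def]
    have u': "X z $ k $ k * u z = 1" "u z * X z $ k $ k = 1"
      using alg_inverse_unit[OF elim] by (simp_all add: u_def)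
    show ?case
      by (intro conjI elimination_matrix_mult) (auto simp: r_def s_def u' simp flip: mult.assoc)
  qed
  let ?Y = "\<lambda>z. X z ** ?E z"
  have limY: "(?Y \<longlongrightarrow> mat 1) F"
    using tendsto_matrix_mult[OF insert.prems(1) limE] by simp
  have "\<forall>\<^sub>F z in F. \<forall>i. i \<notin> S \<longrightarrow> ?Y z $ i = mat 1 $ i"
    using insert.prems(2) unit
  proof eventually_elim
    case (elim z)
    have u': "X z $ k $ k * u z = 1"
      using alg_inverse_unit[OF elim(2)] by (simp add: u_def)
    show ?case
    proof (intro allI impI)
      fix i assume i: "i \<notin> S"
      show "?Y z $ i = mat 1 $ i"
      proof (cases "i = k")
        case True
        then show ?thesis
          by (auto simp: vec_eq_iff mult_elimination_matrix s_def u' mat_def simp flip: mult.assoc)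
      next
        case False
        then have "X z $ i = mat 1 $ i" using elim(1) i by auto
        with False show ?thesis
          by (auto simp: vec_eq_iff mult_elimination_matrix mat_def)
      qed
    qed
  qed
  with insert.IH[OF limY] have Y: "\<forall>\<^sub>F z in F. invertible (?Y z)" "((\<lambda>z. matrix_inv (?Y z)) \<longlongrightarrow> mat 1) F"
    by simp_all
  have "\<forall>\<^sub>F z in F. invertible (X z) \<and> ?E z ** matrix_inv (?Y z) = matrix_inv (X z)"
    using E Y(1)
  proof eventually_elim
    case (elim z)
    note Yi = invertible_matrix_inv[OF elim(2)]
    have 1: "X z ** (?E z ** matrix_inv (?Y z)) = mat 1"
      using Yi(1) by (simp add: matrix_mul_assoc)
    have "X z = ?Y z ** elimination_matrix k (r z)"
      using elim(1) by (simp flip: matrix_mul_assoc)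
    then have "(?E z ** matrix_inv (?Y z)) ** X z = ?E z ** (matrix_inv (?Y z) ** ?Y z) ** elimination_matrix k (r z)"
      by (metis matrix_mul_assoc)
    also have "\<dots> = mat 1" using Yi(2) elim(1) by simp
    finally have 2: "(?E z ** matrix_inv (?Y z)) ** X z = mat 1" .
    show ?case using invertibleI[OF 1 2] matrix_inv_eqI[OF 1 2] by simp
  qed
  then have "\<forall>\<^sub>F z in F. invertible (X z)" "\<forall>\<^sub>F z in F. ?E z ** matrix_inv (?Y z) = matrix_inv (X z)"
    by (simp_all add: eventually_conj_iff)
  moreover have "((\<lambda>z. ?E z ** matrix_inv (?Y z)) \<longlongrightarrow> mat 1) F"
    using tendsto_matrix_mult[OF limE Y(2)] by simp
  ultimately show ?case
    by (blast intro: Lim_transform_eventually)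
qed

text \<open>Multiplication with the inverse of \<open>A\<close> moves a neighbourhood of \<open>A\<close> to one of the
  identity.\<close>

lemma eventually_invertible:
  fixes X :: "'c \<Rightarrow> 'a ^ 'n ^ 'n"
  assumes X: "(X \<longlongrightarrow> A) F" and A: "invertible A"
  shows "\<forall>\<^sub>F z in F. invertible (X z)" and tendsto_matrix_inv: "((\<lambda>z. matrix_inv (X z)) \<longlongrightarrow> matrix_inv A) F"
proof -
  note Ai = invertible_matrix_inv[OF A]
  let ?B = "matrix_inv A"
  have "((\<lambda>z. ?B ** X z) \<longlongrightarrow> mat 1) F"
    using tendsto_matrix_mult[OF tendsto_const X, of ?B] by (simp add: Ai)
  then have 1: "\<forall>\<^sub>F z in F. invertible (?B ** X z)" "((\<lambda>z. matrix_inv (?B ** X z)) \<longlongrightarrow> mat 1) F"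
    using eventually_invertible_near_one[of UNIV "\<lambda>z. ?B ** X z" F] by simp_all
  have *: "\<forall>\<^sub>F z in F. invertible (X z) \<and> matrix_inv (?B ** X z) ** ?B = matrix_inv (X z)"
    using 1(1)
  proof eventually_elim
    case (elim z)
    note i = invertible_matrix_inv[OF elim]
    have X: "X z = A ** (?B ** X z)" by (simp add: matrix_mul_assoc Ai)
    have "X z ** (matrix_inv (?B ** X z) ** ?B) = A ** ((?B ** X z) ** matrix_inv (?B ** X z)) ** ?B"
      by (subst X) (simp only: matrix_mul_assoc)
    then have 1: "X z ** (matrix_inv (?B ** X z) ** ?B) = mat 1" by (simp add: i Ai)
    have 2: "(matrix_inv (?B ** X z) ** ?B) ** X z = mat 1"
      using i(2) by (simp flip: matrix_mul_assoc)
    show ?case using invertibleI[OF 1 2] matrix_inv_eqI[OF 1 2] by simp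
  qed
  then show "\<forall>\<^sub>F z in F. invertible (X z)" by (simp add: eventually_conj_iff)
  have "((\<lambda>z. matrix_inv (?B ** X z) ** ?B) \<longlongrightarrow> ?B) F"
    using tendsto_matrix_mult[OF 1(2) tendsto_const, of ?B] by simp
  then show "((\<lambda>z. matrix_inv (X z)) \<longlongrightarrow> ?B) F"
    by (rule Lim_transform_eventually) (use * in \<open>simp add: eventually_conj_iff\<close>)
qed

lemma open_invertible: "open {A :: 'a ^ 'n ^ 'n. invertible A}"
proof (subst open_subopen, rule ballI)
  fix A :: "'a ^ 'n ^ 'n" assume "A \<in> {A. invertible A}"
  then have "\<forall>\<^sub>F X in nhds A. invertible X"
    by (intro eventually_invertible[OF filterlim_ident]) simp
  then show "\<exists>T. open T \<and> A \<in> T \<and> T \<subseteq> {A. invertible A}"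
    unfolding eventually_nhds by auto
qed

end

text \<open>Noncommutative polynomials in the inverse of \<open>x\<close> and in the directions.\<close>

inductive_set inverse_family :: "('a::real_algebra_1 ^ 'n ^ 'n \<Rightarrow> (nat \<Rightarrow> 'a ^ 'n ^ 'n) \<Rightarrow> 'a ^ 'n ^ 'n) set" where
  inv: "(\<lambda>x p. matrix_inv x) \<in> inverse_family"
| direction: "(\<lambda>x p. p n) \<in> inverse_family"
| zero: "(\<lambda>x p. 0) \<in> inverse_family"
| minus: "\<phi> \<in> inverse_family \<Longrightarrow> (\<lambda>x p. - \<phi> x p) \<in> inverse_family"
| add: "\<phi> \<in> inverse_family \<Longrightarrow> \<psi> \<in> inverse_family \<Longrightarrow> (\<lambda>x p. \<phi> x p + \<psi> x p) \<in> inverse_family"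
| mult: "\<phi> \<in> inverse_family \<Longrightarrow> \<psi> \<in> inverse_family \<Longrightarrow> (\<lambda>x p. \<phi> x p ** \<psi> x p) \<in> inverse_family"

context continuous_inverse_algebra
begin

text \<open>The resolvent identity \<open>y\<^sup>-\<^sup>1 - x\<^sup>-\<^sup>1 = y\<^sup>-\<^sup>1 (x - y) x\<^sup>-\<^sup>1\<close> gives the derivative \<open>- x\<^sup>-\<^sup>1
  h x\<^sup>-\<^sup>1\<close> of the inversion, and the product rule does the rest.\<close>

lemma smooth_family_inverse_family:
  "smooth_family UNIV {x. invertible x} UNIV (inverse_family :: ('a ^ 'n ^ 'n \<Rightarrow> _) set)"
  unfolding smooth_family_def
proof
  let ?U = "{x :: 'a ^ 'n ^ 'n. invertible x}"
  let ?X = "?U \<times> sequences_in UNIV"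
  have U: "openin (top_of_set UNIV) ?U" using open_invertible by simp
  note V = lcs_matrix[where 'n = 'n and 'm = 'n]
  fix \<phi> :: "'a ^ 'n ^ 'n \<Rightarrow> (nat \<Rightarrow> 'a ^ 'n ^ 'n) \<Rightarrow> 'a ^ 'n ^ 'n"
  assume "\<phi> \<in> inverse_family"
  then show "continuous_on ?X (\<lambda>(x, p). \<phi> x p) \<and>
        (\<forall>x\<in>?U. \<forall>p\<in>sequences_in UNIV. \<phi> x p \<in> UNIV) \<and>
        (\<forall>n. \<exists>\<phi>'\<in>inverse_family. derivative_along UNIV ?U n \<phi> \<phi>')"
    (is "?C \<phi> \<and> _ \<and> (\<forall>n. \<exists>\<phi>'\<in>inverse_family. ?D \<phi> n \<phi>')")
  proof induction
    case inv
    have "?C (\<lambda>x p. matrix_inv x)"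
      unfolding continuous_on_def case_prod_unfold
      by (intro ballI tendsto_matrix_inv tendsto_fst tendsto_ident_at) auto
    moreover have "\<exists>\<phi>'\<in>inverse_family. ?D (\<lambda>x p. matrix_inv x) n \<phi>'" for n
    proof (intro bexI ballI)
      show "(\<lambda>x p. - (matrix_inv x ** p n ** matrix_inv x)) \<in> inverse_family"
        by (intro inverse_family.intros)
      fix x p assume x: "x \<in> ?U" 
      let ?y = "\<lambda>t. x + t *\<^sub>R p n"
      have "(?y \<longlongrightarrow> x + 0 *\<^sub>R p n) (at 0)"
        by (intro tendsto_add_lcs[OF V tendsto_const tendsto_scaleR_lcs[OF V tendsto_const tendsto_ident_at]]) auto
      then have y: "(?y \<longlongrightarrow> x) (at 0)" by simp
      have "((\<lambda>t. 0 - matrix_inv (?y t) ** p n ** matrix_inv x) \<longlongrightarrow> 0 - matrix_inv x ** p n ** matrix_inv x) (at 0)"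
        using x by (intro tendsto_diff_lcs[OF V] tendsto_matrix_mult tendsto_const tendsto_matrix_inv y) auto
      moreover have "\<forall>\<^sub>F t in at 0. 0 - matrix_inv (?y t) ** p n ** matrix_inv x = diff_quot matrix_inv x (p n) t"
        using eventually_line_in[OF V U x UNIV_I, of "p n"] eventually_neq_at_within[of 0]
      proof eventually_elim
        case (elim t)
        have i: "matrix_inv (?y t) ** ?y t = mat 1" "x ** matrix_inv x = mat 1"
          using elim x by (simp_all add: invertible_matrix_inv)
        have "matrix_inv (?y t) - matrix_inv x
            = matrix_inv (?y t) ** (x ** matrix_inv x) - (matrix_inv (?y t) ** ?y t) ** matrix_inv x"
          by (simp add: i)
        also have "\<dots> = - (t *\<^sub>R (matrix_inv (?y t) ** p n ** matrix_inv x))"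
          by (simp add: matrix_mult_add matrix_mult_scaleR matrix_mul_assoc)
        finally show ?case using elim(2) by (simp add: diff_quot_def)
      qed
      ultimately have "(diff_quot matrix_inv x (p n) \<longlongrightarrow> 0 - matrix_inv x ** p n ** matrix_inv x) (at 0)"
        by (rule Lim_transform_eventually)
      then show "(diff_quot matrix_inv x (p n) \<longlongrightarrow> - (matrix_inv x ** p n ** matrix_inv x)) (at 0)"
        by simp
    qed
    ultimately show ?case by simp
  next
    case (direction m)
    have "?C (\<lambda>x p. p m)"
      using continuous_on_product_then_coordinatewise[OF continuous_on_snd[OF continuous_on_id], of ?X m]
      by (simp add: case_prod_unfold)
    moreover have "\<exists>\<phi>'\<in>inverse_family. ?D (\<lambda>x p. p m) n \<phi>'" for n
      by (intro bexI[OF _ inverse_family.zero]) (simp add: diff_quot_def[abs_def])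
    ultimately show ?case by simp
  next
    case zero
    have "\<exists>\<phi>'\<in>inverse_family. ?D (\<lambda>x p. 0) n \<phi>'" for n
      by (intro bexI[OF _ inverse_family.zero]) (simp add: diff_quot_def[abs_def])
    then show ?case by (simp add: case_prod_unfold)
  next
    case (minus \<phi>)
    note neg = tendsto_minus_lcs[OF V _ _ UNIV_I, OF _ always_eventually]
    have "?C (\<lambda>x p. - \<phi> x p)"
      using conjunct1[OF minus.IH] unfolding continuous_on_def case_prod_unfold
      by (intro ballI neg) (rule bspec, simp_all)
    moreover have "\<exists>\<phi>'\<in>inverse_family. ?D (\<lambda>x p. - \<phi> x p) n \<phi>'" for n
    proof -
      obtain \<phi>' where \<phi>': "\<phi>' \<in> inverse_family" "?D \<phi> n \<phi>'" using minus.IH by blast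
      have "diff_quot (\<lambda>y. - \<phi> y p) x h = (\<lambda>t. - diff_quot (\<lambda>y. \<phi> y p) x h t)" for p x h
        by (simp add: fun_eq_iff diff_quot_def scaleR_diff_right)
      then show ?thesis
        using \<phi>'(2) by (intro bexI[OF _ inverse_family.minus[OF \<phi>'(1)]]) (simp add: neg)
    qed
    ultimately show ?case by simp
  next
    case (add \<phi> \<psi>)
    have "?C (\<lambda>x p. \<phi> x p + \<psi> x p)"
      using continuous_on_add_lcs[OF V conjunct1[OF add.IH(1)] conjunct1[OF add.IH(2)]]
      by (simp add: case_prod_unfold)
    moreover have "\<exists>\<phi>'\<in>inverse_family. ?D (\<lambda>x p. \<phi> x p + \<psi> x p) n \<phi>'" for n
    proof -
      obtain \<phi>' where \<phi>': "\<phi>' \<in> inverse_family" "?D \<phi> n \<phi>'" using add.IH(1) by blast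
      obtain \<psi>' where \<psi>': "\<psi>' \<in> inverse_family" "?D \<psi> n \<psi>'" using add.IH(2) by blast
      have "?D (\<lambda>x p. \<phi> x p + \<psi> x p) n (\<lambda>x p. \<phi>' x p + \<psi>' x p)"
        using \<phi>'(2) \<psi>'(2) by (intro ballI tendsto_diff_quot_add_lcs[OF V V U]) simp_all
      then show ?thesis
        using inverse_family.add[OF \<phi>'(1) \<psi>'(1)] by (rule bexI)
    qed
    ultimately show ?case by simp
  next
    case (mult \<phi> \<psi>)
    have "?C (\<lambda>x p. \<phi> x p ** \<psi> x p)"
      using conjunct1[OF mult.IH(1)] conjunct1[OF mult.IH(2)]
      unfolding continuous_on_def case_prod_unfold by (intro ballI tendsto_matrix_mult) (drule (1) bspec, assumption)+
    moreover have "\<exists>\<phi>'\<in>inverse_family. ?D (\<lambda>x p. \<phi> x p ** \<psi> x p) n \<phi>'" for n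
    proof -
      obtain \<phi>' where \<phi>': "\<phi>' \<in> inverse_family" "?D \<phi> n \<phi>'" using mult.IH(1) by blast
      obtain \<psi>' where \<psi>': "\<psi>' \<in> inverse_family" "?D \<psi> n \<psi>'" using mult.IH(2) by blast
      have "?D (\<lambda>x p. \<phi> x p ** \<psi> x p) n (\<lambda>x p. \<phi> x p ** \<psi>' x p + \<phi>' x p ** \<psi> x p)"
      proof (intro ballI)
        fix x p assume x: "x \<in> ?U" and p: "p \<in> sequences_in (UNIV :: ('a ^ 'n ^ 'n) set)"
        have d\<phi>: "(diff_quot (\<lambda>y. \<phi> y p) x (p n) \<longlongrightarrow> \<phi>' x p) (at 0)"
          and d\<psi>: "(diff_quot (\<lambda>y. \<psi> y p) x (p n) \<longlongrightarrow> \<psi>' x p) (at 0)"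
          using \<phi>'(2) \<psi>'(2) x p by blast+
        have "((\<lambda>t. \<phi> (x + t *\<^sub>R p n) p) \<longlongrightarrow> \<phi> x p) (at 0)"
          by (rule tendsto_from_quotient[OF V]) (use d\<phi> in \<open>simp_all add: diff_quot_def[abs_def]\<close>)
        then have "((\<lambda>t. \<phi> (x + t *\<^sub>R p n) p ** diff_quot (\<lambda>y. \<psi> y p) x (p n) t
            + diff_quot (\<lambda>y. \<phi> y p) x (p n) t ** \<psi> x p) \<longlongrightarrow> \<phi> x p ** \<psi>' x p + \<phi>' x p ** \<psi> x p) (at 0)"
          by (intro tendsto_add_lcs[OF V] tendsto_matrix_mult d\<phi> d\<psi> tendsto_const) simp_all
        moreover have "(\<lambda>t. \<phi> (x + t *\<^sub>R p n) p ** diff_quot (\<lambda>y. \<psi> y p) x (p n) t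
            + diff_quot (\<lambda>y. \<phi> y p) x (p n) t ** \<psi> x p) = diff_quot (\<lambda>y. \<phi> y p ** \<psi> y p) x (p n)"
          by (simp add: fun_eq_iff diff_quot_def matrix_mult_add matrix_mult_scaleR flip: scaleR_add_right)
        ultimately show "(diff_quot (\<lambda>y. \<phi> y p ** \<psi> y p) x (p n) \<longlongrightarrow> \<phi> x p ** \<psi>' x p + \<phi>' x p ** \<psi> x p) (at 0)"
          by simp
      qed
      moreover have "(\<lambda>x p. \<phi> x p ** \<psi>' x p + \<phi>' x p ** \<psi> x p) \<in> inverse_family"
        by (intro inverse_family.add inverse_family.mult mult.hyps \<phi>'(1) \<psi>'(1))
      ultimately show ?thesis by (rule bexI)
    qed
    ultimately show ?case by simp
  qed
qed

theorem smooth_on_matrix_inv: "smooth_on UNIV {x. invertible x} UNIV (matrix_inv :: 'a ^ 'n ^ 'n \<Rightarrow> _)"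
  by (rule smooth_on_familyI[OF lcs_matrix _ smooth_family_inverse_family inverse_family.inv])
    (use open_invertible in simp_all)

theorem smooth_on_matrix_mult: "smooth_on UNIV UNIV UNIV (\<lambda>(A :: 'a ^ 'n ^ 'n, B :: 'a ^ 'n ^ 'n). A ** B)"
  using locally_convex_space_Times[OF lcs_matrix lcs_matrix]
  by (intro smooth_on_bilinear lcs_matrix continuous_matrix_mult) (simp_all add: matrix_mult_add matrix_mult_scaleR)

end

section \<open>Manifolds\<close>

lemma Hausdorff_space_t2: "Hausdorff_space (euclidean :: 'v::t2_space topology)"
  unfolding Hausdorff_space_def disjnt_def using hausdorff by auto

lemma smooth_manifoldD:
  assumes "smooth_manifold M"
  shows model_lcs: "locally_convex_space (model M)"
    and manifold_Hausdorff: "Hausdorff_space (mtop M)"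
    and topspace_eq_charts: "topspace (mtop M) = (\<Union>(U, \<phi>)\<in>atlas M. U)"
    and chart_openin: "(U, \<phi>) \<in> atlas M \<Longrightarrow> openin (mtop M) U"
    and chart_image_openin: "(U, \<phi>) \<in> atlas M \<Longrightarrow> openin (top_of_set (model M)) (\<phi> ` U)"
    and chart_homeomorphic: "(U, \<phi>) \<in> atlas M \<Longrightarrow>
      homeomorphic_map (subtopology (mtop M) U) (top_of_set (\<phi> ` U)) \<phi>"
    and chart_transition: "(U, \<phi>) \<in> atlas M \<Longrightarrow> (U', \<phi>') \<in> atlas M \<Longrightarrow>
      smooth_on (model M) (\<phi> ` (U \<inter> U')) (model M) (\<phi>' \<circ> inv_into U \<phi>)"
  using assms unfolding smooth_manifold_def by fast+

lemma chart_subset: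
  assumes "smooth_manifold M" "(U, \<phi>) \<in> atlas M"
  shows "U \<subseteq> topspace (mtop M)"
  by (rule openin_subset[OF chart_openin[OF assms]])

lemma obtain_chart:
  assumes "smooth_manifold M" "x \<in> topspace (mtop M)"
  obtains U \<phi> where "(U, \<phi>) \<in> atlas M" "x \<in> U"
  using assms(2) unfolding topspace_eq_charts[OF assms(1)] by blast

lemma chart_inj:
  assumes "smooth_manifold M" "(U, \<phi>) \<in> atlas M"
  shows "inj_on \<phi> U"
  using homeomorphic_imp_injective_map[OF chart_homeomorphic[OF assms]] chart_subset[OF assms]
  by (simp add: Int_absorb1)

lemma chart_image_subset:
  assumes "smooth_manifold M" "(U, \<phi>) \<in> atlas M"
  shows "\<phi> ` U \<subseteq> model M"
  using openin_imp_subset[OF chart_image_openin[OF assms]] .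

lemma chart_image_open:
  assumes M: "smooth_manifold M" "(U, \<phi>) \<in> atlas M" and X: "openin (mtop M) X"
  shows "openin (top_of_set (model M)) (\<phi> ` (U \<inter> X))"
proof -
  have "openin (subtopology (mtop M) U) (U \<inter> X)"
    using X by (simp add: openin_subtopology_Int2)
  then have "openin (top_of_set (\<phi> ` U)) (\<phi> ` (U \<inter> X))"
    using homeomorphic_imp_open_map[OF chart_homeomorphic[OF M]] unfolding open_map_def by blast
  then show ?thesis by (rule openin_trans[OF _ chart_image_openin[OF M]])
qed

lemma chart_continuous:
  assumes "smooth_manifold M" "(U, \<phi>) \<in> atlas M"
  shows "continuous_map (subtopology (mtop M) U) (top_of_set (model M)) \<phi>"
  using homeomorphic_imp_continuous_map[OF chart_homeomorphic[OF assms]] chart_image_subset[OF assms]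
  by (auto simp: continuous_map_in_subtopology)

lemma chart_inv_continuous:
  assumes M: "smooth_manifold M" "(U, \<phi>) \<in> atlas M"
  shows "continuous_map (top_of_set (\<phi> ` U)) (mtop M) (inv_into U \<phi>)"
proof -
  have ts: "topspace (subtopology (mtop M) U) = U" using chart_subset[OF M] by (simp add: Int_absorb1)
  obtain g where g: "homeomorphic_maps (subtopology (mtop M) U) (top_of_set (\<phi> ` U)) \<phi> g"
    using chart_homeomorphic[OF M] unfolding homeomorphic_map_maps by blast
  then have "continuous_map (top_of_set (\<phi> ` U)) (subtopology (mtop M) U) g"
    unfolding homeomorphic_maps_def by blast
  then have "continuous_map (top_of_set (\<phi> ` U)) (mtop M) g"
    by (simp add: continuous_map_in_subtopology)
  then show ?thesis
  proof (rule continuous_map_eq)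
    fix y assume "y \<in> topspace (top_of_set (\<phi> ` U))"
    then obtain x where x: "x \<in> U" "y = \<phi> x" by auto
    have "g (\<phi> x) = x" using g x ts unfolding homeomorphic_maps_def by blast
    then show "g y = inv_into U \<phi> y"
      using x chart_inj[OF M] by simp
  qed
qed

lemma smooth_mapD:
  assumes "smooth_map M N f"
  shows smooth_map_continuous: "continuous_map (mtop M) (mtop N) f"
    and smooth_map_charts: "(U, \<phi>) \<in> atlas M \<Longrightarrow> (W, \<psi>) \<in> atlas N \<Longrightarrow>
      smooth_on (model M) (\<phi> ` (U \<inter> f -` W)) (model N) (\<psi> \<circ> f \<circ> inv_into U \<phi>)"
  using assms unfolding smooth_map_def by fast+

lemma smooth_mapI:
  assumes "continuous_map (mtop M) (mtop N) f"
    and "\<And>U \<phi> W \<psi>. (U, \<phi>) \<in> atlas M \<Longrightarrow> (W, \<psi>) \<in> atlas N \<Longrightarrow>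
      smooth_on (model M) (\<phi> ` (U \<inter> f -` W)) (model N) (\<psi> \<circ> f \<circ> inv_into U \<phi>)"
  shows "smooth_map M N f"
  unfolding smooth_map_def using assms by (intro conjI ballI) auto

lemma smooth_map_in: "smooth_map M N f \<Longrightarrow> x \<in> topspace (mtop M) \<Longrightarrow> f x \<in> topspace (mtop N)"
  using continuous_map_image_subset_topspace[OF smooth_map_continuous] by blast

lemma openin_chart_preimage:
  assumes M: "smooth_manifold M" "(U, \<phi>) \<in> atlas M" and f: "continuous_map (mtop M) (mtop N) f"
    and W: "openin (mtop N) W"
  shows "openin (top_of_set (model M)) (\<phi> ` (U \<inter> f -` W))"
proof -
  have "openin (mtop M) {x \<in> topspace (mtop M). f x \<in> W}"
    using f W by (rule openin_continuous_map_preimage)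
  moreover have "U \<inter> f -` W = U \<inter> {x \<in> topspace (mtop M). f x \<in> W}"
    using chart_subset[OF M] by blast
  ultimately show ?thesis using chart_image_open[OF M] by simp
qed

text \<open>Through a chart of \<open>N\<close> around \<open>f x\<close>, the representation of \<open>g \<circ> f\<close> in charts is locally
  the composition of the representations of \<open>f\<close> and \<open>g\<close>.\<close>

theorem smooth_map_compose:
  assumes M: "smooth_manifold M" and N: "smooth_manifold N" and P: "smooth_manifold P"
    and f: "smooth_map M N f" and g: "smooth_map N P g"
  shows "smooth_map M P (\<lambda>x. g (f x))"
proof (rule smooth_mapI)
  note cf = smooth_map_continuous[OF f] and cg = smooth_map_continuous[OF g]
  show cgf: "continuous_map (mtop M) (mtop P) (\<lambda>x. g (f x))"
    using continuous_map_compose[OF cf cg] by (simp add: o_def)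
  fix U \<phi> W \<psi> assume U: "(U, \<phi>) \<in> atlas M" and W: "(W, \<psi>) \<in> atlas P"
  note MU = M U and PW = P W
  have inj: "inv_into U \<phi> (\<phi> x) = x" if "x \<in> U" for x
    by (rule inv_into_f_f[OF chart_inj[OF MU] that])
  show "smooth_on (model M) (\<phi> ` (U \<inter> (\<lambda>x. g (f x)) -` W)) (model P) (\<psi> \<circ> (\<lambda>x. g (f x)) \<circ> inv_into U \<phi>)"
  proof (rule smooth_on_local[OF model_lcs[OF M]])
    show "openin (top_of_set (model M)) (\<phi> ` (U \<inter> (\<lambda>x. g (f x)) -` W))"
      by (rule openin_chart_preimage[OF MU cgf chart_openin[OF PW]])
    fix y assume "y \<in> \<phi> ` (U \<inter> (\<lambda>x. g (f x)) -` W)"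
    then obtain x where x: "x \<in> U" "g (f x) \<in> W" "y = \<phi> x" by auto
    have "f x \<in> topspace (mtop N)"
      using x chart_subset[OF MU] smooth_map_in[OF f] by blast
    then obtain Y \<eta> where Y: "(Y, \<eta>) \<in> atlas N" "f x \<in> Y" by (rule obtain_chart[OF N])
    note NY = N Y(1)
    have injN: "inv_into Y \<eta> (\<eta> z) = z" if "z \<in> Y" for z
      by (rule inv_into_f_f[OF chart_inj[OF NY] that])
    define D where "D = {z \<in> topspace (mtop N). z \<in> Y \<and> g z \<in> W}"
    have "openin (mtop N) {z \<in> topspace (mtop N). g z \<in> W}"
      by (rule openin_continuous_map_preimage[OF cg chart_openin[OF PW]])
    then have "openin (mtop N) (Y \<inter> {z \<in> topspace (mtop N). g z \<in> W})"
      by (rule openin_Int[OF chart_openin[OF NY]])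
    also have "Y \<inter> {z \<in> topspace (mtop N). g z \<in> W} = D"
      unfolding D_def by blast
    finally have D: "openin (mtop N) D" .
    let ?U' = "\<phi> ` (U \<inter> f -` D)"
    have U'open: "openin (top_of_set (model M)) ?U'"
      by (rule openin_chart_preimage[OF MU cf D])
    have sf: "smooth_on (model M) ?U' (model N) (\<eta> \<circ> f \<circ> inv_into U \<phi>)"
      by (rule smooth_on_subset[OF model_lcs[OF M] smooth_map_charts[OF f U Y(1)] U'open])
        (auto simp: D_def)
    have "smooth_on (model M) ?U' (model P) (\<lambda>v. (\<psi> \<circ> g \<circ> inv_into Y \<eta>) ((\<eta> \<circ> f \<circ> inv_into U \<phi>) v))"
    proof (rule smooth_on_compose[OF model_lcs[OF M] model_lcs[OF N] model_lcs[OF P] sf smooth_map_charts[OF g Y(1) W]])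
      show "(\<eta> \<circ> f \<circ> inv_into U \<phi>) ` ?U' \<subseteq> \<eta> ` (Y \<inter> g -` W)"
        by (auto simp: inj D_def)
    qed
    then have "smooth_on (model M) ?U' (model P) (\<psi> \<circ> (\<lambda>x. g (f x)) \<circ> inv_into U \<phi>)"
      by (rule smooth_on_cong[OF model_lcs[OF M] _ U'open]) (auto simp: inj injN D_def)
    moreover have "y \<in> ?U'"
      using x Y \<open>f x \<in> topspace (mtop N)\<close> by (auto simp: D_def)
    ultimately show "\<exists>U'. y \<in> U' \<and> smooth_on (model M) U' (model P) (\<psi> \<circ> (\<lambda>x. g (f x)) \<circ> inv_into U \<phi>)"
      by (intro exI conjI)
  qed
qed

lemma smooth_map_cong:
  assumes M: "smooth_manifold M" and f: "smooth_map M N f" and "\<And>x. x \<in> topspace (mtop M) \<Longrightarrow> f x = g x"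
  shows "smooth_map M N g"
proof (rule smooth_mapI)
  show "continuous_map (mtop M) (mtop N) g"
    using continuous_map_eq[OF smooth_map_continuous[OF f]] assms(3) by blast
  fix U \<phi> W \<psi> assume U: "(U, \<phi>) \<in> atlas M" and W: "(W, \<psi>) \<in> atlas N"
  have eq: "f x = g x" if "x \<in> U" for x using chart_subset[OF M U] assms(3) that by blast
  then have s: "U \<inter> g -` W = U \<inter> f -` W" by auto
  note sf = smooth_map_charts[OF f U W]
  show "smooth_on (model M) (\<phi> ` (U \<inter> g -` W)) (model N) (\<psi> \<circ> g \<circ> inv_into U \<phi>)"
    unfolding s
    by (rule smooth_on_cong[OF model_lcs[OF M] sf smooth_on_openin[OF sf lcs_subspace[OF model_lcs[OF M]]]])
      (auto simp: eq inv_into_f_f[OF chart_inj[OF M U]])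
qed

subsection \<open>Open submanifolds\<close>

lemma open_submanifold_simps [simp]:
  "mtop (open_submanifold M X) = subtopology (mtop M) X"
  "model (open_submanifold M X) = model M"
  by (simp_all add: open_submanifold_def)

lemma atlas_open_submanifold: "atlas (open_submanifold M X) = {(U \<inter> X, \<phi>) | U \<phi>. (U, \<phi>) \<in> atlas M}"
  by (simp add: open_submanifold_def)

lemma inv_into_chart_Int:
  assumes "smooth_manifold M" "(U, \<phi>) \<in> atlas M" "y \<in> \<phi> ` (U \<inter> X)"
  shows "inv_into (U \<inter> X) \<phi> y = inv_into U \<phi> y"
  using assms(3) chart_inj[OF assms(1,2)] inj_on_subset[OF chart_inj[OF assms(1,2)], of "U \<inter> X"]
  by auto

lemma smooth_manifold_open_submanifold:
  assumes M: "smooth_manifold M" and X: "openin (mtop M) X"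
  shows "smooth_manifold (open_submanifold M X)"
  unfolding smooth_manifold_def open_submanifold_simps
proof (intro conjI)
  note lcs = model_lcs[OF M]
  have at: "\<exists>U. (U, \<phi>) \<in> atlas M \<and> U' = U \<inter> X" if "(U', \<phi>) \<in> atlas (open_submanifold M X)" for U' \<phi>
    using that by (auto simp: atlas_open_submanifold)
  show "locally_convex_space (model M)" by (rule lcs)
  show "Hausdorff_space (subtopology (mtop M) X)"
    by (rule Hausdorff_space_subtopology[OF manifold_Hausdorff[OF M]])
  show "topspace (subtopology (mtop M) X) = (\<Union>(U, \<phi>)\<in>atlas (open_submanifold M X). U)"
    unfolding topspace_subtopology topspace_eq_charts[OF M] atlas_open_submanifold by blast
  show "\<forall>(U, \<phi>)\<in>atlas (open_submanifold M X). openin (subtopology (mtop M) X) U \<and>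
      openin (top_of_set (model M)) (\<phi> ` U) \<and>
      homeomorphic_map (subtopology (subtopology (mtop M) X) U) (top_of_set (\<phi> ` U)) \<phi>"
  proof (rule ballI, rule case_prodI2)
    fix c U' \<phi> assume "c \<in> atlas (open_submanifold M X)" "c = (U', \<phi>)"
    then obtain U where U: "(U, \<phi>) \<in> atlas M" and U': "U' = U \<inter> X" using at by blast
    have "openin (subtopology (mtop M) X) U'"
      unfolding U' by (rule openin_subtopology_Int[OF chart_openin[OF M U]])
    moreover have "openin (top_of_set (model M)) (\<phi> ` U')"
      unfolding U' by (rule chart_image_open[OF M U X])
    moreover have "homeomorphic_map (subtopology (subtopology (mtop M) X) U') (top_of_set (\<phi> ` U')) \<phi>"
    proof -
      have "topspace (subtopology (mtop M) U) \<inter> U' = U'" using chart_subset[OF M U] U' by auto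
      moreover have "\<phi> ` U \<inter> \<phi> ` U' = \<phi> ` U'" using U' by auto
      ultimately have "homeomorphic_map (subtopology (subtopology (mtop M) U) U')
          (subtopology (top_of_set (\<phi> ` U)) (\<phi> ` U')) \<phi>"
        using chart_subset[OF M U] U'
        by (intro homeomorphic_map_subtopologies[OF chart_homeomorphic[OF M U]]) auto
      moreover have "U \<inter> U' = U'" "X \<inter> U' = U'" "\<phi> ` U \<inter> \<phi> ` U' = \<phi> ` U'" using U' by auto
      ultimately show ?thesis by (simp add: subtopology_subtopology)
    qed
    ultimately show "openin (subtopology (mtop M) X) U' \<and> openin (top_of_set (model M)) (\<phi> ` U') \<and>
      homeomorphic_map (subtopology (subtopology (mtop M) X) U') (top_of_set (\<phi> ` U')) \<phi>"
      by (intro conjI)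
  qed
  show "\<forall>(U, \<phi>)\<in>atlas (open_submanifold M X). \<forall>(U', \<phi>')\<in>atlas (open_submanifold M X).
        smooth_on (model M) (\<phi> ` (U \<inter> U')) (model M) (\<phi>' \<circ> inv_into U \<phi>)"
  proof (rule ballI, rule case_prodI2, rule ballI, rule case_prodI2)
    fix c c' U1 \<phi> U1' \<phi>' assume "c \<in> atlas (open_submanifold M X)" "c = (U1, \<phi>)"
      "c' \<in> atlas (open_submanifold M X)" "c' = (U1', \<phi>')"
    then obtain U U' where U: "(U, \<phi>) \<in> atlas M" "U1 = U \<inter> X" and U': "(U', \<phi>') \<in> atlas M" "U1' = U' \<inter> X"
      using at by blast
    have s: "U1 \<inter> U1' = U \<inter> (U' \<inter> X)" using U(2) U'(2) by auto
    have op: "openin (top_of_set (model M)) (\<phi> ` (U1 \<inter> U1'))"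
      unfolding s by (intro chart_image_open[OF M U(1)] openin_Int chart_openin[OF M U'(1)] X)
    show "smooth_on (model M) (\<phi> ` (U1 \<inter> U1')) (model M) (\<phi>' \<circ> inv_into U1 \<phi>)"
    proof (rule smooth_on_mono_cong[OF lcs chart_transition[OF M U(1) U'(1)] op _ order_refl])
      show "\<phi> ` (U1 \<inter> U1') \<subseteq> \<phi> ` (U \<inter> U')" using s by auto
      fix y assume "y \<in> \<phi> ` (U1 \<inter> U1')"
      then have "y \<in> \<phi> ` (U \<inter> X)" using U(2) by blast
      from inv_into_chart_Int[OF M U(1) this]
      show "(\<phi>' \<circ> inv_into U1 \<phi>) y = (\<phi>' \<circ> inv_into U \<phi>) y" unfolding U(2) by simp
    qed
  qed
qed

lemma smooth_map_restrict:
  assumes M: "smooth_manifold M" and N: "smooth_manifold N" and X: "openin (mtop M) X" and f: "smooth_map M N f"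
  shows "smooth_map (open_submanifold M X) N f"
proof (rule smooth_mapI)
  note cf = smooth_map_continuous[OF f]
  show "continuous_map (mtop (open_submanifold M X)) (mtop N) f"
    using cf by (simp add: continuous_map_from_subtopology)
  fix U1 \<phi> W \<psi> assume "(U1, \<phi>) \<in> atlas (open_submanifold M X)" and W: "(W, \<psi>) \<in> atlas N"
  then obtain U where U: "(U, \<phi>) \<in> atlas M" "U1 = U \<inter> X" by (auto simp: atlas_open_submanifold)
  have "openin (mtop M) {x \<in> topspace (mtop M). f x \<in> W}"
    by (rule openin_continuous_map_preimage[OF cf chart_openin[OF N W]])
  then have "openin (top_of_set (model M)) (\<phi> ` (U \<inter> ({x \<in> topspace (mtop M). f x \<in> W} \<inter> X)))"
    by (intro chart_image_open[OF M U(1)] openin_Int X)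
  moreover have "U1 \<inter> f -` W = U \<inter> ({x \<in> topspace (mtop M). f x \<in> W} \<inter> X)"
    using chart_subset[OF M U(1)] U(2) by auto
  ultimately have op: "openin (top_of_set (model M)) (\<phi> ` (U1 \<inter> f -` W))" by simp
  show "smooth_on (model (open_submanifold M X)) (\<phi> ` (U1 \<inter> f -` W)) (model N) (\<psi> \<circ> f \<circ> inv_into U1 \<phi>)"
    unfolding open_submanifold_simps
  proof (rule smooth_on_mono_cong[OF model_lcs[OF M] smooth_map_charts[OF f U(1) W] op _ order_refl])
    show "\<phi> ` (U1 \<inter> f -` W) \<subseteq> \<phi> ` (U \<inter> f -` W)" using U(2) by auto
    fix y assume "y \<in> \<phi> ` (U1 \<inter> f -` W)"
    then have "y \<in> \<phi> ` (U \<inter> X)" using U(2) by blast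
    from inv_into_chart_Int[OF M U(1) this]
    show "(\<psi> \<circ> f \<circ> inv_into U1 \<phi>) y = (\<psi> \<circ> f \<circ> inv_into U \<phi>) y" unfolding U(2) by simp
  qed
qed

lemma smooth_map_local:
  assumes M: "smooth_manifold M" and N: "smooth_manifold N"
    and loc: "\<And>x. x \<in> topspace (mtop M) \<Longrightarrow>
      \<exists>X. openin (mtop M) X \<and> x \<in> X \<and> smooth_map (open_submanifold M X) N f"
  shows "smooth_map M N f"
proof (rule smooth_mapI)
  show cf: "continuous_map (mtop M) (mtop N) f"
  proof (rule pasting_lemma[of "{X. openin (mtop M) X \<and> smooth_map (open_submanifold M X) N f}" _ "\<lambda>X. X" _ "\<lambda>_. f"])
    show "continuous_map (subtopology (mtop M) X) (mtop N) f"
      if "X \<in> {X. openin (mtop M) X \<and> smooth_map (open_submanifold M X) N f}" for X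
      using that smooth_map_continuous[of "open_submanifold M X" N f] by simp
  qed (use loc in auto)
  fix U \<phi> W \<psi> assume U: "(U, \<phi>) \<in> atlas M" and W: "(W, \<psi>) \<in> atlas N"
  show "smooth_on (model M) (\<phi> ` (U \<inter> f -` W)) (model N) (\<psi> \<circ> f \<circ> inv_into U \<phi>)"
  proof (rule smooth_on_local[OF model_lcs[OF M]])
    show "openin (top_of_set (model M)) (\<phi> ` (U \<inter> f -` W))"
      by (rule openin_chart_preimage[OF M U cf chart_openin[OF N W]])
    fix y assume "y \<in> \<phi> ` (U \<inter> f -` W)"
    then obtain x where x: "x \<in> U" "f x \<in> W" "y = \<phi> x" by auto
    obtain X where X: "openin (mtop M) X" "x \<in> X" "smooth_map (open_submanifold M X) N f"
      using loc[of x] chart_subset[OF M U] x(1) by blast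
    have UX: "(U \<inter> X, \<phi>) \<in> atlas (open_submanifold M X)"
      using U by (auto simp: atlas_open_submanifold)
    note sX = smooth_map_charts[OF X(3) UX W, unfolded open_submanifold_simps]
    have "smooth_on (model M) (\<phi> ` (U \<inter> X \<inter> f -` W)) (model N) (\<psi> \<circ> f \<circ> inv_into U \<phi>)"
    proof (rule smooth_on_cong[OF model_lcs[OF M] sX smooth_on_openin[OF sX lcs_subspace[OF model_lcs[OF M]]]])
      fix v assume "v \<in> \<phi> ` (U \<inter> X \<inter> f -` W)"
      then have "v \<in> \<phi> ` (U \<inter> X)" by blast
      from inv_into_chart_Int[OF M U this]
      show "(\<psi> \<circ> f \<circ> inv_into U \<phi>) v = (\<psi> \<circ> f \<circ> inv_into (U \<inter> X) \<phi>) v" by simp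
    qed
    moreover have "y \<in> \<phi> ` (U \<inter> X \<inter> f -` W)" using x X by auto
    ultimately show "\<exists>U'. y \<in> U' \<and> smooth_on (model M) U' (model N) (\<psi> \<circ> f \<circ> inv_into U \<phi>)"
      by (intro exI conjI)
  qed
qed

lemma smooth_map_into_open_submanifold:
  assumes M: "smooth_manifold M" and N: "smooth_manifold N"
  shows "smooth_map M (open_submanifold N Y) f \<longleftrightarrow>
     smooth_map M N f \<and> f \<in> topspace (mtop M) \<rightarrow> Y" (is "?L \<longleftrightarrow> ?R")
proof -
  have ct: "continuous_map (mtop M) (subtopology (mtop N) Y) f \<longleftrightarrow>
      continuous_map (mtop M) (mtop N) f \<and> f \<in> topspace (mtop M) \<rightarrow> Y"
    by (simp add: continuous_map_in_subtopology)
  have s: "U \<inter> f -` (W \<inter> Y) = U \<inter> f -` W" if "f \<in> topspace (mtop M) \<rightarrow> Y" "(U, \<phi>) \<in> atlas M" for U \<phi> W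
    using that chart_subset[OF M that(2)] by blast
  show ?thesis
  proof
    assume L: ?L
    then have c: "continuous_map (mtop M) (mtop N) f" "f \<in> topspace (mtop M) \<rightarrow> Y"
      using smooth_map_continuous[OF L] ct by simp_all
    have "smooth_map M N f"
    proof (rule smooth_mapI[OF c(1)])
      fix U \<phi> W \<psi> assume U: "(U, \<phi>) \<in> atlas M" and W: "(W, \<psi>) \<in> atlas N"
      then have "(W \<inter> Y, \<psi>) \<in> atlas (open_submanifold N Y)" by (auto simp: atlas_open_submanifold)
      from smooth_map_charts[OF L U this]
      show "smooth_on (model M) (\<phi> ` (U \<inter> f -` W)) (model N) (\<psi> \<circ> f \<circ> inv_into U \<phi>)"
        unfolding s[OF c(2) U] open_submanifold_simps .
    qed
    with c show ?R by simp
  next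
    assume R: ?R
    show ?L
    proof (rule smooth_mapI)
      show "continuous_map (mtop M) (mtop (open_submanifold N Y)) f"
        using R smooth_map_continuous[of M N f] ct by simp
      fix U \<phi> W1 \<psi> assume U: "(U, \<phi>) \<in> atlas M" and "(W1, \<psi>) \<in> atlas (open_submanifold N Y)"
      then obtain W where W: "(W, \<psi>) \<in> atlas N" "W1 = W \<inter> Y" by (auto simp: atlas_open_submanifold)
      show "smooth_on (model M) (\<phi> ` (U \<inter> f -` W1)) (model (open_submanifold N Y)) (\<psi> \<circ> f \<circ> inv_into U \<phi>)"
        unfolding W(2) s[OF conjunct2[OF R] U] open_submanifold_simps
        by (rule smooth_map_charts[OF conjunct1[OF R] U W(1)])
    qed
  qed
qed

subsection \<open>Vector spaces\<close>

lemma vector_manifold_simps [simp]: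
  "mtop (vector_manifold V) = top_of_set V" "atlas (vector_manifold V) = {(V, id)}" "model (vector_manifold V) = V"
  by (simp_all add: vector_manifold_def)

lemma smooth_on_id: "locally_convex_space V \<Longrightarrow> openin (top_of_set V) U \<Longrightarrow> smooth_on V U V (\<lambda>x. x)"
  by (rule smooth_on_subset[OF _ smooth_on_linear]) (auto simp: openin_imp_subset)

lemma smooth_manifold_vector_manifold:
  assumes V: "locally_convex_space V"
  shows "smooth_manifold (vector_manifold V)"
proof -
  have "smooth_on V V V (id \<circ> inv_into V id)"
    by (rule smooth_on_cong[OF V smooth_on_id[OF V openin_subtopology_self]])
      (auto simp: inv_into_f_f[of id V, simplified])
  moreover have "Hausdorff_space (top_of_set V)"
    by (intro Hausdorff_space_subtopology Hausdorff_space_t2)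
  ultimately show ?thesis
    unfolding smooth_manifold_def using V by (simp add: subtopology_subtopology)
qed

text \<open>This translates between the calculus on open sets and the smooth maps of manifolds, so
  that all later smoothness proofs can be composed from maps of manifolds.\<close>

lemma smooth_on_iff_smooth_map:
  assumes V: "locally_convex_space V" and U: "openin (top_of_set V) U" and W: "locally_convex_space W"
  shows "smooth_map (open_submanifold (vector_manifold V) U) (vector_manifold W) f \<longleftrightarrow> smooth_on V U W f"
    (is "?L \<longleftrightarrow> ?R")
proof -
  have UV: "U \<subseteq> V" using U openin_imp_subset by blast
  then have VU: "V \<inter> U = U" by auto
  have at: "atlas (open_submanifold (vector_manifold V) U) = {(U, id)}"
    by (simp add: atlas_open_submanifold VU)
  have inv: "inv_into U id x = x" if "x \<in> U" for x
    using inv_into_f_f[of id U x] that by simp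
  show ?thesis
  proof
    assume L: ?L
    have "continuous_map (top_of_set U) (top_of_set W) f"
      using smooth_map_continuous[OF L] by (simp add: subtopology_subtopology VU)
    then have "U \<inter> f -` W = U" by (auto simp: continuous_map_def)
    moreover have "smooth_on V (id ` (U \<inter> f -` W)) W (id \<circ> f \<circ> inv_into U id)"
      using smooth_map_charts[OF L, of U id W id] at by simp
    ultimately have "smooth_on V U W (id \<circ> f \<circ> inv_into U id)" by simp
    then show ?R by (rule smooth_on_cong[OF V _ U]) (simp add: inv)
  next
    assume R: ?R
    note D = smooth_onD[OF R lcs_subspace[OF V]]
    have fW: "f \<in> U \<rightarrow> W"
      using iter_deriv_in[OF R lcs_subspace[OF V], of _ "\<lambda>_. 0" 0] subspace_0[OF lcs_subspace[OF V]] by auto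
    have "continuous_map (prod_topology (top_of_set U) (product_topology (\<lambda>_. top_of_set V) {..<0::nat}))
            (top_of_set W) (\<lambda>(x, h). iter_deriv f 0 h x)"
      using R unfolding smooth_on_def by blast
    moreover have "continuous_map (top_of_set U) (prod_topology (top_of_set U) (product_topology (\<lambda>_. top_of_set V) {..<0::nat}))
        (\<lambda>x. (x, \<lambda>i. undefined))"
      by (intro continuous_map_pairedI) (auto simp: continuous_map_id[unfolded id_def])
    ultimately have "continuous_map (top_of_set U) (top_of_set W) ((\<lambda>(x, h). iter_deriv f 0 h x) \<circ> (\<lambda>x. (x, \<lambda>i. undefined)))"
      by (rule continuous_map_compose[rotated])
    then have cf: "continuous_map (top_of_set U) (top_of_set W) f" by (simp add: o_def)
    show ?L
    proof (rule smooth_mapI)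
      show "continuous_map (mtop (open_submanifold (vector_manifold V) U)) (mtop (vector_manifold W)) f"
        using cf by (simp add: subtopology_subtopology VU)
      fix X \<phi> Y \<psi> assume "(X, \<phi>) \<in> atlas (open_submanifold (vector_manifold V) U)" "(Y, \<psi>) \<in> atlas (vector_manifold W)"
      then have eq: "X = U" "\<phi> = id" "Y = W" "\<psi> = id" by (simp_all add: at)
      have s: "id ` (U \<inter> f -` W) = U" using fW by auto
      show "smooth_on (model (open_submanifold (vector_manifold V) U)) (\<phi> ` (X \<inter> f -` Y)) (model (vector_manifold W))
          (\<psi> \<circ> f \<circ> inv_into X \<phi>)"
        unfolding eq s open_submanifold_simps vector_manifold_simps
        by (rule smooth_on_cong[OF V R U]) (simp add: inv)
    qed
  qed
qed

lemma open_submanifold_vector_self: "open_submanifold (vector_manifold V) V = vector_manifold V"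
  by (simp add: open_submanifold_def vector_manifold_def subtopology_subtopology)

lemma smooth_on_iff_smooth_map_self:
  assumes V: "locally_convex_space V" and W: "locally_convex_space W"
  shows "smooth_map (vector_manifold V) (vector_manifold W) f \<longleftrightarrow> smooth_on V V W f"
  using smooth_on_iff_smooth_map[OF V openin_subtopology_self W] by (simp add: open_submanifold_vector_self)

lemma homeomorphic_chartI:
  assumes "inj_on \<phi> U" "U \<subseteq> topspace X"
    and "continuous_map (subtopology X U) (top_of_set (\<phi> ` U)) \<phi>"
    and "continuous_map (top_of_set (\<phi> ` U)) X (inv_into U \<phi>)"
  shows "homeomorphic_map (subtopology X U) (top_of_set (\<phi> ` U)) \<phi>"
proof -
  have "homeomorphic_maps (subtopology X U) (top_of_set (\<phi> ` U)) \<phi> (inv_into U \<phi>)"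
    unfolding homeomorphic_maps_def
  proof (intro conjI assms(3) ballI)
    show "continuous_map (top_of_set (\<phi> ` U)) (subtopology X U) (inv_into U \<phi>)"
      using assms(4) by (auto simp: continuous_map_in_subtopology intro: inv_into_into)
    show "inv_into U \<phi> (\<phi> x) = x" if "x \<in> topspace (subtopology X U)" for x
      using that assms(1) by simp
    show "\<phi> (inv_into U \<phi> y) = y" if "y \<in> topspace (top_of_set (\<phi> ` U))" for y
      using that by (intro f_inv_into_f) simp
  qed
  then show ?thesis using homeomorphic_map_maps by blast
qed

subsection \<open>Products\<close>

lemma prod_manifold_simps [simp]:
  "mtop (prod_manifold M N) = prod_topology (mtop M) (mtop N)"
  "model (prod_manifold M N) = model M \<times> model N"
  by (simp_all add: prod_manifold_def)

lemma atlas_prod_manifold: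
  "atlas (prod_manifold M N) = {(U \<times> W, map_prod \<phi> \<psi>) | U \<phi> W \<psi>. (U, \<phi>) \<in> atlas M \<and> (W, \<psi>) \<in> atlas N}"
  by (simp add: prod_manifold_def)

lemma prod_chartE:
  assumes "(X, \<eta>) \<in> atlas (prod_manifold M N)"
  obtains U \<phi> W \<psi> where "(U, \<phi>) \<in> atlas M" "(W, \<psi>) \<in> atlas N" "X = U \<times> W" "\<eta> = map_prod \<phi> \<psi>"
  using assms unfolding atlas_prod_manifold by blast

lemma inv_into_map_prod:
  assumes "inj_on \<phi> U" "inj_on \<psi> W" "y \<in> (\<phi> ` U) \<times> (\<psi> ` W)"
  shows "inv_into (U \<times> W) (map_prod \<phi> \<psi>) y = (inv_into U \<phi> (fst y), inv_into W \<psi> (snd y))"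
proof (rule inv_into_f_eq)
  show "inj_on (map_prod \<phi> \<psi>) (U \<times> W)" using assms(1,2) by (rule map_prod_inj_on)
  show "(inv_into U \<phi> (fst y), inv_into W \<psi> (snd y)) \<in> U \<times> W"
    using assms(3) by (auto intro: inv_into_into)
  show "map_prod \<phi> \<psi> (inv_into U \<phi> (fst y), inv_into W \<psi> (snd y)) = y"
    using assms(3) by (auto simp: f_inv_into_f)
qed

lemma openin_Times_top_of_set:
  assumes "openin (top_of_set V) A" "openin (top_of_set W) B"
  shows "openin (top_of_set (V \<times> W)) (A \<times> B)"
proof -
  have "openin (prod_topology (top_of_set V) (top_of_set W)) (A \<times> B)"
    using assms by (simp add: openin_prod_Times_iff del: prod_topology_subtopology_eu)
  then show ?thesis by simp
qed

lemma smooth_on_compose_linear: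
  assumes V: "locally_convex_space V" and W: "locally_convex_space W" and Z: "locally_convex_space Z"
    and L: "smooth_on V V W L" and f: "smooth_on W U Z f" and "openin (top_of_set V) U'" "L ` U' \<subseteq> U"
  shows "smooth_on V U' Z (\<lambda>x. f (L x))"
  by (rule smooth_on_compose[OF V W Z smooth_on_subset[OF V L assms(6) openin_imp_subset[OF assms(6)]] f assms(7)])

lemma smooth_on_fst:
  assumes V: "locally_convex_space V" and W: "locally_convex_space W"
  shows "smooth_on (V \<times> W) (V \<times> W) V fst"
  by (rule smooth_on_linear[OF locally_convex_space_Times[OF V W] V])
    (auto intro: continuous_on_fst[OF continuous_on_id])

lemma smooth_on_snd:
  assumes V: "locally_convex_space V" and W: "locally_convex_space W"
  shows "smooth_on (V \<times> W) (V \<times> W) W snd"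
  by (rule smooth_on_linear[OF locally_convex_space_Times[OF V W] W])
    (auto intro: continuous_on_snd[OF continuous_on_id])

lemma smooth_on_compose_fst:
  assumes V: "locally_convex_space V" and W: "locally_convex_space W" and Z: "locally_convex_space Z"
    and f: "smooth_on V A Z f" and B: "openin (top_of_set W) B"
  shows "smooth_on (V \<times> W) (A \<times> B) Z (\<lambda>x. f (fst x))"
  by (rule smooth_on_compose_linear[OF locally_convex_space_Times[OF V W] V Z smooth_on_fst[OF V W] f
        openin_Times_top_of_set[OF smooth_on_openin[OF f lcs_subspace[OF V]] B]]) auto

lemma smooth_on_compose_snd:
  assumes V: "locally_convex_space V" and W: "locally_convex_space W" and Z: "locally_convex_space Z"
    and f: "smooth_on W B Z f" and A: "openin (top_of_set V) A"
  shows "smooth_on (V \<times> W) (A \<times> B) Z (\<lambda>x. f (snd x))"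
  by (rule smooth_on_compose_linear[OF locally_convex_space_Times[OF V W] W Z smooth_on_snd[OF V W] f
        openin_Times_top_of_set[OF A smooth_on_openin[OF f lcs_subspace[OF W]]]]) auto

lemma map_prod_image_Times: "map_prod f g ` (A \<times> B) = (f ` A) \<times> (g ` B)"
  by auto

lemma smooth_manifold_prod_manifold:
  assumes M: "smooth_manifold M" and N: "smooth_manifold N"
  shows "smooth_manifold (prod_manifold M N)"
  unfolding smooth_manifold_def prod_manifold_simps
proof (intro conjI)
  note lM = model_lcs[OF M] and lN = model_lcs[OF N]
  show "locally_convex_space (model M \<times> model N)" by (rule locally_convex_space_Times[OF lM lN])
  show "Hausdorff_space (prod_topology (mtop M) (mtop N))"
    by (simp add: Hausdorff_space_prod_topology manifold_Hausdorff[OF M] manifold_Hausdorff[OF N])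
  show "topspace (prod_topology (mtop M) (mtop N)) = (\<Union>(U, \<phi>)\<in>atlas (prod_manifold M N). U)"
  proof
    show "topspace (prod_topology (mtop M) (mtop N)) \<subseteq> (\<Union>(U, \<phi>)\<in>atlas (prod_manifold M N). U)"
    proof
      fix x assume "x \<in> topspace (prod_topology (mtop M) (mtop N))"
      then have x: "fst x \<in> topspace (mtop M)" "snd x \<in> topspace (mtop N)" by auto
      from x(1) obtain U \<phi> where U: "(U, \<phi>) \<in> atlas M" "fst x \<in> U" by (rule obtain_chart[OF M])
      from x(2) obtain W \<psi> where W: "(W, \<psi>) \<in> atlas N" "snd x \<in> W" by (rule obtain_chart[OF N])
      have "(U \<times> W, map_prod \<phi> \<psi>) \<in> atlas (prod_manifold M N)"
        unfolding atlas_prod_manifold using U(1) W(1) by blast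
      moreover have "x \<in> U \<times> W" using U W by (simp add: mem_Times_iff)
      ultimately show "x \<in> (\<Union>(U, \<phi>)\<in>atlas (prod_manifold M N). U)" by blast
    qed
    show "(\<Union>(U, \<phi>)\<in>atlas (prod_manifold M N). U) \<subseteq> topspace (prod_topology (mtop M) (mtop N))"
      unfolding atlas_prod_manifold using chart_subset[OF M] chart_subset[OF N] by fastforce
  qed
  show "\<forall>(U, \<phi>)\<in>atlas (prod_manifold M N). openin (prod_topology (mtop M) (mtop N)) U \<and>
      openin (top_of_set (model M \<times> model N)) (\<phi> ` U) \<and>
      homeomorphic_map (subtopology (prod_topology (mtop M) (mtop N)) U) (top_of_set (\<phi> ` U)) \<phi>"
  proof (rule ballI, rule case_prodI2)
    fix c X \<eta> assume "c \<in> atlas (prod_manifold M N)" "c = (X, \<eta>)"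
    then have "(X, \<eta>) \<in> atlas (prod_manifold M N)" by simp
    then obtain U \<phi> W \<psi> where U: "(U, \<phi>) \<in> atlas M" and W: "(W, \<psi>) \<in> atlas N"
      and X: "X = U \<times> W" "\<eta> = map_prod \<phi> \<psi>" by (rule prod_chartE)
    note MU = M U and NW = N W
    have 1: "openin (prod_topology (mtop M) (mtop N)) X"
      unfolding X using chart_openin[OF MU] chart_openin[OF NW] by (simp add: openin_prod_Times_iff)
    have 2: "openin (top_of_set (model M \<times> model N)) (\<eta> ` X)"
      unfolding X map_prod_image_Times
      by (rule openin_Times_top_of_set[OF chart_image_openin[OF MU] chart_image_openin[OF NW]])
    have "homeomorphic_map (subtopology (prod_topology (mtop M) (mtop N)) X) (top_of_set (\<eta> ` X)) \<eta>"
    proof (rule homeomorphic_chartI)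
      show "inj_on \<eta> X" unfolding X by (rule map_prod_inj_on[OF chart_inj[OF MU] chart_inj[OF NW]])
      show "X \<subseteq> topspace (prod_topology (mtop M) (mtop N))" by (rule openin_subset[OF 1])
      have "continuous_map (prod_topology (subtopology (mtop M) U) (subtopology (mtop N) W))
          (prod_topology (top_of_set (\<phi> ` U)) (top_of_set (\<psi> ` W))) (\<lambda>x. (\<phi> (fst x), \<psi> (snd x)))"
        using homeomorphic_imp_continuous_map[OF chart_homeomorphic[OF MU]]
          homeomorphic_imp_continuous_map[OF chart_homeomorphic[OF NW]]
        by (intro continuous_map_pairedI)
          (auto intro: continuous_map_compose[unfolded o_def, OF continuous_map_fst]
            continuous_map_compose[unfolded o_def, OF continuous_map_snd])
      then show "continuous_map (subtopology (prod_topology (mtop M) (mtop N)) X) (top_of_set (\<eta> ` X)) \<eta>"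
        unfolding X map_prod_image_Times subtopology_Times by (simp add: map_prod_def case_prod_unfold)
      have "continuous_map (prod_topology (top_of_set (\<phi> ` U)) (top_of_set (\<psi> ` W))) (prod_topology (mtop M) (mtop N))
          (\<lambda>y. (inv_into U \<phi> (fst y), inv_into W \<psi> (snd y)))"
        using chart_inv_continuous[OF MU] chart_inv_continuous[OF NW]
        by (intro continuous_map_pairedI)
          (auto intro: continuous_map_compose[unfolded o_def, OF continuous_map_fst]
            continuous_map_compose[unfolded o_def, OF continuous_map_snd] simp del: prod_topology_subtopology_eu)
      then have "continuous_map (top_of_set (\<eta> ` X)) (prod_topology (mtop M) (mtop N))
          (\<lambda>y. (inv_into U \<phi> (fst y), inv_into W \<psi> (snd y)))"
        unfolding X map_prod_image_Times by simp
      then show "continuous_map (top_of_set (\<eta> ` X)) (prod_topology (mtop M) (mtop N)) (inv_into X \<eta>)"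
      proof (rule continuous_map_eq)
        fix y assume "y \<in> topspace (top_of_set (\<eta> ` X))"
        then have "y \<in> (\<phi> ` U) \<times> (\<psi> ` W)" by (simp add: X map_prod_image_Times)
        from inv_into_map_prod[OF chart_inj[OF MU] chart_inj[OF NW] this]
        show "(inv_into U \<phi> (fst y), inv_into W \<psi> (snd y)) = inv_into X \<eta> y" by (simp add: X)
      qed
    qed
    with 1 2 show "openin (prod_topology (mtop M) (mtop N)) X \<and> openin (top_of_set (model M \<times> model N)) (\<eta> ` X) \<and>
      homeomorphic_map (subtopology (prod_topology (mtop M) (mtop N)) X) (top_of_set (\<eta> ` X)) \<eta>"
      by (intro conjI)
  qed
  show "\<forall>(U, \<phi>)\<in>atlas (prod_manifold M N). \<forall>(U', \<phi>')\<in>atlas (prod_manifold M N).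
        smooth_on (model M \<times> model N) (\<phi> ` (U \<inter> U')) (model M \<times> model N) (\<phi>' \<circ> inv_into U \<phi>)"
  proof (rule ballI, rule case_prodI2, rule ballI, rule case_prodI2)
    fix c c' X \<eta> X' \<eta>' assume "c \<in> atlas (prod_manifold M N)" "c = (X, \<eta>)"
      "c' \<in> atlas (prod_manifold M N)" "c' = (X', \<eta>')"
    then have at: "(X, \<eta>) \<in> atlas (prod_manifold M N)" "(X', \<eta>') \<in> atlas (prod_manifold M N)" by simp_all
    from at(1) obtain U \<phi> W \<psi> where U: "(U, \<phi>) \<in> atlas M" and W: "(W, \<psi>) \<in> atlas N"
      and X: "X = U \<times> W" "\<eta> = map_prod \<phi> \<psi>" by (rule prod_chartE)
    from at(2) obtain U' \<phi>' W' \<psi>' where U': "(U', \<phi>') \<in> atlas M" and W': "(W', \<psi>') \<in> atlas N"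
      and X': "X' = U' \<times> W'" "\<eta>' = map_prod \<phi>' \<psi>'" by (rule prod_chartE)
    let ?A = "\<phi> ` (U \<inter> U')" and ?B = "\<psi> ` (W \<inter> W')"
    have im: "\<eta> ` (X \<inter> X') = ?A \<times> ?B"
      unfolding X X' Times_Int_Times map_prod_image_Times ..
    note sM = chart_transition[OF M U U'] and sN = chart_transition[OF N W W']
    note lcs = locally_convex_space_Times[OF lM lN]
    have "smooth_on (model M \<times> model N) (?A \<times> ?B) (model M \<times> model N)
        (\<lambda>y. ((\<phi>' \<circ> inv_into U \<phi>) (fst y), (\<psi>' \<circ> inv_into W \<psi>) (snd y)))"
      by (intro smooth_on_Pair lcs smooth_on_compose_fst[OF lM lN lM sM] smooth_on_compose_snd[OF lM lN lN sN]
          smooth_on_openin[OF sM lcs_subspace[OF lM]] smooth_on_openin[OF sN lcs_subspace[OF lN]])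
    then show "smooth_on (model M \<times> model N) (\<eta> ` (X \<inter> X')) (model M \<times> model N) (\<eta>' \<circ> inv_into X \<eta>)"
      unfolding im
    proof (rule smooth_on_cong[OF lcs])
      show "openin (top_of_set (model M \<times> model N)) (?A \<times> ?B)"
        by (intro openin_Times_top_of_set smooth_on_openin[OF sM lcs_subspace[OF lM]] smooth_on_openin[OF sN lcs_subspace[OF lN]])
      fix y assume "y \<in> ?A \<times> ?B"
      then have "y \<in> (\<phi> ` U) \<times> (\<psi> ` W)" by auto
      from inv_into_map_prod[OF chart_inj[OF M U] chart_inj[OF N W] this]
      show "(\<eta>' \<circ> inv_into X \<eta>) y = ((\<phi>' \<circ> inv_into U \<phi>) (fst y), (\<psi>' \<circ> inv_into W \<psi>) (snd y))"
        by (simp add: X X')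
    qed
  qed
qed

lemma smooth_map_fst:
  assumes M: "smooth_manifold M" and N: "smooth_manifold N"
  shows "smooth_map (prod_manifold M N) M fst"
proof (rule smooth_mapI)
  note lM = model_lcs[OF M] and lN = model_lcs[OF N]
  show "continuous_map (mtop (prod_manifold M N)) (mtop M) fst" by (simp add: continuous_map_fst)
  fix X \<eta> U' \<phi>' assume "(X, \<eta>) \<in> atlas (prod_manifold M N)" and U': "(U', \<phi>') \<in> atlas M"
  from this(1) obtain U \<phi> W \<psi> where U: "(U, \<phi>) \<in> atlas M" and W: "(W, \<psi>) \<in> atlas N"
      and X: "X = U \<times> W" "\<eta> = map_prod \<phi> \<psi>" by (rule prod_chartE)
  note sM = chart_transition[OF M U U'] and oW = chart_image_openin[OF N W]
  have "X \<inter> fst -` U' = (U \<inter> U') \<times> W" unfolding X by auto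
  then have im: "\<eta> ` (X \<inter> fst -` U') = (\<phi> ` (U \<inter> U')) \<times> (\<psi> ` W)"
    unfolding X by (simp only: map_prod_image_Times)
  show "smooth_on (model (prod_manifold M N)) (\<eta> ` (X \<inter> fst -` U')) (model M) (\<phi>' \<circ> fst \<circ> inv_into X \<eta>)"
    unfolding im prod_manifold_simps
  proof (rule smooth_on_cong[OF locally_convex_space_Times[OF lM lN] smooth_on_compose_fst[OF lM lN lM sM oW]])
    show "openin (top_of_set (model M \<times> model N)) (\<phi> ` (U \<inter> U') \<times> \<psi> ` W)"
      by (intro openin_Times_top_of_set smooth_on_openin[OF sM lcs_subspace[OF lM]] oW)
    fix y assume "y \<in> \<phi> ` (U \<inter> U') \<times> \<psi> ` W"
    then have "y \<in> (\<phi> ` U) \<times> (\<psi> ` W)" by auto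
    from inv_into_map_prod[OF chart_inj[OF M U] chart_inj[OF N W] this]
    show "(\<phi>' \<circ> fst \<circ> inv_into X \<eta>) y = (\<phi>' \<circ> inv_into U \<phi>) (fst y)" by (simp add: X)
  qed
qed

lemma smooth_map_snd:
  assumes M: "smooth_manifold M" and N: "smooth_manifold N"
  shows "smooth_map (prod_manifold M N) N snd"
proof (rule smooth_mapI)
  note lM = model_lcs[OF M] and lN = model_lcs[OF N]
  show "continuous_map (mtop (prod_manifold M N)) (mtop N) snd" by (simp add: continuous_map_snd)
  fix X \<eta> W' \<psi>' assume "(X, \<eta>) \<in> atlas (prod_manifold M N)" and W': "(W', \<psi>') \<in> atlas N"
  from this(1) obtain U \<phi> W \<psi> where U: "(U, \<phi>) \<in> atlas M" and W: "(W, \<psi>) \<in> atlas N"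
      and X: "X = U \<times> W" "\<eta> = map_prod \<phi> \<psi>" by (rule prod_chartE)
  note sN = chart_transition[OF N W W'] and oU = chart_image_openin[OF M U]
  have "X \<inter> snd -` W' = U \<times> (W \<inter> W')" unfolding X by auto
  then have im: "\<eta> ` (X \<inter> snd -` W') = (\<phi> ` U) \<times> (\<psi> ` (W \<inter> W'))"
    unfolding X by (simp only: map_prod_image_Times)
  show "smooth_on (model (prod_manifold M N)) (\<eta> ` (X \<inter> snd -` W')) (model N) (\<psi>' \<circ> snd \<circ> inv_into X \<eta>)"
    unfolding im prod_manifold_simps
  proof (rule smooth_on_cong[OF locally_convex_space_Times[OF lM lN] smooth_on_compose_snd[OF lM lN lN sN oU]])
    show "openin (top_of_set (model M \<times> model N)) (\<phi> ` U \<times> \<psi> ` (W \<inter> W'))"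
      by (intro openin_Times_top_of_set smooth_on_openin[OF sN lcs_subspace[OF lN]] oU)
    fix y assume "y \<in> \<phi> ` U \<times> \<psi> ` (W \<inter> W')"
    then have "y \<in> (\<phi> ` U) \<times> (\<psi> ` W)" by auto
    from inv_into_map_prod[OF chart_inj[OF M U] chart_inj[OF N W] this]
    show "(\<psi>' \<circ> snd \<circ> inv_into X \<eta>) y = (\<psi>' \<circ> inv_into W \<psi>) (snd y)" by (simp add: X)
  qed
qed

lemma smooth_map_Pair:
  assumes M: "smooth_manifold M" and N: "smooth_manifold N" and P: "smooth_manifold P"
    and f: "smooth_map M N f" and g: "smooth_map M P g"
  shows "smooth_map M (prod_manifold N P) (\<lambda>x. (f x, g x))"
proof (rule smooth_mapI)
  note lM = model_lcs[OF M]
  show c: "continuous_map (mtop M) (mtop (prod_manifold N P)) (\<lambda>x. (f x, g x))"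
    unfolding prod_manifold_simps
    by (intro continuous_map_pairedI smooth_map_continuous[OF f] smooth_map_continuous[OF g])
  fix U \<phi> X \<eta> assume U: "(U, \<phi>) \<in> atlas M" and "(X, \<eta>) \<in> atlas (prod_manifold N P)"
  from this(2) obtain W \<psi> Y \<omega> where W: "(W, \<psi>) \<in> atlas N" and Y: "(Y, \<omega>) \<in> atlas P"
      and X: "X = W \<times> Y" "\<eta> = map_prod \<psi> \<omega>" by (rule prod_chartE)
  let ?U' = "\<phi> ` (U \<inter> (\<lambda>x. (f x, g x)) -` X)"
  have "openin (mtop (prod_manifold N P)) X"
    unfolding X using chart_openin[OF N W] chart_openin[OF P Y] by (simp add: openin_prod_Times_iff)
  from openin_chart_preimage[OF M U c this]
  have op: "openin (top_of_set (model M)) ?U'" .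
  have "smooth_on (model M) ?U' (model N \<times> model P)
      (\<lambda>v. ((\<psi> \<circ> f \<circ> inv_into U \<phi>) v, (\<omega> \<circ> g \<circ> inv_into U \<phi>) v))"
    by (intro smooth_on_Pair lM smooth_on_subset[OF lM smooth_map_charts[OF f U W] op]
        smooth_on_subset[OF lM smooth_map_charts[OF g U Y] op]) (auto simp: X)
  then show "smooth_on (model M) ?U' (model (prod_manifold N P)) (\<eta> \<circ> (\<lambda>x. (f x, g x)) \<circ> inv_into U \<phi>)"
    by (simp add: X o_def)
qed

lemma smooth_map_const:
  assumes M: "smooth_manifold M" and N: "smooth_manifold N" and c: "c \<in> topspace (mtop N)"
  shows "smooth_map M N (\<lambda>_. c)"
proof (rule smooth_mapI)
  show cm: "continuous_map (mtop M) (mtop N) (\<lambda>_. c)" using c by simp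
  fix U \<phi> W \<psi> assume U: "(U, \<phi>) \<in> atlas M" and W: "(W, \<psi>) \<in> atlas N"
  let ?w = "if c \<in> W then \<psi> c else 0"
  have w: "?w \<in> model N"
    using chart_image_subset[OF N W] subspace_0[OF lcs_subspace[OF model_lcs[OF N]]] by auto
  note op = openin_chart_preimage[OF M U cm chart_openin[OF N W]]
  show "smooth_on (model M) (\<phi> ` (U \<inter> (\<lambda>_. c) -` W)) (model N) (\<psi> \<circ> (\<lambda>_. c) \<circ> inv_into U \<phi>)"
    by (rule smooth_on_cong[OF model_lcs[OF M] smooth_on_const[OF model_lcs[OF M] op model_lcs[OF N] w] op]) auto
qed

lemma smooth_map_id:
  assumes M: "smooth_manifold M"
  shows "smooth_map M M (\<lambda>x. x)"
proof (rule smooth_mapI)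
  fix U \<phi> W \<psi> assume U: "(U, \<phi>) \<in> atlas M" and W: "(W, \<psi>) \<in> atlas M"
  have "U \<inter> (\<lambda>x. x) -` W = U \<inter> W" by auto
  then show "smooth_on (model M) (\<phi> ` (U \<inter> (\<lambda>x. x) -` W)) (model M) (\<psi> \<circ> (\<lambda>x. x) \<circ> inv_into U \<phi>)"
    using chart_transition[OF M U W] by (simp add: o_def)
qed simp

lemma smooth_map_vec:
  fixes f :: "'x \<Rightarrow> 'w::{real_vector,t2_space} ^ 'n"
  assumes M: "smooth_manifold M" and W: "locally_convex_space (UNIV :: 'w set)"
    and f: "\<And>i. smooth_map M (vector_manifold UNIV) (\<lambda>x. f x $ i)"
  shows "smooth_map M (vector_manifold UNIV) f"
proof (rule smooth_mapI)
  have "continuous_map (mtop M) euclidean (\<lambda>x. f x $ i)" for i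
    using smooth_map_continuous[OF f[of i]] by simp
  then have "continuous_map (mtop M) euclidean f"
    unfolding continuous_map_atin by (auto intro: vec_tendstoI)
  then show "continuous_map (mtop M) (mtop (vector_manifold UNIV)) f" by simp
  fix U \<phi> X \<psi> assume U: "(U, \<phi>) \<in> atlas M" and "(X, \<psi>) \<in> atlas (vector_manifold (UNIV :: ('w ^ 'n) set))"
  then have X: "X = UNIV" "\<psi> = id" by simp_all
  have "smooth_on (model M) (\<phi> ` U) UNIV (\<lambda>v. f (inv_into U \<phi> v) $ i)" for i
    using smooth_map_charts[OF f[of i] U, of UNIV id] by (simp add: o_def)
  then have "smooth_on (model M) (\<phi> ` U) UNIV (\<lambda>v. f (inv_into U \<phi> v))"
    by (rule smooth_on_vec[OF model_lcs[OF M]])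
  then show "smooth_on (model M) (\<phi> ` (U \<inter> f -` X)) (model (vector_manifold UNIV)) (\<psi> \<circ> f \<circ> inv_into U \<phi>)"
    by (simp add: X o_def)
qed

subsection \<open>Charts\<close>

lemma smooth_map_chart:
  assumes M: "smooth_manifold M" and U: "(U, \<phi>) \<in> atlas M"
  shows "smooth_map (open_submanifold M U) (vector_manifold (model M)) \<phi>"
proof (rule smooth_mapI)
  show c: "continuous_map (mtop (open_submanifold M U)) (mtop (vector_manifold (model M))) \<phi>"
    using chart_continuous[OF M U] by simp
  fix X \<psi> Y \<omega> assume "(X, \<psi>) \<in> atlas (open_submanifold M U)" "(Y, \<omega>) \<in> atlas (vector_manifold (model M))"
  then obtain U' where U': "(U', \<psi>) \<in> atlas M" "X = U' \<inter> U" and Y: "Y = model M" "\<omega> = id"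
    by (auto simp: atlas_open_submanifold)
  have s: "U' \<inter> U \<inter> \<phi> -` model M = U' \<inter> U" using chart_image_subset[OF M U] by auto
  note sm = chart_transition[OF M U'(1) U]
  show "smooth_on (model (open_submanifold M U)) (\<psi> ` (X \<inter> \<phi> -` Y)) (model (vector_manifold (model M)))
      (\<omega> \<circ> \<phi> \<circ> inv_into X \<psi>)"
    unfolding open_submanifold_simps vector_manifold_simps Y U'(2) s
    by (rule smooth_on_cong[OF model_lcs[OF M] sm smooth_on_openin[OF sm lcs_subspace[OF model_lcs[OF M]]]])
      (simp add: inv_into_chart_Int[OF M U'(1)])
qed

lemma smooth_map_chart_inverse:
  assumes M: "smooth_manifold M" and U: "(U, \<phi>) \<in> atlas M"
  shows "smooth_map (open_submanifold (vector_manifold (model M)) (\<phi> ` U)) M (inv_into U \<phi>)"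
proof (rule smooth_mapI)
  have s: "model M \<inter> \<phi> ` U = \<phi> ` U" using chart_image_subset[OF M U] by auto
  show "continuous_map (mtop (open_submanifold (vector_manifold (model M)) (\<phi> ` U))) (mtop M) (inv_into U \<phi>)"
    using chart_inv_continuous[OF M U] by (simp add: subtopology_subtopology s)
  fix X \<psi> U' \<phi>' assume "(X, \<psi>) \<in> atlas (open_submanifold (vector_manifold (model M)) (\<phi> ` U))"
    and U': "(U', \<phi>') \<in> atlas M"
  then have X: "X = \<phi> ` U" "\<psi> = id" by (auto simp: atlas_open_submanifold s)
  have im: "id ` (\<phi> ` U \<inter> inv_into U \<phi> -` U') = \<phi> ` (U \<inter> U')"
    using chart_inj[OF M U] by auto
  have inv: "inv_into A id v = v" if "v \<in> A" for A and v :: 'b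
    using inv_into_f_f[of id A v] that by simp
  note sm = chart_transition[OF M U U']
  show "smooth_on (model (open_submanifold (vector_manifold (model M)) (\<phi> ` U))) (\<psi> ` (X \<inter> inv_into U \<phi> -` U'))
      (model M) (\<phi>' \<circ> inv_into U \<phi> \<circ> inv_into X \<psi>)"
    unfolding X im open_submanifold_simps vector_manifold_simps
  proof (rule smooth_on_cong[OF model_lcs[OF M] sm smooth_on_openin[OF sm lcs_subspace[OF model_lcs[OF M]]]])
    fix v assume "v \<in> \<phi> ` (U \<inter> U')"
    then have "v \<in> \<phi> ` U" by auto
    then show "(\<phi>' \<circ> inv_into U \<phi> \<circ> inv_into (\<phi> ` U) id) v = (\<phi>' \<circ> inv_into U \<phi>) v"
      by (simp add: inv)
  qed
qed

subsection \<open>Manifold structures induced by injective maps\<close>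

text \<open>A set \<open>H\<close> with an injective map \<open>j\<close> into a manifold \<open>B\<close> and with charts that are
  compatible with \<open>j\<close>: locally, each chart factors through \<open>j\<close> and a smooth map on an open
  subset of \<open>B\<close>, and \<open>j\<close> is smooth on the image of each chart.\<close>

locale embedded_charts =
  fixes B :: "('b, 'w::{real_vector,t2_space}) manifold" and j :: "'h \<Rightarrow> 'b" and H :: "'h set"
    and charts :: "('h set \<times> ('h \<Rightarrow> 'v::{real_vector,t2_space})) set" and V :: "'v set"
  assumes B: "smooth_manifold B" and V: "locally_convex_space V"
    and j_in: "j \<in> H \<rightarrow> topspace (mtop B)" and j_inj: "inj_on j H"
    and cover: "H = (\<Union>(U, \<phi>)\<in>charts. U)"
    and extends: "(U, \<phi>) \<in> charts \<Longrightarrow> \<exists>X \<Phi>. openin (mtop B) X \<and> U = {h \<in> H. j h \<in> X} \<and>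
       smooth_map (open_submanifold B X) (vector_manifold V) \<Phi> \<and> (\<forall>h\<in>U. \<phi> h = \<Phi> (j h))"
    and inj: "(U, \<phi>) \<in> charts \<Longrightarrow> inj_on \<phi> U"
    and image_open: "(U, \<phi>) \<in> charts \<Longrightarrow> openin (top_of_set V) (\<phi> ` U)"
    and inverse_smooth: "(U, \<phi>) \<in> charts \<Longrightarrow>
       smooth_map (open_submanifold (vector_manifold V) (\<phi> ` U)) B (\<lambda>v. j (inv_into U \<phi> v))"
begin

definition induced :: "('h, 'v) manifold" where
  "induced = \<lparr>mtop = pullback_topology H j (mtop B), atlas = charts, model = V\<rparr>"

lemma induced_simps [simp]:
  "mtop induced = pullback_topology H j (mtop B)" "atlas induced = charts" "model induced = V"
  by (simp_all add: induced_def)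

lemma topspace_induced: "topspace (pullback_topology H j (mtop B)) = H"
  using j_in by (auto simp: topspace_pullback_topology)

lemma continuous_into_induced:
  "continuous_map X (pullback_topology H j (mtop B)) f \<longleftrightarrow>
   continuous_map X (mtop B) (\<lambda>x. j (f x)) \<and> f \<in> topspace X \<rightarrow> H"
proof
  assume L: "continuous_map X (pullback_topology H j (mtop B)) f"
  have "continuous_map (pullback_topology H j (mtop B)) (mtop B) (id \<circ> j)"
    by (rule continuous_map_pullback) simp
  from continuous_map_compose[OF L this]
  show "continuous_map X (mtop B) (\<lambda>x. j (f x)) \<and> f \<in> topspace X \<rightarrow> H"
    using L topspace_induced by (auto simp: o_def continuous_map_def)
next
  assume R: "continuous_map X (mtop B) (\<lambda>x. j (f x)) \<and> f \<in> topspace X \<rightarrow> H"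
  show "continuous_map X (pullback_topology H j (mtop B)) f"
    by (rule continuous_map_pullback') (use R in \<open>auto simp: o_def\<close>)
qed

lemma continuous_j: "continuous_map (pullback_topology H j (mtop B)) (mtop B) j"
  using continuous_into_induced[of "pullback_topology H j (mtop B)" "\<lambda>x. x"] by simp

lemma chart_open_in_induced:
  assumes "(U, \<phi>) \<in> charts"
  shows "openin (pullback_topology H j (mtop B)) U"
proof -
  obtain X where "openin (mtop B) X" "U = {h \<in> H. j h \<in> X}" using extends[OF assms] by blast
  then show ?thesis unfolding openin_pullback_topology by (intro exI[of _ X]) auto
qed

lemma chart_subset_carrier: "(U, \<phi>) \<in> charts \<Longrightarrow> U \<subseteq> H"
  using cover by blast

lemma smooth_into_chart:
  assumes N: "smooth_manifold N" and U: "(U, \<phi>) \<in> charts"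
    and f: "smooth_map N B (\<lambda>x. j (f x))" and fU: "f \<in> topspace (mtop N) \<rightarrow> U"
  shows "smooth_map N (vector_manifold V) (\<lambda>x. \<phi> (f x))"
proof -
  from extends[OF U] obtain X \<Phi> where X: "openin (mtop B) X" "U = {h \<in> H. j h \<in> X}"
    and \<Phi>: "smooth_map (open_submanifold B X) (vector_manifold V) \<Phi>" "\<forall>h\<in>U. \<phi> h = \<Phi> (j h)"
    by (elim exE conjE)
  have jf: "smooth_map N (open_submanifold B X) (\<lambda>x. j (f x))"
    using f fU X(2) by (auto simp: smooth_map_into_open_submanifold[OF N B])
  have "smooth_map N (vector_manifold V) (\<lambda>x. \<Phi> (j (f x)))"
    by (rule smooth_map_compose[OF N smooth_manifold_open_submanifold[OF B X(1)]
          smooth_manifold_vector_manifold[OF V] jf \<Phi>(1)])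
  then show ?thesis
    by (rule smooth_map_cong[OF N]) (simp add: \<Phi>(2)[rule_format, OF funcset_mem[OF fU]])
qed

text \<open>A change of charts is the smooth extension of one chart to \<open>B\<close> applied to \<open>j\<close> after the
  inverse of the other chart.\<close>

theorem smooth_manifold_induced: "smooth_manifold induced"
  unfolding smooth_manifold_def induced_simps
proof (intro conjI)
  show "locally_convex_space V" by (rule V)
  show "Hausdorff_space (pullback_topology H j (mtop B))"
    by (rule Hausdorff_space_injective_preimage[OF manifold_Hausdorff[OF B] continuous_j])
      (simp add: topspace_induced j_inj)
  show "topspace (pullback_topology H j (mtop B)) = (\<Union>(U, \<phi>)\<in>charts. U)"
    unfolding topspace_induced by (rule cover)
  note VB = smooth_manifold_vector_manifold[OF V]
  have sub: "smooth_manifold (open_submanifold (vector_manifold V) A)" if "openin (top_of_set V) A" for A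
    using that by (intro smooth_manifold_open_submanifold VB) simp
  show "\<forall>(U, \<phi>)\<in>charts. openin (pullback_topology H j (mtop B)) U \<and> openin (top_of_set V) (\<phi> ` U) \<and>
      homeomorphic_map (subtopology (pullback_topology H j (mtop B)) U) (top_of_set (\<phi> ` U)) \<phi>"
  proof (rule ballI, rule case_prodI2)
    fix c U \<phi> assume "c \<in> charts" "c = (U, \<phi>)"
    then have U: "(U, \<phi>) \<in> charts" by simp
    have \<phi>UV: "\<phi> ` U \<subseteq> V" using openin_imp_subset[OF image_open[OF U]] .
    have "homeomorphic_map (subtopology (pullback_topology H j (mtop B)) U) (top_of_set (\<phi> ` U)) \<phi>"
    proof (rule homeomorphic_chartI[OF inj[OF U]])
      show "U \<subseteq> topspace (pullback_topology H j (mtop B))"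
        unfolding topspace_induced by (rule chart_subset_carrier[OF U])
      from extends[OF U] obtain X \<Phi> where X: "openin (mtop B) X" "U = {h \<in> H. j h \<in> X}"
        and \<Phi>: "smooth_map (open_submanifold B X) (vector_manifold V) \<Phi>" "\<forall>h\<in>U. \<phi> h = \<Phi> (j h)"
        by (elim exE conjE)
      have "continuous_map (subtopology (pullback_topology H j (mtop B)) U) (mtop B) j"
        using continuous_j by (rule continuous_map_from_subtopology)
      then have "continuous_map (subtopology (pullback_topology H j (mtop B)) U) (subtopology (mtop B) X) j"
        using X(2) by (auto simp: continuous_map_in_subtopology topspace_induced)
      moreover have "continuous_map (subtopology (mtop B) X) (top_of_set V) \<Phi>"
        using smooth_map_continuous[OF \<Phi>(1)] by simp
      ultimately have "continuous_map (subtopology (pullback_topology H j (mtop B)) U) (top_of_set V) (\<Phi> \<circ> j)"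
        by (rule continuous_map_compose)
      then have "continuous_map (subtopology (pullback_topology H j (mtop B)) U) (top_of_set V) \<phi>"
        by (rule continuous_map_eq) (use \<Phi>(2) in \<open>simp add: topspace_induced\<close>)
      then show "continuous_map (subtopology (pullback_topology H j (mtop B)) U) (top_of_set (\<phi> ` U)) \<phi>"
        by (auto simp: continuous_map_in_subtopology topspace_induced)
      have "V \<inter> \<phi> ` U = \<phi> ` U" using \<phi>UV by auto
      then have "continuous_map (top_of_set (\<phi> ` U)) (mtop B) (\<lambda>v. j (inv_into U \<phi> v))"
        using smooth_map_continuous[OF inverse_smooth[OF U]] by (simp add: subtopology_subtopology)
      moreover have "inv_into U \<phi> \<in> topspace (top_of_set (\<phi> ` U)) \<rightarrow> H"
        using chart_subset_carrier[OF U] by (auto simp: inv_into_f_f[OF inj[OF U]])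
      ultimately show "continuous_map (top_of_set (\<phi> ` U)) (pullback_topology H j (mtop B)) (inv_into U \<phi>)"
        unfolding continuous_into_induced by (rule conjI)
    qed
    then show "openin (pullback_topology H j (mtop B)) U \<and> openin (top_of_set V) (\<phi> ` U) \<and>
      homeomorphic_map (subtopology (pullback_topology H j (mtop B)) U) (top_of_set (\<phi> ` U)) \<phi>"
      by (intro conjI chart_open_in_induced[OF U] image_open[OF U])
  qed
  show "\<forall>(U, \<phi>)\<in>charts. \<forall>(U', \<phi>')\<in>charts. smooth_on V (\<phi> ` (U \<inter> U')) V (\<phi>' \<circ> inv_into U \<phi>)"
  proof (rule ballI, rule case_prodI2, rule ballI, rule case_prodI2)
    fix c c' U \<phi> U' \<phi>' assume "c \<in> charts" "c = (U, \<phi>)" "c' \<in> charts" "c' = (U', \<phi>')"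
    then have U: "(U, \<phi>) \<in> charts" and U': "(U', \<phi>') \<in> charts" by simp_all
    let ?A = "\<phi> ` (U \<inter> U')" and ?i = "inv_into U \<phi>"
    have inv: "?i (\<phi> h) = h" if "h \<in> U" for h by (rule inv_into_f_f[OF inj[OF U] that])
    from extends[OF U'] obtain X where X: "openin (mtop B) X" "U' = {h \<in> H. j h \<in> X}" by (elim exE conjE)
    let ?D = "open_submanifold (vector_manifold V) (\<phi> ` U)"
    have top: "mtop ?D = top_of_set (\<phi> ` U)"
      using openin_imp_subset[OF image_open[OF U]] by (simp add: subtopology_subtopology Int_absorb1)
    have "openin (mtop ?D) {v \<in> topspace (mtop ?D). j (?i v) \<in> X}"
      by (rule openin_continuous_map_preimage[OF smooth_map_continuous[OF inverse_smooth[OF U]] X(1)])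
    moreover have "{v \<in> topspace (mtop ?D). j (?i v) \<in> X} = ?A"
      unfolding top using chart_subset_carrier[OF U] X(2) by (auto simp: inv)
    ultimately have oA': "openin (top_of_set (\<phi> ` U)) ?A" unfolding top by simp
    then have oA: "openin (top_of_set V) ?A" by (rule openin_trans[OF _ image_open[OF U]])
    have eq: "open_submanifold ?D ?A = open_submanifold (vector_manifold V) ?A"
      using openin_imp_subset[OF image_open[OF U]]
      by (auto simp: open_submanifold_def subtopology_subtopology vector_manifold_def intro: arg_cong[where f = "subtopology euclidean"])
    have "smooth_map (open_submanifold ?D ?A) B (\<lambda>v. j (?i v))"
      by (rule smooth_map_restrict[OF sub[OF image_open[OF U]] B _ inverse_smooth[OF U]]) (use oA' top in simp)
    then have ji: "smooth_map (open_submanifold (vector_manifold V) ?A) B (\<lambda>v. j (?i v))"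
      unfolding eq .
    have "smooth_map (open_submanifold (vector_manifold V) ?A) (vector_manifold V) (\<lambda>v. \<phi>' (?i v))"
      by (rule smooth_into_chart[OF sub[OF oA] U' ji]) (auto simp: inv)
    then show "smooth_on V ?A V (\<phi>' \<circ> ?i)"
      by (simp add: smooth_on_iff_smooth_map[OF V oA V] o_def)
  qed
qed

theorem smooth_map_j: "smooth_map induced B j"
proof (rule smooth_mapI)
  show "continuous_map (mtop induced) (mtop B) j" using continuous_j by simp
  fix U \<phi> W \<psi> assume "(U, \<phi>) \<in> atlas induced" and W: "(W, \<psi>) \<in> atlas B"
  then have U: "(U, \<phi>) \<in> charts" by simp
  let ?i = "inv_into U \<phi>"
  let ?D = "open_submanifold (vector_manifold V) (\<phi> ` U)"
  have inv: "?i (\<phi> h) = h" if "h \<in> U" for h by (rule inv_into_f_f[OF inj[OF U] that])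
  have s: "V \<inter> \<phi> ` U = \<phi> ` U" using openin_imp_subset[OF image_open[OF U]] by auto
  have at: "(\<phi> ` U, id) \<in> atlas ?D" by (simp add: atlas_open_submanifold s)
  note sm = smooth_map_charts[OF inverse_smooth[OF U] at W, unfolded open_submanifold_simps vector_manifold_simps]
  have im: "id ` (\<phi> ` U \<inter> (\<lambda>v. j (?i v)) -` W) = \<phi> ` (U \<inter> j -` W)"
    by (auto simp: inv)
  show "smooth_on (model induced) (\<phi> ` (U \<inter> j -` W)) (model B) (\<psi> \<circ> j \<circ> ?i)"
    unfolding induced_simps
  proof (rule smooth_on_cong[OF V sm[unfolded im] smooth_on_openin[OF sm[unfolded im] lcs_subspace[OF V]]])
    fix v assume "v \<in> \<phi> ` (U \<inter> j -` W)"
    then have "v \<in> \<phi> ` U" by auto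
    then show "(\<psi> \<circ> j \<circ> ?i) v = (\<psi> \<circ> (\<lambda>v. j (?i v)) \<circ> inv_into (\<phi> ` U) id) v"
      using inv_into_f_f[of id "\<phi> ` U" v] by simp
  qed
qed

text \<open>The universal property that replaces computations in charts: smoothness of a map into the
  induced manifold can be tested in \<open>B\<close>.\<close>

theorem smooth_map_into_induced:
  assumes N: "smooth_manifold N"
  shows "smooth_map N induced f \<longleftrightarrow> smooth_map N B (\<lambda>x. j (f x)) \<and> f \<in> topspace (mtop N) \<rightarrow> H"
proof
  assume L: "smooth_map N induced f"
  show "smooth_map N B (\<lambda>x. j (f x)) \<and> f \<in> topspace (mtop N) \<rightarrow> H"
  proof
    show "smooth_map N B (\<lambda>x. j (f x))"
      by (rule smooth_map_compose[OF N smooth_manifold_induced B L smooth_map_j])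
    show "f \<in> topspace (mtop N) \<rightarrow> H"
      using smooth_map_in[OF L] topspace_induced by auto
  qed
next
  assume R: "smooth_map N B (\<lambda>x. j (f x)) \<and> f \<in> topspace (mtop N) \<rightarrow> H"
  then have jf: "smooth_map N B (\<lambda>x. j (f x))" and fH: "f \<in> topspace (mtop N) \<rightarrow> H" by simp_all
  have c: "continuous_map (mtop N) (mtop induced) f"
    using smooth_map_continuous[OF jf] fH by (simp add: continuous_into_induced)
  show "smooth_map N induced f"
  proof (rule smooth_map_local[OF N smooth_manifold_induced])
    fix x assume x: "x \<in> topspace (mtop N)"
    then have "f x \<in> H" using fH by auto
    then obtain U \<phi> where U: "(U, \<phi>) \<in> charts" "f x \<in> U" using cover by blast
    let ?X = "{y \<in> topspace (mtop N). f y \<in> U}"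
    have X: "openin (mtop N) ?X"
      using c chart_open_in_induced[OF U(1)] by (intro openin_continuous_map_preimage[of _ "mtop induced"]) simp_all
    let ?N = "open_submanifold N ?X"
    note NX = smooth_manifold_open_submanifold[OF N X]
    have topX: "topspace (mtop ?N) = ?X" by auto
    have "smooth_map ?N (vector_manifold V) (\<lambda>y. \<phi> (f y))"
      by (rule smooth_into_chart[OF NX U(1) smooth_map_restrict[OF N B X jf]]) (auto simp: topX)
    then have s: "smooth_map ?N (open_submanifold (vector_manifold V) (\<phi> ` U)) (\<lambda>y. \<phi> (f y))"
      by (subst smooth_map_into_open_submanifold[OF NX smooth_manifold_vector_manifold[OF V]]) auto
    have at: "(U, \<phi>) \<in> atlas induced" using U(1) by simp
    note ci = smooth_map_chart_inverse[OF smooth_manifold_induced at, unfolded induced_simps]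
    have "smooth_map ?N induced (\<lambda>y. inv_into U \<phi> (\<phi> (f y)))"
      by (rule smooth_map_compose[OF NX smooth_manifold_open_submanifold[OF smooth_manifold_vector_manifold[OF V]]
            smooth_manifold_induced s ci]) (use image_open[OF U(1)] in simp)
    then have "smooth_map ?N induced f"
      by (rule smooth_map_cong[OF NX]) (auto simp: inv_into_f_f[OF inj[OF U(1)]])
    then show "\<exists>X. openin (mtop N) X \<and> x \<in> X \<and> smooth_map (open_submanifold N X) induced f"
      using X x U(2) by (intro exI[of _ ?X]) simp
  qed
qed

end

section \<open>Semilinear automorphisms as matrices\<close>

lemma additive_sum:
  fixes f :: "'u::ab_group_add \<Rightarrow> 'v::ab_group_add"
  assumes "\<And>x y. f (x + y) = f x + f y"
  shows "f (sum h I) = (\<Sum>i\<in>I. f (h i))"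
proof -
  have "f 0 = 0" using assms[of 0 0] by simp
  then show ?thesis by (induction I rule: infinite_finite_induct) (simp_all add: assms)
qed

text \<open>The hypotheses on the algebra, the group, its action and the module, where \<open>\<theta>\<close> identifies
  the module with \<open>pA\<^sup>n\<close>.\<close>

locale projective_module = continuous_inverse_algebra scaleK
  for scaleK :: "'k::real_or_complex \<Rightarrow> 'a::{real_algebra_1,t2_space} \<Rightarrow> 'a" +
  fixes G :: "('g, 'b) monoid_scheme"
    and MG :: "('g, 'm::{real_vector,t2_space}) manifold"
    and \<mu> :: "'g \<Rightarrow> 'a \<Rightarrow> 'a"
    and act :: "'e::{ab_group_add,topological_space} \<Rightarrow> 'a \<Rightarrow> 'e"
    and p :: "'a^'n^'n"
    and \<theta> :: "'e \<Rightarrow> 'a^'n"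
  assumes lie_group_G: "lie_group G MG"
    and action: "smooth_action scaleK G MG \<mu>"
    and module: "fg_projective_via act p \<theta>"
    and liftable: "\<mu> ` carrier G \<subseteq> Aut_alg_mod scaleK act"
begin

sublocale G: group G
  using lie_group_G unfolding lie_group_def by blast

subsection \<open>The action on matrices and vectors\<close>

abbreviation star :: "'g \<Rightarrow> 'a^'n^'n \<Rightarrow> 'a^'n^'n" where "star g \<equiv> map_matrix (\<mu> g)"
definition sharp :: "'g \<Rightarrow> 'a^'n \<Rightarrow> 'a^'n" where "sharp g v = (\<chi> i. \<mu> g (v $ i))"

lemma mu_hom: "\<mu> \<in> hom G (Aut_alg scaleK)"
  using action unfolding smooth_action_def by blast

lemma mu_Aut: "g \<in> carrier G \<Longrightarrow> \<mu> g \<in> carrier (Aut_alg scaleK)"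
  using mu_hom by (rule hom_in_carrier)

lemma
  assumes "g \<in> carrier G"
  shows mu_add: "\<mu> g (a + b) = \<mu> g a + \<mu> g b" and mu_mult: "\<mu> g (a * b) = \<mu> g a * \<mu> g b"
    and mu_one: "\<mu> g 1 = 1" and mu_scaleK: "\<mu> g (scaleK c a) = scaleK c (\<mu> g a)"
    and mu_homeo: "homeomorphic_map euclidean euclidean (\<mu> g)"
  using mu_Aut[OF assms] unfolding Aut_alg_def by (auto simp: Vector_Spaces.linear_iff)

lemma mu_sum: "g \<in> carrier G \<Longrightarrow> \<mu> g (sum f I) = (\<Sum>i\<in>I. \<mu> g (f i))"
  by (rule additive_sum) (rule mu_add)

lemma mu_compose: "g \<in> carrier G \<Longrightarrow> h \<in> carrier G \<Longrightarrow> \<mu> (g \<otimes>\<^bsub>G\<^esub> h) a = \<mu> g (\<mu> h a)"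
  using hom_mult[OF mu_hom, of g h] by (simp add: Aut_alg_def fun_eq_iff)

text \<open>The image of the unit is an idempotent of a group of bijections.\<close>

lemma mu_unit: "\<mu> \<one>\<^bsub>G\<^esub> a = a"
proof -
  have "inj (\<mu> \<one>\<^bsub>G\<^esub>)"
    using homeomorphic_imp_injective_map[OF mu_homeo[OF G.one_closed]] by simp
  moreover have "\<mu> \<one>\<^bsub>G\<^esub> (\<mu> \<one>\<^bsub>G\<^esub> a) = \<mu> \<one>\<^bsub>G\<^esub> a"
    using mu_compose[OF G.one_closed G.one_closed, of a] by simp
  ultimately show ?thesis by (simp add: inj_def)
qed

lemma star_mult: "g \<in> carrier G \<Longrightarrow> star g (A ** B) = star g A ** star g B"
  by (simp add: vec_eq_iff matrix_matrix_mult_def mu_sum mu_mult)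

lemma star_compose: "g \<in> carrier G \<Longrightarrow> h \<in> carrier G \<Longrightarrow> star (g \<otimes>\<^bsub>G\<^esub> h) A = star g (star h A)"
  by (simp add: vec_eq_iff mu_compose)

lemma star_unit: "star \<one>\<^bsub>G\<^esub> A = A"
  by (simp add: vec_eq_iff mu_unit)

lemma star_inv: "g \<in> carrier G \<Longrightarrow> star g (star (inv\<^bsub>G\<^esub> g) A) = A"
  "g \<in> carrier G \<Longrightarrow> star (inv\<^bsub>G\<^esub> g) (star g A) = A"
  by (simp_all add: star_unit flip: star_compose)

lemma sharp_compose: "g \<in> carrier G \<Longrightarrow> h \<in> carrier G \<Longrightarrow> sharp (g \<otimes>\<^bsub>G\<^esub> h) v = sharp g (sharp h v)"
  by (simp add: sharp_def vec_eq_iff mu_compose)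

lemma sharp_unit: "sharp \<one>\<^bsub>G\<^esub> v = v"
  by (simp add: sharp_def vec_eq_iff mu_unit)

lemma sharp_inv: "g \<in> carrier G \<Longrightarrow> sharp g (sharp (inv\<^bsub>G\<^esub> g) v) = v"
  "g \<in> carrier G \<Longrightarrow> sharp (inv\<^bsub>G\<^esub> g) (sharp g v) = v"
  by (simp_all add: sharp_unit flip: sharp_compose)

lemma sharp_mult: "g \<in> carrier G \<Longrightarrow> sharp g (A *v v) = star g A *v sharp g v"
  by (simp add: sharp_def vec_eq_iff matrix_vector_mult_def mu_sum mu_mult)

lemma sharp_add: "g \<in> carrier G \<Longrightarrow> sharp g (v + w) = sharp g v + sharp g w"
  by (simp add: sharp_def vec_eq_iff mu_add)

lemma continuous_sharp: "g \<in> carrier G \<Longrightarrow> continuous_on UNIV (sharp g)"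
proof -
  assume g: "g \<in> carrier G"
  have "continuous_on UNIV (\<mu> g)"
    using homeomorphic_imp_continuous_map[OF mu_homeo[OF g]] by simp
  then have "continuous_on UNIV (\<lambda>v :: 'a^'n. \<mu> g (v $ i))" for i
    by (rule continuous_on_compose2[OF _ continuous_on_component[OF continuous_on_id]]) simp
  then show ?thesis unfolding sharp_def by (rule continuous_on_vec_lambda)
qed

lemma continuous_matrix_vector: "continuous_on UNIV (\<lambda>v. (A :: 'a^'n^'n) *v v)"
  unfolding continuous_on_def
proof (intro ballI vec_tendstoI)
  fix v :: "'a^'n" and i
  have "((\<lambda>v. \<Sum>j\<in>UNIV. A $ i $ j * v $ j) \<longlongrightarrow> (\<Sum>j\<in>UNIV. A $ i $ j * v $ j)) (at v)"
    by (intro tendsto_sum_lcs[OF locally_convex] tendsto_mult_cia tendsto_const tendsto_vec_nth tendsto_ident_at) auto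
  then show "((\<lambda>v. (A *v v) $ i) \<longlongrightarrow> (A *v v) $ i) (at v)"
    by (simp add: matrix_vector_mult_def)
qed

subsection \<open>The module\<close>

lemma
  shows right_module: "right_module act" and p_idem: "p ** p = p"
    and theta_add: "\<theta> (s + t) = \<theta> s + \<theta> t" and theta_act: "\<theta> (act s a) = (\<chi> i. \<theta> s $ i * a)"
    and theta_homeo: "homeomorphic_map euclidean (top_of_set (range (\<lambda>x. p *v x))) \<theta>"
  using module unfolding fg_projective_via_def by blast+

lemma theta_inj: "\<theta> s = \<theta> t \<longleftrightarrow> s = t"
  using homeomorphic_imp_injective_map[OF theta_homeo] by (auto simp: inj_def)

lemma theta_range: "range \<theta> = range (\<lambda>x. p *v x)"
  using homeomorphic_imp_surjective_map[OF theta_homeo] by simp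

lemma p_theta: "p *v \<theta> s = \<theta> s"
proof -
  obtain x where "\<theta> s = p *v x" using theta_range by blast
  then show ?thesis by (simp add: matrix_vector_mul_assoc p_idem)
qed

definition theta_inv :: "'a^'n \<Rightarrow> 'e" where "theta_inv = inv_into UNIV \<theta>"

lemma theta_inv_theta [simp]: "theta_inv (\<theta> s) = s"
  unfolding theta_inv_def by (rule inv_into_f_f) (auto simp: inj_def theta_inj)

lemma theta_theta_inv: "p *v v = v \<Longrightarrow> \<theta> (theta_inv v) = v"
  unfolding theta_inv_def using theta_range by (intro f_inv_into_f) (metis rangeI)

lemma continuous_theta: "continuous_on UNIV \<theta>"
  using homeomorphic_imp_continuous_map[OF theta_homeo] by (simp add: continuous_map_in_subtopology)

lemma continuous_theta_inv: "continuous_on (range (\<lambda>x. p *v x)) theta_inv"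
proof -
  obtain f where f: "homeomorphic_maps euclidean (top_of_set (range (\<lambda>x. p *v x))) \<theta> f"
    using theta_homeo homeomorphic_map_maps by blast
  then have c: "continuous_map (top_of_set (range (\<lambda>x. p *v x))) euclidean f"
    and inv: "\<forall>s\<in>topspace euclidean. f (\<theta> s) = s"
    unfolding homeomorphic_maps_def by - (elim conjE, assumption)+
  from c have "continuous_on (range (\<lambda>x. p *v x)) f"
    unfolding continuous_map_iff_continuous .
  then show ?thesis
  proof (rule continuous_on_eq)
    fix v assume "v \<in> range (\<lambda>x. p *v x)"
    then obtain s where "v = \<theta> s" using theta_range by blast
    then show "f v = theta_inv v" using inv by simp
  qed
qed

lemma
  shows act_add_left: "act (s + t) a = act s a + act t a" and act_add_right: "act s (a + b) = act s a + act s b"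
    and act_mult: "act s (a * b) = act (act s a) b" and act_one: "act s 1 = s"
  using right_module unfolding right_module_def by blast+

lemma column_eq: "column j A = A *v axis j 1"
  for A :: "'a^'n^'n"
  by (simp add: vec_eq_iff column_def matrix_vector_mult_def axis_def if_distrib cong: if_cong)

definition generator :: "'n \<Rightarrow> 'e" where "generator j = theta_inv (column j p)"

lemma theta_generator: "\<theta> (generator j) = column j p"
  unfolding generator_def
  by (rule theta_theta_inv) (simp add: column_eq matrix_vector_mul_assoc p_idem)

lemma generator_expansion: "s = (\<Sum>j\<in>UNIV. act (generator j) (\<theta> s $ j))"
proof -
  have "\<theta> (\<Sum>j\<in>UNIV. act (generator j) (\<theta> s $ j)) = (\<Sum>j\<in>UNIV. \<theta> (act (generator j) (\<theta> s $ j)))"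
    by (rule additive_sum) (rule theta_add)
  also have "\<dots> = p *v \<theta> s"
    by (simp add: vec_eq_iff theta_act theta_generator column_def matrix_vector_mult_def)
  finally show ?thesis by (simp add: p_theta theta_inj)
qed

text \<open>The columns are the images of the generators. This depends on \<open>\<phi>\<close> alone, also for a map
  that is semilinear over some \<open>g\<close>.\<close>

definition matrix_of :: "('e \<Rightarrow> 'e) \<Rightarrow> 'a^'n^'n" where
  "matrix_of \<phi> = (\<chi> i j. \<theta> (\<phi> (generator j)) $ i)"

lemma column_matrix_of: "column j (matrix_of \<phi>) = \<theta> (\<phi> (generator j))"
  by (simp add: vec_eq_iff column_def matrix_of_def)

lemma matrix_eq_columns: "(\<And>j. column j A = column j B) \<Longrightarrow> A = B"
  for A B :: "'a^'n^'n"
  by (simp add: vec_eq_iff column_def)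

lemma column_mult: "column j (A ** B) = A *v column j B"
  for A B :: "'a^'n^'n"
  by (simp add: column_eq matrix_vector_mul_assoc)

lemma column_star: "column j (star g A) = sharp g (column j A)"
  by (simp add: vec_eq_iff column_def sharp_def)

lemma p_matrix_of: "p ** matrix_of \<phi> = matrix_of \<phi>"
  by (rule matrix_eq_columns) (simp add: column_mult column_matrix_of p_theta)

lemma matrix_of_id: "matrix_of (\<lambda>s. s) = p" "matrix_of id = p"
  by (rule matrix_eq_columns, simp add: column_matrix_of theta_generator)+

text \<open>This is the carrier of the extension group. That its elements are linear over the ground
  field follows from semilinearity, because automorphisms of the algebra fix the scalars.\<close>

definition semilinear_auts :: "(('e \<Rightarrow> 'e) \<times> 'g) set" where
  "semilinear_auts = {(\<phi>, g). g \<in> carrier G \<and> (\<forall>s t. \<phi> (s + t) = \<phi> s + \<phi> t) \<and>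
     (\<forall>s a. \<phi> (act s a) = act (\<phi> s) (\<mu> g a)) \<and> homeomorphic_map euclidean euclidean \<phi>}"

abbreviation Ghat :: "(('e \<Rightarrow> 'e) \<times> 'g) monoid" where "Ghat \<equiv> G_hat scaleK act G \<mu>"

lemma scale_module_vector_space: "vector_space (scale_module scaleK act)"
proof
  fix a b :: 'k and s t
  show "scale_module scaleK act a (s + t) = scale_module scaleK act a s + scale_module scaleK act a t"
    by (simp add: scale_module_def act_add_left)
  show "scale_module scaleK act (a + b) s = scale_module scaleK act a s + scale_module scaleK act b s"
    by (simp add: scale_module_def scale_left_distrib act_add_right)
  have "scaleK (a * b) 1 = scaleK b 1 * scaleK a 1"
    by (simp add: scaleK_mult_left scaleK_mult_right mult.commute)
  then show "scale_module scaleK act a (scale_module scaleK act b s) = scale_module scaleK act (a * b) s"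
    by (simp add: scale_module_def act_mult)
  show "scale_module scaleK act 1 s = s"
    by (simp add: scale_module_def act_one)
qed

lemma carrier_Ghat: "carrier Ghat = semilinear_auts"
proof -
  have "\<phi> \<in> carrier (GammaL scaleK act) \<longleftrightarrow> (\<forall>s t. \<phi> (s + t) = \<phi> s + \<phi> t) \<and> homeomorphic_map euclidean euclidean \<phi>"
    if g: "g \<in> carrier G" and sl: "\<And>s a. \<phi> (act s a) = act (\<phi> s) (\<mu> g a)" for \<phi> g
  proof -
    have "\<exists>\<psi>\<in>carrier (Aut_alg scaleK). \<forall>s a. \<phi> (act s a) = act (\<phi> s) (\<psi> a)"
      using mu_Aut[OF g] sl by blast
    moreover have "\<phi> (scale_module scaleK act c s) = scale_module scaleK act c (\<phi> s)" for c s
      by (simp add: scale_module_def sl mu_scaleK[OF g] mu_one[OF g])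
    ultimately show ?thesis
      by (auto simp: GammaL_def GL_K_def Vector_Spaces.linear_iff scale_module_vector_space)
  qed
  then show ?thesis
    unfolding G_hat_def semilinear_auts_def by auto
qed

lemma Ghat_cases:
  assumes "h \<in> carrier Ghat"
  obtains \<phi> g where "h = (\<phi>, g)" "(\<phi>, g) \<in> semilinear_auts"
proof -
  have "h = (fst h, snd h)" by simp
  moreover have "(fst h, snd h) \<in> semilinear_auts" using assms unfolding carrier_Ghat by simp
  ultimately show ?thesis by (rule that)
qed

lemma semilinear_autsD:
  assumes "(\<phi>, g) \<in> semilinear_auts"
  shows "g \<in> carrier G" "\<phi> (s + t) = \<phi> s + \<phi> t" "\<phi> (act s a) = act (\<phi> s) (\<mu> g a)"
    "homeomorphic_map euclidean euclidean \<phi>"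
  using assms unfolding semilinear_auts_def by blast+

lemma semilinear_autsI:
  assumes "g \<in> carrier G" "\<And>s t. \<phi> (s + t) = \<phi> s + \<phi> t" "\<And>s a. \<phi> (act s a) = act (\<phi> s) (\<mu> g a)"
    "homeomorphic_map euclidean euclidean \<phi>"
  shows "(\<phi>, g) \<in> semilinear_auts"
  using assms unfolding semilinear_auts_def by blast

lemma Ghat_mult: "(\<phi>, g) \<otimes>\<^bsub>Ghat\<^esub> (\<psi>, h) = (\<phi> \<circ> \<psi>, g \<otimes>\<^bsub>G\<^esub> h)"
  by (simp add: G_hat_def GammaL_def DirProd_def)

lemma Ghat_one: "\<one>\<^bsub>Ghat\<^esub> = (id, \<one>\<^bsub>G\<^esub>)"
  by (simp add: G_hat_def GammaL_def DirProd_def)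

lemma semilinear_auts_bij: "(\<phi>, g) \<in> semilinear_auts \<Longrightarrow> bij \<phi>"
  using homeomorphic_imp_injective_map[OF semilinear_autsD(4)] homeomorphic_imp_surjective_map[OF semilinear_autsD(4)]
  by (simp add: bij_def)

lemma semilinear_auts_compose:
  assumes "(\<phi>, g) \<in> semilinear_auts" "(\<psi>, h) \<in> semilinear_auts"
  shows "(\<phi> \<circ> \<psi>, g \<otimes>\<^bsub>G\<^esub> h) \<in> semilinear_auts"
  using semilinear_autsD[OF assms(1)] semilinear_autsD[OF assms(2)]
  by (intro semilinear_autsI) (auto simp: mu_compose intro: homeomorphic_map_compose)

lemma semilinear_auts_inverse:
  assumes "(\<phi>, g) \<in> semilinear_auts"
  shows "(inv_into UNIV \<phi>, inv\<^bsub>G\<^esub> g) \<in> semilinear_auts"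
proof (rule semilinear_autsI)
  note D = semilinear_autsD[OF assms] and bij = semilinear_auts_bij[OF assms]
  have inj: "\<phi> x = \<phi> y \<Longrightarrow> x = y" for x y using bij by (simp add: bij_def inj_def)
  have i: "\<phi> (inv_into UNIV \<phi> s) = s" for s using bij by (simp add: bij_def surj_f_inv_f)
  show "inv\<^bsub>G\<^esub> g \<in> carrier G" using D(1) by simp
  show "inv_into UNIV \<phi> (s + t) = inv_into UNIV \<phi> s + inv_into UNIV \<phi> t" for s t
    by (rule inj) (simp add: D(2) i)
  have "\<mu> g (\<mu> (inv\<^bsub>G\<^esub> g) a) = a" for a
    using D(1) by (simp add: mu_unit flip: mu_compose)
  then show "inv_into UNIV \<phi> (act s a) = act (inv_into UNIV \<phi> s) (\<mu> (inv\<^bsub>G\<^esub> g) a)" for s a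
    by - (rule inj, simp add: D(3) i)
  obtain \<psi> where \<psi>: "homeomorphic_maps euclidean euclidean \<phi> \<psi>"
    using D(4) homeomorphic_map_maps by blast
  then have "\<psi> = inv_into UNIV \<phi>"
    unfolding homeomorphic_maps_def by - (rule ext, rule inj, simp add: i)
  then show "homeomorphic_map euclidean euclidean (inv_into UNIV \<phi>)"
    using \<psi> homeomorphic_maps_sym homeomorphic_map_maps by metis
qed

lemma group_Ghat: "group Ghat"
proof (rule groupI)
  show "x \<otimes>\<^bsub>Ghat\<^esub> y \<in> carrier Ghat" if "x \<in> carrier Ghat" "y \<in> carrier Ghat" for x y
    using that semilinear_auts_compose unfolding carrier_Ghat by (cases x; cases y) (simp add: Ghat_mult)
  show "\<one>\<^bsub>Ghat\<^esub> \<in> carrier Ghat"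
    unfolding carrier_Ghat Ghat_one by (rule semilinear_autsI) (simp_all add: mu_unit)
  show "x \<otimes>\<^bsub>Ghat\<^esub> y \<otimes>\<^bsub>Ghat\<^esub> z = x \<otimes>\<^bsub>Ghat\<^esub> (y \<otimes>\<^bsub>Ghat\<^esub> z)"
    if "x \<in> carrier Ghat" "y \<in> carrier Ghat" "z \<in> carrier Ghat" for x y z
    using that semilinear_autsD(1) unfolding carrier_Ghat
    by (cases x; cases y; cases z) (auto simp: Ghat_mult o_assoc intro: G.m_assoc)
  show "\<one>\<^bsub>Ghat\<^esub> \<otimes>\<^bsub>Ghat\<^esub> x = x" if "x \<in> carrier Ghat" for x
    using that semilinear_autsD(1) unfolding carrier_Ghat Ghat_one by (cases x) (simp add: Ghat_mult)
  show "\<exists>y\<in>carrier Ghat. y \<otimes>\<^bsub>Ghat\<^esub> x = \<one>\<^bsub>Ghat\<^esub>" if "x \<in> carrier Ghat" for x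
  proof -
    from that obtain \<phi> g where x: "x = (\<phi>, g)" "(\<phi>, g) \<in> semilinear_auts" by (rule Ghat_cases)
    have "inv_into UNIV \<phi> \<circ> \<phi> = id"
      using semilinear_auts_bij[OF x(2)] by (simp add: bij_def)
    then have "(inv_into UNIV \<phi>, inv\<^bsub>G\<^esub> g) \<otimes>\<^bsub>Ghat\<^esub> x = \<one>\<^bsub>Ghat\<^esub>"
      unfolding x(1) Ghat_one Ghat_mult using G.l_inv[OF semilinear_autsD(1)[OF x(2)]] by simp
    then show ?thesis
      using semilinear_auts_inverse[OF x(2)] unfolding carrier_Ghat by (rule bexI)
  qed
qed

sublocale Gh: group Ghat by (rule group_Ghat)

lemma Ghat_snd: "h \<in> carrier Ghat \<Longrightarrow> snd h \<in> carrier G"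
  using semilinear_autsD(1) carrier_Ghat by (cases h) auto

lemma Ghat_snd_mult: "snd (x \<otimes>\<^bsub>Ghat\<^esub> y) = snd x \<otimes>\<^bsub>G\<^esub> snd y"
  by (cases x; cases y) (simp add: Ghat_mult)

lemma snd_hom: "snd \<in> hom Ghat G"
  by (rule homI) (simp_all add: Ghat_snd Ghat_snd_mult)

lemma Ghat_snd_inv: "h \<in> carrier Ghat \<Longrightarrow> snd (inv\<^bsub>Ghat\<^esub> h) = inv\<^bsub>G\<^esub> (snd h)"
  using group_hom.hom_inv[of Ghat G snd h] snd_hom group_Ghat G.group_axioms
  by (simp add: group_hom_def group_hom_axioms_def)

abbreviation Mat :: "('e \<Rightarrow> 'e) \<times> 'g \<Rightarrow> 'a^'n^'n" where "Mat h \<equiv> matrix_of (fst h)"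

text \<open>Expand \<open>s\<close> in the generators.\<close>

lemma theta_semilinear:
  assumes "h \<in> carrier Ghat"
  shows "\<theta> (fst h s) = Mat h *v sharp (snd h) (\<theta> s)"
proof -
  obtain \<phi> g where h: "h = (\<phi>, g)" "(\<phi>, g) \<in> semilinear_auts" using assms by (rule Ghat_cases)
  note D = semilinear_autsD[OF h(2)]
  have "\<phi> s = \<phi> (\<Sum>j\<in>UNIV. act (generator j) (\<theta> s $ j))"
    by (subst generator_expansion[of s]) (rule refl)
  also have "\<dots> = (\<Sum>j\<in>UNIV. act (\<phi> (generator j)) (\<mu> g (\<theta> s $ j)))"
    by (simp add: additive_sum[of \<phi>, OF D(2)] D(3))
  finally have "\<theta> (\<phi> s) = (\<Sum>j\<in>UNIV. \<theta> (act (\<phi> (generator j)) (\<mu> g (\<theta> s $ j))))"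
    by (simp add: additive_sum[of \<theta>, OF theta_add])
  also have "\<dots> = matrix_of \<phi> *v sharp g (\<theta> s)"
    by (simp add: vec_eq_iff theta_act matrix_of_def matrix_vector_mult_def sharp_def)
  finally show ?thesis by (simp add: h(1))
qed

lemma mat_mult:
  assumes "x \<in> carrier Ghat" "y \<in> carrier Ghat"
  shows "Mat (x \<otimes>\<^bsub>Ghat\<^esub> y) = Mat x ** star (snd x) (Mat y)"
proof (rule matrix_eq_columns)
  fix j
  have "fst (x \<otimes>\<^bsub>Ghat\<^esub> y) = fst x \<circ> fst y" by (cases x; cases y) (simp add: Ghat_mult)
  then show "column j (Mat (x \<otimes>\<^bsub>Ghat\<^esub> y)) = column j (Mat x ** star (snd x) (Mat y))"
    by (simp add: column_matrix_of column_mult column_star theta_semilinear[OF assms(1)])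
qed

lemma mat_one: "Mat \<one>\<^bsub>Ghat\<^esub> = p"
  by (simp add: Ghat_one matrix_of_id)

lemma mat_star_p:
  assumes "h \<in> carrier Ghat"
  shows "Mat h ** star (snd h) p = Mat h"
  using mat_mult[OF assms Gh.one_closed] assms by (simp add: mat_one)

lemma Ghat_eqI:
  assumes "x \<in> carrier Ghat" "y \<in> carrier Ghat" "Mat x = Mat y" "snd x = snd y"
  shows "x = y"
proof -
  have "fst x s = fst y s" for s
    using theta_semilinear[OF assms(1), of s] theta_semilinear[OF assms(2), of s] assms(3,4)
    by (simp add: theta_inj flip: theta_inj)
  then show ?thesis using assms(4) by (intro prod_eqI) auto
qed

text \<open>The counterpart \<open>Y\<close> of the matrix \<open>X\<close> of \<open>h\<close>: as a matrix it is not the matrix of the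
  inverse of \<open>h\<close>, which lies over the inverse group element, but its translate back by \<open>g\<close>.\<close>

definition co_mat :: "('e \<Rightarrow> 'e) \<times> 'g \<Rightarrow> 'a^'n^'n" where
  "co_mat h = star (snd h) (Mat (inv\<^bsub>Ghat\<^esub> h))"

lemma
  assumes h: "h \<in> carrier Ghat"
  shows mat_co_mat: "Mat h ** co_mat h = p" and co_mat_mat: "co_mat h ** Mat h = star (snd h) p"
    and star_p_co_mat: "star (snd h) p ** co_mat h = co_mat h" and co_mat_p: "co_mat h ** p = co_mat h"
proof -
  note g = Ghat_snd[OF h]
  show "Mat h ** co_mat h = p"
    using mat_mult[OF h Gh.inv_closed[OF h]] h by (simp add: mat_one co_mat_def)
  have "Mat (inv\<^bsub>Ghat\<^esub> h) ** star (inv\<^bsub>G\<^esub> (snd h)) (Mat h) = p"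
    using mat_mult[OF Gh.inv_closed[OF h] h] h by (simp add: mat_one Ghat_snd_inv)
  from arg_cong[OF this, of "star (snd h)"]
  show "co_mat h ** Mat h = star (snd h) p"
    by (simp add: star_mult[OF g] star_inv[OF g] co_mat_def)
  show "star (snd h) p ** co_mat h = co_mat h"
    by (simp add: co_mat_def p_matrix_of flip: star_mult[OF g])
  from arg_cong[OF mat_star_p[OF Gh.inv_closed[OF h]], of "star (snd h)"]
  show "co_mat h ** p = co_mat h"
    by (simp add: star_mult[OF g] star_inv[OF g] co_mat_def Ghat_snd_inv[OF h])
qed

lemma mat_inv: "h \<in> carrier Ghat \<Longrightarrow> Mat (inv\<^bsub>Ghat\<^esub> h) = star (inv\<^bsub>G\<^esub> (snd h)) (co_mat h)"
  by (simp add: co_mat_def star_inv Ghat_snd)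

text \<open>The element over \<open>g\<close> with the matrix \<open>X\<close>.\<close>

definition of_mat :: "'a^'n^'n \<Rightarrow> 'g \<Rightarrow> ('e \<Rightarrow> 'e) \<times> 'g" where
  "of_mat X g = (\<lambda>s. theta_inv (X *v sharp g (\<theta> s)), g)"

lemma vector_act: "A *v (\<chi> i. v $ i * a) = (\<chi> i. (A *v v) $ i * a)" for A :: "'a^'n^'n"
  by (simp add: vec_eq_iff matrix_vector_mult_def sum_distrib_right mult.assoc)

lemma
  assumes g: "g \<in> carrier G" and X: "p ** X = X" "X ** star g p = X"
    and Y: "star g p ** Y = Y" and XY: "X ** Y = p" "Y ** X = star g p"
  shows of_mat_in: "of_mat X g \<in> carrier Ghat" and mat_of_mat: "Mat (of_mat X g) = X"
proof -
  define \<phi> where "\<phi> = (\<lambda>s. theta_inv (X *v sharp g (\<theta> s)))"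
  define \<psi> where "\<psi> = (\<lambda>s. theta_inv (sharp (inv\<^bsub>G\<^esub> g) (Y *v \<theta> s)))"
  have g': "inv\<^bsub>G\<^esub> g \<in> carrier G" using g by simp
  have p\<phi>: "p *v (X *v v) = X *v v" for v by (simp add: matrix_vector_mul_assoc X)
  have \<theta>\<phi>: "\<theta> (\<phi> s) = X *v sharp g (\<theta> s)" for s
    unfolding \<phi>_def by (rule theta_theta_inv[OF p\<phi>])
  have p\<psi>: "p *v sharp (inv\<^bsub>G\<^esub> g) (Y *v v) = sharp (inv\<^bsub>G\<^esub> g) (Y *v v)" for v
  proof -
    have "p *v sharp (inv\<^bsub>G\<^esub> g) (Y *v v) = star (inv\<^bsub>G\<^esub> g) (star g p) *v sharp (inv\<^bsub>G\<^esub> g) (Y *v v)"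
      by (simp add: star_inv[OF g])
    also have "\<dots> = sharp (inv\<^bsub>G\<^esub> g) (star g p *v (Y *v v))"
      by (simp add: sharp_mult[OF g'])
    finally show ?thesis by (simp add: matrix_vector_mul_assoc Y)
  qed
  have \<theta>\<psi>: "\<theta> (\<psi> s) = sharp (inv\<^bsub>G\<^esub> g) (Y *v \<theta> s)" for s
    unfolding \<psi>_def by (rule theta_theta_inv[OF p\<psi>])
  have "(\<phi>, g) \<in> semilinear_auts"
  proof (rule semilinear_autsI[OF g])
    show "\<phi> (s + t) = \<phi> s + \<phi> t" for s t
      by (simp add: theta_inj[symmetric] \<theta>\<phi> theta_add sharp_add[OF g] matrix_vector_right_distrib)
    have "sharp g (\<chi> i. \<theta> s $ i * a) = (\<chi> i. sharp g (\<theta> s) $ i * \<mu> g a)" for s a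
      by (simp add: sharp_def vec_eq_iff mu_mult[OF g])
    then show "\<phi> (act s a) = act (\<phi> s) (\<mu> g a)" for s a
      by (simp add: theta_inj[symmetric] \<theta>\<phi> theta_act vector_act)
    have c1: "continuous_on UNIV \<phi>"
      unfolding \<phi>_def
    proof (rule continuous_on_compose2[OF continuous_theta_inv])
      show "continuous_on UNIV (\<lambda>s. X *v sharp g (\<theta> s))"
        by (intro continuous_on_compose2[OF continuous_matrix_vector] continuous_on_compose2[OF continuous_sharp[OF g]]
            continuous_theta) simp_all
      show "range (\<lambda>s. X *v sharp g (\<theta> s)) \<subseteq> range ((*v) p)" using p\<phi> by (metis image_subsetI rangeI)
    qed
    have c2: "continuous_on UNIV \<psi>"
      unfolding \<psi>_def
    proof (rule continuous_on_compose2[OF continuous_theta_inv])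
      show "continuous_on UNIV (\<lambda>s. sharp (inv\<^bsub>G\<^esub> g) (Y *v \<theta> s))"
        by (intro continuous_on_compose2[OF continuous_sharp[OF g']] continuous_on_compose2[OF continuous_matrix_vector]
            continuous_theta) simp_all
      show "range (\<lambda>s. sharp (inv\<^bsub>G\<^esub> g) (Y *v \<theta> s)) \<subseteq> range ((*v) p)" using p\<psi> by (metis image_subsetI rangeI)
    qed
    have "\<psi> (\<phi> s) = s" for s
    proof -
      have "\<theta> (\<psi> (\<phi> s)) = sharp (inv\<^bsub>G\<^esub> g) (star g p *v sharp g (\<theta> s))"
        by (simp add: \<theta>\<psi> \<theta>\<phi> matrix_vector_mul_assoc XY)
      also have "\<dots> = \<theta> s"
        by (simp add: sharp_inv[OF g] p_theta flip: sharp_mult[OF g])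
      finally show ?thesis by (simp add: theta_inj)
    qed
    moreover have "\<phi> (\<psi> s) = s" for s
      by (simp add: theta_inj[symmetric] \<theta>\<psi> \<theta>\<phi> sharp_inv[OF g] matrix_vector_mul_assoc XY p_theta)
    ultimately have "homeomorphic_maps euclidean euclidean \<phi> \<psi>"
      unfolding homeomorphic_maps_def using c1 c2 by simp
    then show "homeomorphic_map euclidean euclidean \<phi>" using homeomorphic_map_maps by blast
  qed
  then show "of_mat X g \<in> carrier Ghat"
    unfolding carrier_Ghat of_mat_def \<phi>_def .
  have "Mat (of_mat X g) = matrix_of \<phi>" by (simp add: of_mat_def \<phi>_def)
  also have "\<dots> = X"
  proof (rule matrix_eq_columns)
    fix j
    have "column j (matrix_of \<phi>) = column j (X ** star g p)"
      by (simp add: column_matrix_of \<theta>\<phi> theta_generator column_mult column_star)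
    then show "column j (matrix_of \<phi>) = column j X" by (simp add: X)
  qed
  finally show "Mat (of_mat X g) = X" .
qed

lemma snd_of_mat [simp]: "snd (of_mat X g) = g"
  by (simp add: of_mat_def)

subsection \<open>The linear automorphisms\<close>

lemma theta_end_of_matrix: "x \<in> corner p \<Longrightarrow> \<theta> (end_of_matrix \<theta> x s) = x *v \<theta> s"
proof -
  assume "x \<in> corner p"
  then obtain y where "x = p ** y ** p" by (auto simp: corner_def)
  then have "p *v (x *v \<theta> s) = x *v \<theta> s" by (simp add: matrix_vector_mul_assoc matrix_mul_assoc p_idem)
  then show ?thesis unfolding end_of_matrix_def using theta_theta_inv by (simp add: theta_inv_def)
qed

lemma corner_iff: "x \<in> corner p \<longleftrightarrow> p ** x = x \<and> x ** p = x"
proof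
  assume "x \<in> corner p"
  then obtain y where "x = p ** y ** p" by (auto simp: corner_def)
  then show "p ** x = x \<and> x ** p = x"
    by (metis matrix_mul_assoc p_idem)
next
  assume "p ** x = x \<and> x ** p = x"
  then have "x = p ** x ** p" by simp
  then show "x \<in> corner p" unfolding corner_def by blast
qed

text \<open>Linear automorphisms are the semilinear ones over the unit of \<open>G\<close>.\<close>

lemma Units_End_mod: "\<phi> \<in> Units (End_mod act) \<longleftrightarrow> (\<phi>, \<one>\<^bsub>G\<^esub>) \<in> carrier Ghat"
proof
  assume "\<phi> \<in> Units (End_mod act)"
  then obtain \<psi> where \<phi>: "\<phi> \<in> carrier (End_mod act)" and \<psi>: "\<psi> \<in> carrier (End_mod act)"
    and i: "\<psi> \<circ> \<phi> = id" "\<phi> \<circ> \<psi> = id"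
    unfolding Units_def by (auto simp: End_mod_def)
  have "homeomorphic_maps euclidean euclidean \<phi> \<psi>"
    using \<phi> \<psi> i unfolding homeomorphic_maps_def End_mod_def by (simp add: fun_eq_iff)
  then have "homeomorphic_map euclidean euclidean \<phi>" using homeomorphic_map_maps by blast
  then show "(\<phi>, \<one>\<^bsub>G\<^esub>) \<in> carrier Ghat"
    unfolding carrier_Ghat using \<phi> by (intro semilinear_autsI) (auto simp: End_mod_def mu_unit)
next
  assume h: "(\<phi>, \<one>\<^bsub>G\<^esub>) \<in> carrier Ghat"
  have End: "\<phi> \<in> carrier (End_mod act)" if "(\<phi>, \<one>\<^bsub>G\<^esub>) \<in> semilinear_auts" for \<phi>
    using semilinear_autsD[OF that] homeomorphic_imp_continuous_map[of euclidean euclidean \<phi>]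
    by (auto simp: End_mod_def mu_unit)
  have \<psi>: "(inv_into UNIV \<phi>, \<one>\<^bsub>G\<^esub>) \<in> semilinear_auts"
    using semilinear_auts_inverse[of \<phi> "\<one>\<^bsub>G\<^esub>"] h carrier_Ghat by simp
  have "inv_into UNIV \<phi> \<circ> \<phi> = id" "\<phi> \<circ> inv_into UNIV \<phi> = id"
    using semilinear_auts_bij[of \<phi> "\<one>\<^bsub>G\<^esub>"] h carrier_Ghat
    by (simp_all add: bij_def surj_iff)
  then show "\<phi> \<in> Units (End_mod act)"
    unfolding Units_def using End[OF \<psi>] End[of \<phi>] h carrier_Ghat
    by (auto simp: End_mod_def intro!: bexI[of _ "inv_into UNIV \<phi>"])
qed

lemma carrier_GL: "carrier (GL_mod act) = {\<phi>. (\<phi>, \<one>\<^bsub>G\<^esub>) \<in> carrier Ghat}"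
  using Units_End_mod by (auto simp: GL_mod_def units_of_def)

lemma GL_mult: "\<phi> \<otimes>\<^bsub>GL_mod act\<^esub> \<psi> = \<phi> \<circ> \<psi>"
  by (simp add: GL_mod_def units_of_def End_mod_def)

lemma GL_one: "\<one>\<^bsub>GL_mod act\<^esub> = id"
  by (simp add: GL_mod_def units_of_def End_mod_def)

lemma monoid_End_mod: "monoid (End_mod act)"
  by (rule monoidI) (auto simp: End_mod_def o_assoc intro: continuous_on_compose2[where t = UNIV])

lemma group_GL: "group (GL_mod act)"
  unfolding GL_mod_def by (rule monoid.units_group[OF monoid_End_mod])

abbreviation \<iota> :: "('e \<Rightarrow> 'e) \<Rightarrow> ('e \<Rightarrow> 'e) \<times> 'g" where "\<iota> \<phi> \<equiv> (\<phi>, \<one>\<^bsub>G\<^esub>)"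

lemma iota_hom: "\<iota> \<in> hom (GL_mod act) Ghat"
  by (rule homI) (simp_all add: carrier_GL GL_mult Ghat_mult)

lemma GL_inv: "\<phi> \<in> carrier (GL_mod act) \<Longrightarrow> \<iota> (inv\<^bsub>GL_mod act\<^esub> \<phi>) = inv\<^bsub>Ghat\<^esub> (\<iota> \<phi>)"
  using group_hom.hom_inv[of "GL_mod act" Ghat \<iota> \<phi>] iota_hom group_Ghat group_GL
  by (simp add: group_hom_def group_hom_axioms_def)

lemma kernel_snd: "\<iota> ` carrier (GL_mod act) = kernel Ghat G snd"
  by (auto simp: carrier_GL kernel_def)

text \<open>This is the hypothesis that every automorphism \<open>\<mu> g\<close> lifts to the module.\<close>

lemma snd_surj: "snd ` carrier Ghat = carrier G"
proof
  show "snd ` carrier Ghat \<subseteq> carrier G" using Ghat_snd by blast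
  show "carrier G \<subseteq> snd ` carrier Ghat"
  proof
    fix g assume g: "g \<in> carrier G"
    then have "\<mu> g \<in> Aut_alg_mod scaleK act" using liftable by blast
    then obtain \<phi> where \<phi>: "\<phi> \<in> GL_K scaleK act" "\<forall>s a. \<phi> (act s a) = act (\<phi> s) (\<mu> g a)"
      unfolding Aut_alg_mod_def by blast
    then have "(\<phi>, g) \<in> carrier Ghat"
      unfolding carrier_Ghat using g by (intro semilinear_autsI) (auto simp: GL_K_def Vector_Spaces.linear_iff)
    then show "g \<in> snd ` carrier Ghat" by force
  qed
qed

definition kappa :: "('e \<Rightarrow> 'e) \<Rightarrow> 'a^'n^'n" where "kappa = inv_into (corner p) (end_of_matrix \<theta>)"

text \<open>So the chart of the linear automorphisms is the restriction of the matrix representation.\<close>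

lemma kappa_eq:
  assumes "\<phi> \<in> carrier (GL_mod act)"
  shows "kappa \<phi> = matrix_of \<phi>" and "matrix_of \<phi> \<in> corner p"
proof -
  have h: "\<iota> \<phi> \<in> carrier Ghat" using assms carrier_GL by simp
  show c: "matrix_of \<phi> \<in> corner p"
    using mat_star_p[OF h] p_matrix_of by (simp add: corner_iff star_unit)
  show "kappa \<phi> = matrix_of \<phi>"
    unfolding kappa_def
  proof (rule inv_into_f_eq[OF _ c])
    show "inj_on (end_of_matrix \<theta>) (corner p)"
    proof (rule inj_onI)
      fix x y assume xy: "x \<in> corner p" "y \<in> corner p" "end_of_matrix \<theta> x = end_of_matrix \<theta> y"
      have "x *v \<theta> s = y *v \<theta> s" for s
        using theta_end_of_matrix[OF xy(1), of s] theta_end_of_matrix[OF xy(2), of s] xy(3) by simp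
      then have "column j (x ** p) = column j (y ** p)" for j
        unfolding column_mult theta_generator[symmetric] by simp
      then show "x = y" using matrix_eq_columns xy(1,2) by (metis corner_iff)
    qed
    show "end_of_matrix \<theta> (matrix_of \<phi>) = \<phi>"
    proof
      fix s show "end_of_matrix \<theta> (matrix_of \<phi>) s = \<phi> s"
        using theta_end_of_matrix[OF c, of s] theta_semilinear[OF h, of s]
        by (simp add: sharp_unit flip: theta_inj)
    qed
  qed
qed

end

section \<open>The Lie group extension\<close>

lemma prod_vector_manifold:
  "prod_manifold (vector_manifold V) (vector_manifold W) = vector_manifold (V \<times> W)"
  unfolding prod_manifold_def vector_manifold_def by (auto simp: map_prod.id)

lemma smooth_map_binary:
  fixes F :: "'u::{real_vector,t2_space} \<times> 'v::{real_vector,t2_space} \<Rightarrow> 'w::{real_vector,t2_space}"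
  assumes lcs: "locally_convex_space (UNIV :: 'u set)" "locally_convex_space (UNIV :: 'v set)"
      "locally_convex_space (UNIV :: 'w set)"
    and F: "smooth_on UNIV UNIV UNIV F" and N: "smooth_manifold N"
    and f: "smooth_map N (vector_manifold UNIV) f" and g: "smooth_map N (vector_manifold UNIV) g"
  shows "smooth_map N (vector_manifold UNIV) (\<lambda>x. F (f x, g x))"
proof -
  note UV = locally_convex_space_Times[OF lcs(1,2), simplified]
  have fg: "smooth_map N (vector_manifold UNIV) (\<lambda>x. (f x, g x))"
    using smooth_map_Pair[OF N smooth_manifold_vector_manifold[OF lcs(1)] smooth_manifold_vector_manifold[OF lcs(2)] f g]
    by (simp add: prod_vector_manifold)
  have "smooth_map (vector_manifold UNIV) (vector_manifold UNIV) F"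
    using F by (simp add: smooth_on_iff_smooth_map_self[OF UV lcs(3)])
  from smooth_map_compose[OF N smooth_manifold_vector_manifold[OF UV] smooth_manifold_vector_manifold[OF lcs(3)] fg this]
  show ?thesis .
qed

lemma smooth_map_linear:
  fixes L :: "'u::{real_vector,t2_space} \<Rightarrow> 'w::{real_vector,t2_space}"
  assumes lcs: "locally_convex_space (UNIV :: 'u set)" "locally_convex_space (UNIV :: 'w set)"
    and L: "\<And>x y. L (x + y) = L x + L y" "\<And>r x. L (r *\<^sub>R x) = r *\<^sub>R L x" "continuous_on UNIV L"
    and N: "smooth_manifold N" and f: "smooth_map N (vector_manifold UNIV) f"
  shows "smooth_map N (vector_manifold UNIV) (\<lambda>x. L (f x))"
proof -
  have "smooth_on UNIV UNIV UNIV L"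
    by (rule smooth_on_linear[OF lcs]) (use L in auto)
  then have "smooth_map (vector_manifold UNIV) (vector_manifold UNIV) L"
    by (simp add: smooth_on_iff_smooth_map_self[OF lcs])
  from smooth_map_compose[OF N smooth_manifold_vector_manifold[OF lcs(1)] smooth_manifold_vector_manifold[OF lcs(2)] f this]
  show ?thesis .
qed

lemma smooth_map_add_diff:
  fixes f g :: "'x \<Rightarrow> 'u::{real_vector,t2_space}"
  assumes lcs: "locally_convex_space (UNIV :: 'u set)" and N: "smooth_manifold N"
    and f: "smooth_map N (vector_manifold UNIV) f" and g: "smooth_map N (vector_manifold UNIV) g"
  shows "smooth_map N (vector_manifold UNIV) (\<lambda>x. f x + g x)"
    and "smooth_map N (vector_manifold UNIV) (\<lambda>x. f x - g x)"
proof -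
  note UV = locally_convex_space_Times[OF lcs lcs, simplified]
  have c: "continuous_on UNIV (\<lambda>z :: 'u \<times> 'u. fst z + snd z)" "continuous_on UNIV (\<lambda>z :: 'u \<times> 'u. fst z - snd z)"
    unfolding continuous_on_def
    by (intro ballI tendsto_add_lcs[OF lcs] tendsto_diff_lcs[OF lcs] tendsto_fst tendsto_snd tendsto_ident_at; simp)+
  have "smooth_on UNIV UNIV UNIV (\<lambda>z :: 'u \<times> 'u. fst z + snd z)" "smooth_on UNIV UNIV UNIV (\<lambda>z :: 'u \<times> 'u. fst z - snd z)"
    by (rule smooth_on_linear[OF UV lcs]; use c in \<open>simp add: algebra_simps\<close>)+
  from smooth_map_binary[OF lcs lcs lcs this(1) N f g] smooth_map_binary[OF lcs lcs lcs this(2) N f g]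
  show "smooth_map N (vector_manifold UNIV) (\<lambda>x. f x + g x)"
    and "smooth_map N (vector_manifold UNIV) (\<lambda>x. f x - g x)" by simp_all
qed

lemma subspace_corner:
  fixes p :: "'a::real_algebra_1^'n^'n"
  assumes "p ** p = p"
  shows "subspace (corner p)"
proof -
  have "linear (\<lambda>x. p ** x ** p)"
    by (rule linearI) (simp_all add: matrix_mult_add matrix_mult_scaleR)
  then show ?thesis
    unfolding corner_def by (rule linear_subspace_image) (rule subspace_UNIV)
qed

text \<open>The matrix intertwines the two idempotents, whether or not it is invertible.\<close>

lemma idempotent_pair:
  fixes P Q :: "'a::ring_1^'n^'n"
  assumes "P ** P = P" "Q ** Q = Q"
  shows "(P ** Q + (mat 1 - P) ** (mat 1 - Q)) ** Q = P ** Q"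
    and "P ** (P ** Q + (mat 1 - P) ** (mat 1 - Q)) = P ** Q"
proof -
  have z: "(mat 1 - Q) ** Q = 0" "P ** (mat 1 - P) = 0" by (simp_all add: matrix_mult_add assms)
  have "(P ** Q + (mat 1 - P) ** (mat 1 - Q)) ** Q = P ** (Q ** Q) + (mat 1 - P) ** ((mat 1 - Q) ** Q)"
    by (simp only: matrix_mult_add(2) matrix_mul_assoc)
  then show "(P ** Q + (mat 1 - P) ** (mat 1 - Q)) ** Q = P ** Q"
    by (simp only: z assms matrix_mult_add(7)) simp
  have "P ** (P ** Q + (mat 1 - P) ** (mat 1 - Q)) = (P ** P) ** Q + (P ** (mat 1 - P)) ** (mat 1 - Q)"
    by (simp only: matrix_mult_add(1) matrix_mul_assoc)
  then show "P ** (P ** Q + (mat 1 - P) ** (mat 1 - Q)) = P ** Q"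
    by (simp only: z assms matrix_mult_add(8)) simp
qed

lemma diffeomorphismI:
  assumes N: "smooth_manifold N" and f: "smooth_map M N f" and g: "smooth_map N M g"
    and gf: "\<And>x. x \<in> topspace (mtop M) \<Longrightarrow> g (f x) = x" and fg: "\<And>y. y \<in> topspace (mtop N) \<Longrightarrow> f (g y) = y"
  shows "diffeomorphism M N f"
  unfolding diffeomorphism_def
proof (intro conjI f)
  show bij: "bij_betw f (topspace (mtop M)) (topspace (mtop N))"
    by (rule bij_betw_byWitness[of _ g]) (use gf fg smooth_map_in[OF f] smooth_map_in[OF g] in auto)
  show "smooth_map N M (inv_into (topspace (mtop M)) f)"
  proof (rule smooth_map_cong[OF N g])
    fix y assume y: "y \<in> topspace (mtop N)"
    show "g y = inv_into (topspace (mtop M)) f y"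
      by (rule inv_into_f_eq[symmetric, OF bij_betw_imp_inj_on[OF bij] smooth_map_in[OF g y] fg[OF y]])
  qed
qed

context projective_module
begin

abbreviation VM :: "('a^'n^'n, 'a^'n^'n) manifold" where "VM \<equiv> vector_manifold UNIV"

lemma MG: "smooth_manifold MG" "topspace (mtop MG) = carrier G"
    "smooth_map (prod_manifold MG MG) MG (\<lambda>(x, y). x \<otimes>\<^bsub>G\<^esub> y)" "smooth_map MG MG (m_inv G)"
  using lie_group_G unfolding lie_group_def by blast+

lemma VM: "smooth_manifold VM"
  by (rule smooth_manifold_vector_manifold[OF lcs_matrix])

lemma smooth_matrix_mult:
  assumes "smooth_manifold N" "smooth_map N VM f" "smooth_map N VM g"
  shows "smooth_map N VM (\<lambda>x. f x ** g x)"
  using smooth_map_binary[OF lcs_matrix lcs_matrix lcs_matrix smooth_on_matrix_mult assms] by simp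

lemma smooth_matrix_const: "smooth_manifold N \<Longrightarrow> smooth_map N VM (\<lambda>_. A)"
  by (rule smooth_map_const[OF _ VM]) simp_all

lemmas smooth_matrix_add = smooth_map_add_diff(1)[OF lcs_matrix]
lemmas smooth_matrix_diff = smooth_map_add_diff(2)[OF lcs_matrix]

lemma smooth_matrix_inv:
  assumes N: "smooth_manifold N" and f: "smooth_map N VM f"
    and inv: "\<And>x. x \<in> topspace (mtop N) \<Longrightarrow> invertible (f x)"
  shows "smooth_map N VM (\<lambda>x. matrix_inv (f x))"
proof -
  let ?U = "{A :: 'a^'n^'n. invertible A}"
  have U: "openin (top_of_set UNIV) ?U" using open_invertible by simp
  have "smooth_map N (open_submanifold VM ?U) f"
    using f inv by (auto simp: smooth_map_into_open_submanifold[OF N VM])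
  moreover have "smooth_map (open_submanifold VM ?U) VM matrix_inv"
    using smooth_on_matrix_inv by (simp add: smooth_on_iff_smooth_map[OF lcs_matrix U lcs_matrix])
  moreover have "smooth_manifold (open_submanifold VM ?U)"
    by (rule smooth_manifold_open_submanifold[OF VM]) (use U in simp)
  ultimately show ?thesis using smooth_map_compose[OF N _ VM] by blast
qed

lemma smooth_star:
  assumes N: "smooth_manifold N" and q: "smooth_map N MG q" and f: "smooth_map N VM f"
  shows "smooth_map N VM (\<lambda>x. star (q x) (f x))"
proof (intro smooth_map_vec[OF N] locally_convex lcs_matrix locally_convex_space_vec)
  fix i j
  note VA = smooth_manifold_vector_manifold[OF locally_convex]
  have "continuous_on UNIV (\<lambda>A :: 'a^'n^'n. A $ i $ j)"
    by (intro continuous_on_component continuous_on_id)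
  then have e: "smooth_map N (vector_manifold UNIV) (\<lambda>x. f x $ i $ j)"
    by (intro smooth_map_linear[OF lcs_matrix locally_convex _ _ _ N f, of "\<lambda>A. A $ i $ j"]) simp_all
  have "smooth_map (prod_manifold MG (vector_manifold UNIV)) (vector_manifold UNIV) (\<lambda>(g, a). \<mu> g a)"
    using action unfolding smooth_action_def by (elim conjE)
  from smooth_map_compose[OF N smooth_manifold_prod_manifold[OF MG(1) VA] VA smooth_map_Pair[OF N MG(1) VA q e] this]
  show "smooth_map N (vector_manifold UNIV) (\<lambda>x. star (q x) (f x) $ i $ j)"
    by simp
qed

lemma lcs_corner: "locally_convex_space (corner p)"
  by (rule locally_convex_space_subset[OF lcs_matrix subspace_corner[OF p_idem]]) simp

lemma vector_corner: "smooth_manifold (vector_manifold (corner p))"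
  by (rule smooth_manifold_vector_manifold[OF lcs_corner])

lemma continuous_compress: "continuous_on UNIV (\<lambda>x. p ** x ** p)"
  unfolding continuous_on_def
  by (intro ballI tendsto_matrix_mult tendsto_const tendsto_ident_at)

lemma smooth_into_corner:
  assumes N: "smooth_manifold N"
  shows "smooth_map N (vector_manifold (corner p)) f \<longleftrightarrow> smooth_map N VM f \<and> f \<in> topspace (mtop N) \<rightarrow> corner p"
proof
  assume L: "smooth_map N (vector_manifold (corner p)) f"
  have "smooth_on (corner p) (corner p) UNIV (\<lambda>x. x)"
    by (rule smooth_on_superset_target[OF lcs_corner smooth_on_id[OF lcs_corner openin_subtopology_self]]) simp
  then have "smooth_map (vector_manifold (corner p)) VM (\<lambda>x. x)"
    by (simp add: smooth_on_iff_smooth_map_self[OF lcs_corner lcs_matrix])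
  from smooth_map_compose[OF N vector_corner VM L this] smooth_map_in[OF L]
  show "smooth_map N VM f \<and> f \<in> topspace (mtop N) \<rightarrow> corner p" by auto
next
  assume R: "smooth_map N VM f \<and> f \<in> topspace (mtop N) \<rightarrow> corner p"
  then have fV: "smooth_map N VM f" and fc: "f \<in> topspace (mtop N) \<rightarrow> corner p" by simp_all
  have "smooth_on UNIV UNIV (corner p) (\<lambda>x. p ** x ** p)"
    by (rule smooth_on_linear[OF lcs_matrix lcs_corner])
      (auto simp: matrix_mult_add matrix_mult_scaleR corner_def continuous_compress)
  then have "smooth_map VM (vector_manifold (corner p)) (\<lambda>x. p ** x ** p)"
    by (simp add: smooth_on_iff_smooth_map_self[OF lcs_matrix lcs_corner])
  from smooth_map_compose[OF N VM vector_corner fV this]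
  have "smooth_map N (vector_manifold (corner p)) (\<lambda>x. p ** f x ** p)" .
  then show "smooth_map N (vector_manifold (corner p)) f"
  proof (rule smooth_map_cong[OF N])
    fix x assume "x \<in> topspace (mtop N)"
    then have "f x \<in> corner p" using fc by auto
    then show "p ** f x ** p = f x" by (simp add: corner_iff)
  qed
qed

subsection \<open>Units of the corner\<close>

definition corner_units :: "('a^'n^'n) set" where
  "corner_units = {x \<in> corner p. invertible (x + (mat 1 - p))}"

text \<open>The inverse with respect to the unit \<open>p\<close> of the corner: adding \<open>1 - p\<close> turns units of the
  corner into invertible matrices.\<close>

definition corner_inverse :: "'a^'n^'n \<Rightarrow> 'a^'n^'n" where
  "corner_inverse x = p ** matrix_inv (x + (mat 1 - p)) ** p"

lemma corner_unitsI:
  assumes x: "x \<in> corner p" and y: "y \<in> corner p" and xy: "x ** y = p" "y ** x = p"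
  shows "x \<in> corner_units" and "corner_inverse x = y"
proof -
  note c = x[unfolded corner_iff] y[unfolded corner_iff]
  have 1: "(x + (mat 1 - p)) ** (y + (mat 1 - p)) = mat 1" "(y + (mat 1 - p)) ** (x + (mat 1 - p)) = mat 1"
    using c xy by (simp_all add: matrix_mult_add p_idem)
  show "x \<in> corner_units" unfolding corner_units_def using x invertibleI[OF 1] by simp
  have "corner_inverse x = p ** (y + (mat 1 - p)) ** p"
    unfolding corner_inverse_def matrix_inv_eqI[OF 1] ..
  then show "corner_inverse x = y" using c by (simp add: matrix_mult_add p_idem)
qed

lemma corner_unitsD:
  assumes "x \<in> corner_units"
  shows "x \<in> corner p" "corner_inverse x \<in> corner p" "x ** corner_inverse x = p" "corner_inverse x ** x = p"
proof -
  show x: "x \<in> corner p" using assms unfolding corner_units_def by simp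
  note c = x[unfolded corner_iff]
  let ?z = "matrix_inv (x + (mat 1 - p))"
  have "invertible (x + (mat 1 - p))" using assms unfolding corner_units_def by simp
  note z = invertible_matrix_inv[OF this]
  show "corner_inverse x \<in> corner p" unfolding corner_inverse_def corner_def by blast
  have e1: "p ** (x + (mat 1 - p)) = x" "(x + (mat 1 - p)) ** p = x"
    using c by (simp_all add: matrix_mult_add p_idem)
  have "x ** ?z = p" using arg_cong[OF z(1), of "\<lambda>A. p ** A"] by (simp add: matrix_mul_assoc e1)
  then have "x ** p ** ?z ** p = p" using c p_idem by simp
  then show "x ** corner_inverse x = p" by (simp add: corner_inverse_def matrix_mul_assoc)
  have "?z ** x = p" using arg_cong[OF z(2), of "\<lambda>A. A ** p"] by (simp add: e1 flip: matrix_mul_assoc)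
  then have "p ** (?z ** (p ** x)) = p" using c p_idem by simp
  then show "corner_inverse x ** x = p" by (simp add: corner_inverse_def matrix_mul_assoc)
qed

lemma p_corner_unit: "p \<in> corner_units" "corner_inverse p = p"
  using corner_unitsI[of p p] by (simp_all add: corner_iff p_idem)

lemma openin_corner_units: "openin (top_of_set (corner p)) corner_units"
proof -
  have "continuous_on UNIV (\<lambda>x. x + (mat 1 - p))"
    unfolding continuous_on_def
    by (intro ballI tendsto_add_lcs[OF lcs_matrix] tendsto_ident_at tendsto_const) simp_all
  then have "open ((\<lambda>x. x + (mat 1 - p)) -` {A. invertible A})"
    using open_vimage[OF open_invertible] by blast
  moreover have "corner_units = corner p \<inter> (\<lambda>x. x + (mat 1 - p)) -` {A. invertible A}"
    unfolding corner_units_def by auto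
  ultimately show ?thesis by (simp add: openin_open_Int)
qed

lemma smooth_corner_inverse:
  assumes N: "smooth_manifold N" and f: "smooth_map N VM f" and u: "\<And>x. x \<in> topspace (mtop N) \<Longrightarrow> f x \<in> corner_units"
  shows "smooth_map N VM (\<lambda>x. corner_inverse (f x))"
  unfolding corner_inverse_def
  by (intro smooth_matrix_mult[OF N] smooth_matrix_const[OF N] smooth_matrix_inv[OF N] smooth_matrix_add[OF N] f)
    (use u in \<open>simp add: corner_units_def\<close>)

subsection \<open>Local trivializations\<close>

text \<open>The matrix \<open>\<gamma>\<close> that compares the idempotents \<open>g\<^sub>0 * p\<close> and \<open>g * p\<close>.\<close>

definition gamma_at :: "'g \<Rightarrow> 'g \<Rightarrow> 'a^'n^'n" where
  "gamma_at g0 g = star g0 p ** star g p + (mat 1 - star g0 p) ** (mat 1 - star g p)"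

text \<open>An open neighbourhood of \<open>g\<^sub>0\<close> over which the extension is trivial.\<close>

definition Omega :: "'g \<Rightarrow> 'g set" where "Omega g0 = {g \<in> carrier G. invertible (gamma_at g0 g)}"

text \<open>The matrix \<open>X\<^sub>0 (g * p)\<close> of the local section through \<open>h0\<close>.\<close>

definition Sig :: "('e \<Rightarrow> 'e) \<times> 'g \<Rightarrow> 'g \<Rightarrow> 'a^'n^'n" where "Sig h0 g = Mat h0 ** star g p"

text \<open>The counterpart \<open>\<gamma>\<^sup>-\<^sup>1 Y\<^sub>0\<close> of \<open>Sig h0 g\<close>.\<close>

definition coSig :: "('e \<Rightarrow> 'e) \<times> 'g \<Rightarrow> 'g \<Rightarrow> 'a^'n^'n" where
  "coSig h0 g = matrix_inv (gamma_at (snd h0) g) ** co_mat h0"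

lemma star_p_idem: "g \<in> carrier G \<Longrightarrow> star g p ** star g p = star g p"
  by (simp add: p_idem flip: star_mult)

lemma Omega_self: "g \<in> carrier G \<Longrightarrow> g \<in> Omega g"
  unfolding Omega_def gamma_at_def
  by (auto simp: matrix_mult_add star_p_idem intro!: invertibleI[of _ "mat 1"])

lemma gamma_at_smooth:
  assumes N: "smooth_manifold N" and q: "smooth_map N MG q"
  shows "smooth_map N VM (\<lambda>x. gamma_at g0 (q x))"
  unfolding gamma_at_def
  by (intro smooth_matrix_add[OF N] smooth_matrix_mult[OF N] smooth_matrix_diff[OF N] smooth_matrix_const[OF N] smooth_star[OF N q])

lemma openin_Omega: "openin (mtop MG) (Omega g0)"
proof -
  have "continuous_map (mtop MG) (mtop VM) (gamma_at g0)"
    by (rule smooth_map_continuous[OF gamma_at_smooth[OF MG(1) smooth_map_id[OF MG(1)]]])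
  then have "openin (mtop MG) {g \<in> topspace (mtop MG). gamma_at g0 g \<in> {A. invertible A}}"
    by (rule openin_continuous_map_preimage) (simp add: open_invertible)
  then show ?thesis unfolding Omega_def MG(2) by simp
qed

lemma
  assumes h0: "h0 \<in> carrier Ghat" and g: "g \<in> Omega (snd h0)"
  shows Sig_coSig: "Sig h0 g ** coSig h0 g = p" and coSig_Sig: "coSig h0 g ** Sig h0 g = star g p"
    and p_Sig: "p ** Sig h0 g = Sig h0 g" and Sig_star_p: "Sig h0 g ** star g p = Sig h0 g"
    and star_p_coSig: "star g p ** coSig h0 g = coSig h0 g" and coSig_p: "coSig h0 g ** p = coSig h0 g"
proof -
  have gG: "g \<in> carrier G" and inv: "invertible (gamma_at (snd h0) g)" using g unfolding Omega_def by simp_all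
  note i = invertible_matrix_inv[OF inv]
  let ?X = "Mat h0" and ?Y = "co_mat h0" and ?Q = "star (snd h0) p" and ?P = "star g p"
  let ?c = "gamma_at (snd h0) g" and ?d = "matrix_inv (gamma_at (snd h0) g)"
  note idem = star_p_idem[OF gG] star_p_idem[OF Ghat_snd[OF h0]]
  have assoc: "A ** (B ** C) = A ** B ** C" for A B C :: "'a^'n^'n" by (rule matrix_mul_assoc)
  have cP: "?c ** ?P = ?Q ** ?P" and P0c: "?Q ** ?c = ?Q ** ?P"
    using idempotent_pair[OF idem(2,1)] by (simp_all add: gamma_at_def)
  have dP0: "?d ** ?Q = ?P ** ?d"
  proof -
    have "?d ** ?Q = ?d ** (?Q ** ?c) ** ?d" using i by (simp flip: assoc)
    also have "\<dots> = ?d ** (?c ** ?P) ** ?d" by (simp add: cP P0c)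
    also have "\<dots> = ?P ** ?d" by (simp add: assoc i)
    finally show ?thesis .
  qed
  \<comment> \<open>So \<open>X\<^sub>0 (g * p) = X\<^sub>0 \<gamma>\<close>, and the counterpart is \<open>\<gamma>\<^sup>-\<^sup>1 Y\<^sub>0\<close>.\<close>
  have XP: "?X ** ?P = ?X ** ?c"
  proof -
    have "?X ** ?P = ?X ** (?Q ** ?P)" using mat_star_p[OF h0] by (simp add: assoc)
    also have "\<dots> = ?X ** ?c" using mat_star_p[OF h0] by (simp add: assoc flip: P0c)
    finally show ?thesis .
  qed
  have "Sig h0 g ** coSig h0 g = ?X ** (?c ** ?d) ** ?Y"
    unfolding Sig_def coSig_def XP by (simp only: assoc)
  then show "Sig h0 g ** coSig h0 g = p" by (simp add: i mat_co_mat[OF h0])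
  have "coSig h0 g ** Sig h0 g = ?d ** (?Y ** ?X) ** ?P"
    unfolding Sig_def coSig_def by (simp only: assoc)
  also have "\<dots> = ?d ** (?c ** ?P)" by (simp add: co_mat_mat[OF h0] cP flip: assoc)
  also have "\<dots> = ?P" by (simp add: assoc i)
  finally show "coSig h0 g ** Sig h0 g = ?P" .
  show "p ** Sig h0 g = Sig h0 g" by (simp add: Sig_def assoc p_matrix_of)
  show "Sig h0 g ** ?P = Sig h0 g" by (simp add: Sig_def idem flip: assoc)
  have "?P ** coSig h0 g = (?d ** ?Q) ** ?Y" unfolding coSig_def dP0 by (simp only: assoc)
  then show "?P ** coSig h0 g = coSig h0 g" by (simp add: coSig_def star_p_co_mat[OF h0] flip: assoc)
  show "coSig h0 g ** p = coSig h0 g" by (simp add: coSig_def co_mat_p[OF h0] flip: assoc)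
qed

lemma Sig_smooth:
  assumes N: "smooth_manifold N" and q: "smooth_map N MG q"
  shows "smooth_map N VM (\<lambda>x. Sig h0 (q x))"
  unfolding Sig_def by (intro smooth_matrix_mult[OF N] smooth_matrix_const[OF N] smooth_star[OF N q])

lemma coSig_smooth:
  assumes N: "smooth_manifold N" and q: "smooth_map N MG q" and Omega: "q \<in> topspace (mtop N) \<rightarrow> Omega (snd h0)"
  shows "smooth_map N VM (\<lambda>x. coSig h0 (q x))"
  unfolding coSig_def
  by (intro smooth_matrix_mult[OF N] smooth_matrix_const[OF N] smooth_matrix_inv[OF N] gamma_at_smooth[OF N q])
    (use Omega in \<open>auto simp: Omega_def\<close>)

lemma
  assumes h0: "h0 \<in> carrier Ghat" and g: "g \<in> Omega (snd h0)" and x: "x \<in> corner_units"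
  shows of_mat_Sig_in: "of_mat (x ** Sig h0 g) g \<in> carrier Ghat"
    and mat_of_mat_Sig: "Mat (of_mat (x ** Sig h0 g) g) = x ** Sig h0 g"
proof -
  have gG: "g \<in> carrier G" using g unfolding Omega_def by simp
  note S = Sig_coSig[OF h0 g] coSig_Sig[OF h0 g] p_Sig[OF h0 g] Sig_star_p[OF h0 g] star_p_coSig[OF h0 g] coSig_p[OF h0 g]
  note xD = corner_unitsD[OF x] corner_unitsD(1)[OF x, unfolded corner_iff] corner_unitsD(2)[OF x, unfolded corner_iff]
  have assoc: "A ** (B ** C) = A ** B ** C" for A B C :: "'a^'n^'n" by (rule matrix_mul_assoc)
  let ?X = "x ** Sig h0 g" and ?Y = "coSig h0 g ** corner_inverse x"
  have 1: "p ** ?X = ?X" using xD by (simp add: assoc)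
  have 2: "?X ** star g p = ?X" using S by (simp flip: assoc)
  have 3: "star g p ** ?Y = ?Y" using S by (simp add: assoc)
  have "?X ** ?Y = x ** (Sig h0 g ** coSig h0 g) ** corner_inverse x" by (simp only: assoc)
  then have 4: "?X ** ?Y = p" using S xD by simp
  have "?Y ** ?X = coSig h0 g ** (corner_inverse x ** x) ** Sig h0 g" by (simp only: assoc)
  then have 5: "?Y ** ?X = star g p" using S xD by simp
  show "of_mat ?X g \<in> carrier Ghat" by (rule of_mat_in[OF gG 1 2 3 4 5])
  show "Mat (of_mat ?X g) = ?X" by (rule mat_of_mat[OF gG 1 2 3 4 5])
qed

text \<open>Division of an element over \<open>g\<close> by the section gives a unit of the corner, whose inverse
  is the section divided by the element.\<close>

lemma chart_coordinate:
  assumes h0: "h0 \<in> carrier Ghat" and h: "h \<in> carrier Ghat" and g: "snd h \<in> Omega (snd h0)"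
  shows "Mat h ** coSig h0 (snd h) \<in> corner_units"
    and "corner_inverse (Mat h ** coSig h0 (snd h)) = Sig h0 (snd h) ** co_mat h"
    and "Mat h ** coSig h0 (snd h) ** Sig h0 (snd h) = Mat h"
proof -
  note S = Sig_coSig[OF h0 g] coSig_Sig[OF h0 g] p_Sig[OF h0 g] Sig_star_p[OF h0 g] star_p_coSig[OF h0 g] coSig_p[OF h0 g]
  have assoc: "A ** (B ** C) = A ** B ** C" for A B C :: "'a^'n^'n" by (rule matrix_mul_assoc)
  let ?x = "Mat h ** coSig h0 (snd h)" and ?y = "Sig h0 (snd h) ** co_mat h"
  note m = mat_co_mat[OF h] co_mat_mat[OF h] star_p_co_mat[OF h] co_mat_p[OF h] mat_star_p[OF h]
  have x: "?x \<in> corner p" using S m unfolding corner_iff by (simp add: assoc p_matrix_of) (simp flip: assoc)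
  have y: "?y \<in> corner p" using S m unfolding corner_iff by (simp add: assoc) (simp flip: assoc)
  have "?x ** ?y = Mat h ** (coSig h0 (snd h) ** Sig h0 (snd h)) ** co_mat h" by (simp only: assoc)
  then have xy: "?x ** ?y = p" using S m by simp
  have "?y ** ?x = Sig h0 (snd h) ** (co_mat h ** Mat h) ** coSig h0 (snd h)" by (simp only: assoc)
  then have yx: "?y ** ?x = p" using S m by simp
  show "?x \<in> corner_units" "corner_inverse ?x = ?y" by (rule corner_unitsI[OF x y xy yx])+
  have "?x ** Sig h0 (snd h) = Mat h ** (coSig h0 (snd h) ** Sig h0 (snd h))" by (simp only: assoc)
  then show "?x ** Sig h0 (snd h) = Mat h" using S m by simp
qed

end

text \<open>The inverse map in the definition of a diffeomorphism depends on the values of the map on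
  the manifold only.\<close>

lemma diffeomorphism_cong:
  assumes M: "smooth_manifold M" and N: "smooth_manifold N" and f: "diffeomorphism M N f"
    and eq: "\<And>x. x \<in> topspace (mtop M) \<Longrightarrow> g x = f x"
  shows "diffeomorphism M N g"
proof -
  let ?S = "topspace (mtop M)"
  from f have bij: "bij_betw f ?S (topspace (mtop N))" and sf: "smooth_map M N f" and si: "smooth_map N M (inv_into ?S f)"
    unfolding diffeomorphism_def by simp_all
  show ?thesis
  proof (rule diffeomorphismI[OF N _ si])
    show "smooth_map M N g" by (rule smooth_map_cong[OF M sf]) (simp add: eq)
    show "inv_into ?S f (g x) = x" if "x \<in> ?S" for x
      using bij that by (simp add: eq bij_betw_inv_into_left)
    show "g (inv_into ?S f y) = y" if "y \<in> topspace (mtop N)" for y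
      using bij that smooth_map_in[OF si that] by (simp add: eq bij_betw_inv_into_right)
  qed
qed

context projective_module
begin

subsection \<open>The manifold structures\<close>

definition chart_domain :: "('e \<Rightarrow> 'e) \<times> 'g \<Rightarrow> 'g set \<Rightarrow> (('e \<Rightarrow> 'e) \<times> 'g) set" where
  "chart_domain h0 W = {h \<in> carrier Ghat. snd h \<in> W \<inter> Omega (snd h0)}"

definition chart_map :: "('e \<Rightarrow> 'e) \<times> 'g \<Rightarrow> ('g \<Rightarrow> 'm) \<Rightarrow> ('e \<Rightarrow> 'e) \<times> 'g \<Rightarrow> ('a^'n^'n) \<times> 'm" where
  "chart_map h0 \<psi> h = (Mat h ** coSig h0 (snd h), \<psi> (snd h))"

text \<open>One chart for each chart of \<open>G\<close> and each element \<open>h0\<close> whose section is used.\<close>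

definition Ghat_charts where
  "Ghat_charts = {(chart_domain h0 W, chart_map h0 \<psi>) | h0 W \<psi>. h0 \<in> carrier Ghat \<and> (W, \<psi>) \<in> atlas MG}"

lemma chart_map_inverse:
  assumes h0: "h0 \<in> carrier Ghat" and W: "(W, \<psi>) \<in> atlas MG"
  shows "inj_on (chart_map h0 \<psi>) (chart_domain h0 W)"
    and "chart_map h0 \<psi> ` chart_domain h0 W = corner_units \<times> \<psi> ` (W \<inter> Omega (snd h0))"
    and "v \<in> corner_units \<times> \<psi> ` (W \<inter> Omega (snd h0)) \<Longrightarrow>
      inv_into (chart_domain h0 W) (chart_map h0 \<psi>) v = of_mat (fst v ** Sig h0 (inv_into W \<psi> (snd v))) (inv_into W \<psi> (snd v))"
proof -
  note inj = chart_inj[OF MG(1) W]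
  let ?i = "inv_into W \<psi>" and ?D = "chart_domain h0 W"
  let ?r = "\<lambda>v. of_mat (fst v ** Sig h0 (?i (snd v))) (?i (snd v))"
  have D: "h \<in> carrier Ghat" "snd h \<in> W" "snd h \<in> Omega (snd h0)" if "h \<in> ?D" for h
    using that by (simp_all add: chart_domain_def)
  have r: "?r (chart_map h0 \<psi> h) = h" if h: "h \<in> ?D" for h
  proof (rule Ghat_eqI)
    note d = D[OF h] and c = chart_coordinate[OF h0 D(1)[OF h] D(3)[OF h]]
    have i: "?i (\<psi> (snd h)) = snd h" by (rule inv_into_f_f[OF inj d(2)])
    show "?r (chart_map h0 \<psi> h) \<in> carrier Ghat"
      unfolding chart_map_def fst_conv snd_conv i by (rule of_mat_Sig_in[OF h0 d(3) c(1)])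
    show "Mat (?r (chart_map h0 \<psi> h)) = Mat h"
      unfolding chart_map_def fst_conv snd_conv i mat_of_mat_Sig[OF h0 d(3) c(1)] by (rule c(3))
  qed (use D[OF h] in \<open>simp_all add: chart_map_def inv_into_f_f[OF inj]\<close>)
  then show inj_c: "inj_on (chart_map h0 \<psi>) ?D" by (rule inj_on_inverseI)
  have v: "?r v \<in> ?D \<and> chart_map h0 \<psi> (?r v) = v" if "v \<in> corner_units \<times> \<psi> ` (W \<inter> Omega (snd h0))" for v
  proof -
    from that obtain x g where xg: "v = (x, \<psi> g)" "x \<in> corner_units" "g \<in> W" "g \<in> Omega (snd h0)" by auto
    have i: "?i (\<psi> g) = g" by (rule inv_into_f_f[OF inj xg(3)])
    have "x ** Sig h0 g ** coSig h0 g = x"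
      using Sig_coSig[OF h0 xg(4)] corner_unitsD(1)[OF xg(2)] by (simp add: corner_iff flip: matrix_mul_assoc)
    then show ?thesis
      using of_mat_Sig_in[OF h0 xg(4,2)] mat_of_mat_Sig[OF h0 xg(4,2)] xg
      by (simp add: xg(1) i chart_domain_def chart_map_def)
  qed
  show im: "chart_map h0 \<psi> ` ?D = corner_units \<times> \<psi> ` (W \<inter> Omega (snd h0))"
  proof
    show "chart_map h0 \<psi> ` ?D \<subseteq> corner_units \<times> \<psi> ` (W \<inter> Omega (snd h0))"
    proof (rule image_subsetI)
      fix h assume h: "h \<in> ?D"
      show "chart_map h0 \<psi> h \<in> corner_units \<times> \<psi> ` (W \<inter> Omega (snd h0))"
        unfolding chart_map_def using chart_coordinate(1)[OF h0 D(1)[OF h] D(3)[OF h]] D[OF h] by blast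
    qed
    show "corner_units \<times> \<psi> ` (W \<inter> Omega (snd h0)) \<subseteq> chart_map h0 \<psi> ` ?D"
    proof
      fix v assume "v \<in> corner_units \<times> \<psi> ` (W \<inter> Omega (snd h0))"
      from v[OF this] show "v \<in> chart_map h0 \<psi> ` ?D" by (intro image_eqI[of v _ "?r v"]) simp_all
    qed
  qed
  show "inv_into ?D (chart_map h0 \<psi>) v = ?r v" if "v \<in> corner_units \<times> \<psi> ` (W \<inter> Omega (snd h0))"
    using v[OF that] by (intro inv_into_f_eq[OF inj_c]) simp_all
qed

lemma compress_in_corner: "p ** x ** p \<in> corner p"
  unfolding corner_def by (rule rangeI)

abbreviation ambient where "ambient \<equiv> prod_manifold VM MG"

lemma ambient: "smooth_manifold ambient"
  by (rule smooth_manifold_prod_manifold[OF VM MG(1)])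

abbreviation \<j> :: "('e \<Rightarrow> 'e) \<times> 'g \<Rightarrow> ('a^'n^'n) \<times> 'g" where "\<j> h \<equiv> (Mat h, snd h)"

lemma lcs_model: "locally_convex_space (corner p \<times> model MG)"
  by (rule locally_convex_space_Times[OF lcs_corner model_lcs[OF MG(1)]])

lemma openin_chart_base: "(W, \<psi>) \<in> atlas MG \<Longrightarrow> openin (mtop MG) (W \<inter> Omega g0)"
  by (intro openin_Int chart_openin[OF MG(1)] openin_Omega)

lemma openin_chart_range:
  assumes "(W, \<psi>) \<in> atlas MG"
  shows "openin (top_of_set (corner p \<times> model MG)) (corner_units \<times> \<psi> ` (W \<inter> Omega g0))"
  by (intro openin_Times_top_of_set openin_corner_units chart_image_open[OF MG(1) assms] openin_Omega)

text \<open>The compression by \<open>p\<close> in the extension \<open>\<Phi>\<close> of a chart changes nothing on the group, but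
  keeps the values in the corner for arbitrary matrices.\<close>

lemma embedded_Ghat: "embedded_charts ambient \<j> (carrier Ghat) Ghat_charts (corner p \<times> model MG)"
proof
  show "smooth_manifold ambient" by (rule ambient)
  show "locally_convex_space (corner p \<times> model MG)" by (rule lcs_model)
  show "\<j> \<in> carrier Ghat \<rightarrow> topspace (mtop ambient)"
    using Ghat_snd by (auto simp: MG(2))
  show "inj_on \<j> (carrier Ghat)"
    by (rule inj_onI) (rule Ghat_eqI; simp)
  show "carrier Ghat = (\<Union>(U, \<phi>)\<in>Ghat_charts. U)"
  proof
    show "carrier Ghat \<subseteq> (\<Union>(U, \<phi>)\<in>Ghat_charts. U)"
    proof
      fix h assume h: "h \<in> carrier Ghat"
      then obtain W \<psi> where W: "(W, \<psi>) \<in> atlas MG" "snd h \<in> W"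
        using obtain_chart[OF MG(1), of "snd h"] Ghat_snd MG(2) by metis
      have "(chart_domain h W, chart_map h \<psi>) \<in> Ghat_charts" unfolding Ghat_charts_def using h W by blast
      moreover have "h \<in> chart_domain h W" using h W Omega_self[OF Ghat_snd[OF h]] by (simp add: chart_domain_def)
      ultimately show "h \<in> (\<Union>(U, \<phi>)\<in>Ghat_charts. U)" by blast
    qed
    show "(\<Union>(U, \<phi>)\<in>Ghat_charts. U) \<subseteq> carrier Ghat"
      by (auto simp: Ghat_charts_def chart_domain_def)
  qed
  fix U \<phi> assume "(U, \<phi>) \<in> Ghat_charts"
  then obtain h0 W \<psi> where U: "U = chart_domain h0 W" "\<phi> = chart_map h0 \<psi>"
    and h0: "h0 \<in> carrier Ghat" and W: "(W, \<psi>) \<in> atlas MG" unfolding Ghat_charts_def by blast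
  note ci = chart_map_inverse[OF h0 W]
  let ?O = "W \<inter> Omega (snd h0)"
  note O = openin_chart_base[OF W, of "snd h0"]
  note MO = smooth_manifold_open_submanifold[OF MG(1) O]
  show "inj_on \<phi> U" unfolding U by (rule ci(1))
  show "openin (top_of_set (corner p \<times> model MG)) (\<phi> ` U)" unfolding U ci(2) by (rule openin_chart_range[OF W])
  show "\<exists>X \<Phi>. openin (mtop ambient) X \<and> U = {h \<in> carrier Ghat. \<j> h \<in> X} \<and>
      smooth_map (open_submanifold ambient X) (vector_manifold (corner p \<times> model MG)) \<Phi> \<and> (\<forall>h\<in>U. \<phi> h = \<Phi> (\<j> h))"
  proof (intro exI conjI ballI)
    let ?X = "UNIV \<times> ?O"
    let ?\<Phi> = "\<lambda>z. (p ** (fst z ** coSig h0 (snd z)) ** p, \<psi> (snd z))"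
    show X: "openin (mtop ambient) ?X" using O by (simp add: openin_prod_Times_iff)
    show "U = {h \<in> carrier Ghat. \<j> h \<in> ?X}" unfolding U chart_domain_def by auto
    show "\<phi> h = ?\<Phi> (\<j> h)" if "h \<in> U" for h
    proof -
      have h: "h \<in> carrier Ghat" "snd h \<in> Omega (snd h0)" using that unfolding U chart_domain_def by simp_all
      have "Mat h ** coSig h0 (snd h) \<in> corner p"
        by (rule corner_unitsD(1)[OF chart_coordinate(1)[OF h0 h]])
      then show ?thesis unfolding U chart_map_def by (simp add: corner_iff)
    qed
    let ?N = "open_submanifold ambient ?X"
    note N = smooth_manifold_open_submanifold[OF ambient X]
    have f: "smooth_map ?N VM fst" by (rule smooth_map_restrict[OF ambient VM X smooth_map_fst[OF VM MG(1)]])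
    have s: "smooth_map ?N MG snd" by (rule smooth_map_restrict[OF ambient MG(1) X smooth_map_snd[OF VM MG(1)]])
    have top: "topspace (mtop ?N) \<subseteq> UNIV \<times> ?O" by auto
    have "smooth_map ?N VM (\<lambda>z. p ** (fst z ** coSig h0 (snd z)) ** p)"
      by (intro smooth_matrix_mult[OF N] smooth_matrix_const[OF N] f coSig_smooth[OF N s]) (use top in auto)
    then have 1: "smooth_map ?N (vector_manifold (corner p)) (\<lambda>z. p ** (fst z ** coSig h0 (snd z)) ** p)"
      by (simp add: smooth_into_corner[OF N] compress_in_corner)
    have "smooth_map ?N (open_submanifold MG W) snd"
      using s top by (auto simp: smooth_map_into_open_submanifold[OF N MG(1)])
    from smooth_map_compose[OF N smooth_manifold_open_submanifold[OF MG(1) chart_openin[OF MG(1) W]]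
        smooth_manifold_vector_manifold[OF model_lcs[OF MG(1)]] this smooth_map_chart[OF MG(1) W]]
    have 2: "smooth_map ?N (vector_manifold (model MG)) (\<lambda>z. \<psi> (snd z))" .
    show "smooth_map ?N (vector_manifold (corner p \<times> model MG)) ?\<Phi>"
      using smooth_map_Pair[OF N vector_corner smooth_manifold_vector_manifold[OF model_lcs[OF MG(1)]] 1 2]
      by (simp add: prod_vector_manifold)
  qed
  let ?VV = "vector_manifold (corner p \<times> model MG)"
  let ?R = "corner_units \<times> \<psi> ` ?O"
  let ?N = "open_submanifold ?VV ?R"
  note VV = smooth_manifold_vector_manifold[OF lcs_model]
  have oR: "openin (mtop ?VV) ?R" using openin_chart_range[OF W] by simp
  note N = smooth_manifold_open_submanifold[OF VV oR]
  have top: "topspace (mtop ?N) \<subseteq> ?R" by auto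
  have "smooth_map ?N (vector_manifold (corner p)) fst"
    using smooth_map_fst[OF vector_corner smooth_manifold_vector_manifold[OF model_lcs[OF MG(1)]]]
    by (intro smooth_map_restrict[OF VV vector_corner oR]) (simp add: prod_vector_manifold)
  then have f: "smooth_map ?N VM fst" by (simp add: smooth_into_corner[OF N])
  have s: "smooth_map ?N (vector_manifold (model MG)) snd"
    using smooth_map_snd[OF vector_corner smooth_manifold_vector_manifold[OF model_lcs[OF MG(1)]]]
    by (intro smooth_map_restrict[OF VV smooth_manifold_vector_manifold[OF model_lcs[OF MG(1)]] oR]) (simp add: prod_vector_manifold)
  then have s': "smooth_map ?N (open_submanifold (vector_manifold (model MG)) (\<psi> ` W)) snd"
    using top by (auto simp: smooth_map_into_open_submanifold[OF N smooth_manifold_vector_manifold[OF model_lcs[OF MG(1)]]])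
  have "smooth_manifold (open_submanifold (vector_manifold (model MG)) (\<psi> ` W))"
    using chart_image_openin[OF MG(1) W]
    by (intro smooth_manifold_open_submanifold smooth_manifold_vector_manifold model_lcs[OF MG(1)]) simp
  from smooth_map_compose[OF N this MG(1) s' smooth_map_chart_inverse[OF MG(1) W]]
  have q: "smooth_map ?N MG (\<lambda>v. inv_into W \<psi> (snd v))" .
  have "smooth_map ?N ambient (\<lambda>v. (fst v ** Sig h0 (inv_into W \<psi> (snd v)), inv_into W \<psi> (snd v)))"
    by (intro smooth_map_Pair[OF N VM MG(1)] q smooth_matrix_mult[OF N] f Sig_smooth[OF N q])
  then have "smooth_map ?N ambient (\<lambda>v. \<j> (inv_into U \<phi> v))"
  proof (rule smooth_map_cong[OF N])
    fix v assume "v \<in> topspace (mtop ?N)"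
    then have v: "v \<in> ?R" using top by blast
    then have "fst v \<in> corner_units" "inv_into W \<psi> (snd v) \<in> Omega (snd h0)"
      using inv_into_f_f[OF chart_inj[OF MG(1) W]] by auto
    then show "(fst v ** Sig h0 (inv_into W \<psi> (snd v)), inv_into W \<psi> (snd v)) = \<j> (inv_into U \<phi> v)"
      unfolding U ci(3)[OF v] using mat_of_mat_Sig[OF h0] by simp
  qed
  then show "smooth_map (open_submanifold ?VV (\<phi> ` U)) ambient (\<lambda>v. \<j> (inv_into U \<phi> v))"
    unfolding U ci(2) .
qed

interpretation H: embedded_charts ambient \<j> "carrier Ghat" Ghat_charts "corner p \<times> model MG"
  by (rule embedded_Ghat)

definition MHat :: "(('e \<Rightarrow> 'e) \<times> 'g, ('a^'n^'n) \<times> 'm) manifold" where "MHat = H.induced"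

lemma MHat: "smooth_manifold MHat" and topspace_MHat: "topspace (mtop MHat) = carrier Ghat"
  unfolding MHat_def using H.smooth_manifold_induced H.topspace_induced by simp_all

lemma Mat_smooth: "smooth_map MHat VM (\<lambda>h. Mat h)" and snd_smooth: "smooth_map MHat MG snd"
proof -
  have j: "smooth_map MHat ambient \<j>" using H.smooth_map_j unfolding MHat_def .
  show "smooth_map MHat VM (\<lambda>h. Mat h)"
    using smooth_map_compose[OF MHat ambient VM j smooth_map_fst[OF VM MG(1)]] by simp
  show "smooth_map MHat MG snd"
    using smooth_map_compose[OF MHat ambient MG(1) j smooth_map_snd[OF VM MG(1)]] by simp
qed

lemma smooth_into_MHat:
  assumes N: "smooth_manifold N" and "smooth_map N VM (\<lambda>x. Mat (f x))" "smooth_map N MG (\<lambda>x. snd (f x))"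
    and "f \<in> topspace (mtop N) \<rightarrow> carrier Ghat"
  shows "smooth_map N MHat f"
  unfolding MHat_def H.smooth_map_into_induced[OF N]
  using smooth_map_Pair[OF N VM MG(1) assms(2,3)] assms(4) by simp

abbreviation GL where "GL \<equiv> GL_mod act"
abbreviation MGL where "MGL \<equiv> GL_mod_manifold act p \<theta>"

lemma kappa_image: "kappa ` carrier GL = corner_units"
proof
  show "kappa ` carrier GL \<subseteq> corner_units"
  proof (rule image_subsetI)
    fix \<phi> assume \<phi>: "\<phi> \<in> carrier GL"
    then have h: "\<iota> \<phi> \<in> carrier Ghat" by (simp add: carrier_GL)
    note m = mat_co_mat[OF h] co_mat_mat[OF h] star_p_co_mat[OF h] co_mat_p[OF h]
    have c: "co_mat (\<iota> \<phi>) \<in> corner p" using m unfolding corner_iff by (simp add: star_unit)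
    show "kappa \<phi> \<in> corner_units"
      unfolding kappa_eq(1)[OF \<phi>] by (rule corner_unitsI(1)[OF kappa_eq(2)[OF \<phi>] c]) (use m in \<open>simp_all add: star_unit\<close>)
  qed
  show "corner_units \<subseteq> kappa ` carrier GL"
  proof
    fix x assume x: "x \<in> corner_units"
    note d = corner_unitsD[OF x]
    note c = d(1)[unfolded corner_iff] d(2)[unfolded corner_iff]
    have pr: "p ** x = x" "x ** star \<one>\<^bsub>G\<^esub> p = x" "star \<one>\<^bsub>G\<^esub> p ** corner_inverse x = corner_inverse x"
      "x ** corner_inverse x = p" "corner_inverse x ** x = star \<one>\<^bsub>G\<^esub> p"
      using c d by (simp_all add: star_unit)
    let ?h = "of_mat x \<one>\<^bsub>G\<^esub>"
    have "?h \<in> carrier Ghat" and m: "Mat ?h = x"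
      by (rule of_mat_in[OF G.one_closed pr] mat_of_mat[OF G.one_closed pr])+
    then have \<phi>: "fst ?h \<in> carrier GL" by (simp add: carrier_GL of_mat_def)
    show "x \<in> kappa ` carrier GL"
      using kappa_eq(1)[OF \<phi>] m by (intro image_eqI[OF _ \<phi>]) simp
  qed
qed

lemma kappa_inj: "inj_on kappa (carrier GL)"
proof (rule inj_onI)
  fix \<phi> \<psi> assume \<phi>: "\<phi> \<in> carrier GL" "\<psi> \<in> carrier GL" "kappa \<phi> = kappa \<psi>"
  have "\<iota> \<phi> = \<iota> \<psi>"
    by (rule Ghat_eqI) (use \<phi> kappa_eq in \<open>simp_all add: carrier_GL\<close>)
  then show "\<phi> = \<psi>" by simp
qed

lemma embedded_GL: "embedded_charts (vector_manifold (corner p)) kappa (carrier GL) {(carrier GL, kappa)} (corner p)"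
proof
  show "smooth_manifold (vector_manifold (corner p))" by (rule vector_corner)
  show "locally_convex_space (corner p)" by (rule lcs_corner)
  show "kappa \<in> carrier GL \<rightarrow> topspace (mtop (vector_manifold (corner p)))"
    using kappa_eq by auto
  show "inj_on kappa (carrier GL)" by (rule kappa_inj)
  show "carrier GL = (\<Union>(U, \<phi>)\<in>{(carrier GL, kappa)}. U)" by simp
  fix U \<phi> assume "(U, \<phi>) \<in> {(carrier GL, kappa)}"
  then have U: "U = carrier GL" "\<phi> = kappa" by simp_all
  show "inj_on \<phi> U" unfolding U by (rule kappa_inj)
  show "openin (top_of_set (corner p)) (\<phi> ` U)" unfolding U kappa_image by (rule openin_corner_units)
  show "\<exists>X \<Phi>. openin (mtop (vector_manifold (corner p))) X \<and> U = {h \<in> carrier GL. kappa h \<in> X} \<and>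
      smooth_map (open_submanifold (vector_manifold (corner p)) X) (vector_manifold (corner p)) \<Phi> \<and>
      (\<forall>h\<in>U. \<phi> h = \<Phi> (kappa h))"
  proof (intro exI conjI ballI)
    show "openin (mtop (vector_manifold (corner p))) (corner p)" by simp
    show "U = {h \<in> carrier GL. kappa h \<in> corner p}" unfolding U using kappa_eq by auto
    show "smooth_map (open_submanifold (vector_manifold (corner p)) (corner p)) (vector_manifold (corner p)) (\<lambda>x. x)"
      unfolding open_submanifold_vector_self by (rule smooth_map_id[OF vector_corner])
  qed (simp add: U)
  have o: "openin (mtop (vector_manifold (corner p))) corner_units" using openin_corner_units by simp
  have "smooth_map (open_submanifold (vector_manifold (corner p)) corner_units) (vector_manifold (corner p)) (\<lambda>x. x)"
    by (rule smooth_map_restrict[OF vector_corner vector_corner o smooth_map_id[OF vector_corner]])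
  then show "smooth_map (open_submanifold (vector_manifold (corner p)) (\<phi> ` U)) (vector_manifold (corner p))
      (\<lambda>v. kappa (inv_into U \<phi> v))"
    unfolding U kappa_image
    by (rule smooth_map_cong[OF smooth_manifold_open_submanifold[OF vector_corner o]])
      (auto simp: f_inv_into_f kappa_image)
qed

interpretation L: embedded_charts "vector_manifold (corner p)" kappa "carrier GL" "{(carrier GL, kappa)}" "corner p"
  by (rule embedded_GL)

lemma MGL_induced: "MGL = L.induced"
  unfolding GL_mod_manifold_def L.induced_def Let_def kappa_def[symmetric] by simp

lemma MGL: "smooth_manifold MGL" and topspace_MGL: "topspace (mtop MGL) = carrier GL"
  unfolding MGL_induced using L.smooth_manifold_induced L.topspace_induced by simp_all

lemma matrix_of_smooth: "smooth_map MGL VM matrix_of"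
proof -
  have "smooth_map MGL (vector_manifold (corner p)) kappa" unfolding MGL_induced by (rule L.smooth_map_j)
  then have "smooth_map MGL VM kappa" by (simp add: smooth_into_corner[OF MGL])
  then show ?thesis by (rule smooth_map_cong[OF MGL]) (simp add: topspace_MGL kappa_eq)
qed

lemma smooth_into_MGL:
  assumes N: "smooth_manifold N" and f: "smooth_map N VM (\<lambda>x. matrix_of (f x))" "f \<in> topspace (mtop N) \<rightarrow> carrier GL"
  shows "smooth_map N MGL f"
proof -
  have "smooth_map N VM (\<lambda>x. kappa (f x))"
    by (rule smooth_map_cong[OF N f(1)]) (simp add: kappa_eq(1)[OF funcset_mem[OF f(2)]])
  then have "smooth_map N (vector_manifold (corner p)) (\<lambda>x. kappa (f x))"
    unfolding smooth_into_corner[OF N]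
    by (intro conjI Pi_I) (simp_all add: kappa_eq[OF funcset_mem[OF f(2)]])
  then show ?thesis unfolding MGL_induced L.smooth_map_into_induced[OF N] using f(2) by simp
qed

subsection \<open>Smoothness of the group operations\<close>

lemma smooth_G_mult:
  assumes N: "smooth_manifold N" and q: "smooth_map N MG q" "smooth_map N MG r"
  shows "smooth_map N MG (\<lambda>x. q x \<otimes>\<^bsub>G\<^esub> r x)"
  using smooth_map_compose[OF N smooth_manifold_prod_manifold[OF MG(1) MG(1)] MG(1) smooth_map_Pair[OF N MG(1) MG(1) q] MG(3)]
  by simp

lemma smooth_G_inv:
  assumes N: "smooth_manifold N" and q: "smooth_map N MG q"
  shows "smooth_map N MG (\<lambda>x. inv\<^bsub>G\<^esub> (q x))"
  by (rule smooth_map_compose[OF N MG(1) MG(1) q MG(4)])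

text \<open>Locally, \<open>Y = \<Sigma>\<^sup>-\<^sup>1 x\<^sup>-\<^sup>1\<close> where \<open>x\<close> is the coordinate of \<open>h\<close> in the corner and \<open>\<Sigma>\<close> the
  section.\<close>

lemma co_mat_smooth: "smooth_map MHat VM co_mat"
proof (rule smooth_map_local[OF MHat VM])
  fix h0 assume "h0 \<in> topspace (mtop MHat)"
  then have h0: "h0 \<in> carrier Ghat" by (simp add: topspace_MHat)
  let ?X = "{h \<in> topspace (mtop MHat). snd h \<in> Omega (snd h0)}"
  have X: "openin (mtop MHat) ?X"
    by (rule openin_continuous_map_preimage[OF smooth_map_continuous[OF snd_smooth] openin_Omega])
  have h0X: "h0 \<in> ?X" using h0 Omega_self[OF Ghat_snd[OF h0]] by (simp add: topspace_MHat)
  let ?N = "open_submanifold MHat ?X"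
  note N = smooth_manifold_open_submanifold[OF MHat X]
  have top: "topspace (mtop ?N) = ?X" by auto
  note m = smooth_map_restrict[OF MHat VM X Mat_smooth] and q = smooth_map_restrict[OF MHat MG(1) X snd_smooth]
  have cS: "smooth_map ?N VM (\<lambda>h. coSig h0 (snd h))"
    by (rule coSig_smooth[OF N q]) (auto simp: top)
  have x: "smooth_map ?N VM (\<lambda>h. Mat h ** coSig h0 (snd h))"
    by (rule smooth_matrix_mult[OF N m cS])
  have "smooth_map ?N VM (\<lambda>h. coSig h0 (snd h) ** corner_inverse (Mat h ** coSig h0 (snd h)))"
    by (rule smooth_matrix_mult[OF N cS smooth_corner_inverse[OF N x]])
      (use chart_coordinate(1)[OF h0] in \<open>simp add: top topspace_MHat\<close>)
  then have "smooth_map ?N VM co_mat"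
  proof (rule smooth_map_cong[OF N])
    fix h assume "h \<in> topspace (mtop ?N)"
    then have h: "h \<in> carrier Ghat" "snd h \<in> Omega (snd h0)" by (simp_all add: top topspace_MHat)
    show "coSig h0 (snd h) ** corner_inverse (Mat h ** coSig h0 (snd h)) = co_mat h"
      unfolding chart_coordinate(2)[OF h0 h] matrix_mul_assoc coSig_Sig[OF h0 h(2)] star_p_co_mat[OF h(1)] ..
  qed
  with X h0X show "\<exists>X. openin (mtop MHat) X \<and> h0 \<in> X \<and> smooth_map (open_submanifold MHat X) VM co_mat"
    by (intro exI conjI)
qed

lemma smooth_Ghat_mult:
  assumes N: "smooth_manifold N" and f: "smooth_map N MHat f" and g: "smooth_map N MHat g"
  shows "smooth_map N MHat (\<lambda>x. f x \<otimes>\<^bsub>Ghat\<^esub> g x)"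
proof (rule smooth_into_MHat[OF N])
  have fH: "f x \<in> carrier Ghat" and gH: "g x \<in> carrier Ghat" if "x \<in> topspace (mtop N)" for x
    using smooth_map_in[OF f that] smooth_map_in[OF g that] by (simp_all add: topspace_MHat)
  note qf = smooth_map_compose[OF N MHat MG(1) f snd_smooth] and qg = smooth_map_compose[OF N MHat MG(1) g snd_smooth]
  note mf = smooth_map_compose[OF N MHat VM f Mat_smooth] and mg = smooth_map_compose[OF N MHat VM g Mat_smooth]
  show "smooth_map N VM (\<lambda>x. Mat (f x \<otimes>\<^bsub>Ghat\<^esub> g x))"
    by (rule smooth_map_cong[OF N smooth_matrix_mult[OF N mf smooth_star[OF N qf mg]]]) (simp add: mat_mult fH gH)
  show "smooth_map N MG (\<lambda>x. snd (f x \<otimes>\<^bsub>Ghat\<^esub> g x))"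
    using smooth_G_mult[OF N qf qg] by (simp add: Ghat_snd_mult)
  show "(\<lambda>x. f x \<otimes>\<^bsub>Ghat\<^esub> g x) \<in> topspace (mtop N) \<rightarrow> carrier Ghat"
    using fH gH by auto
qed

lemma smooth_Ghat_inv:
  assumes N: "smooth_manifold N" and f: "smooth_map N MHat f"
  shows "smooth_map N MHat (\<lambda>x. inv\<^bsub>Ghat\<^esub> (f x))"
proof (rule smooth_into_MHat[OF N])
  have fH: "f x \<in> carrier Ghat" if "x \<in> topspace (mtop N)" for x
    using smooth_map_in[OF f that] by (simp add: topspace_MHat)
  note q = smooth_G_inv[OF N smooth_map_compose[OF N MHat MG(1) f snd_smooth]]
  note c = smooth_map_compose[OF N MHat VM f co_mat_smooth]
  show "smooth_map N VM (\<lambda>x. Mat (inv\<^bsub>Ghat\<^esub> (f x)))"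
    by (rule smooth_map_cong[OF N smooth_star[OF N q c]]) (simp add: mat_inv fH)
  show "smooth_map N MG (\<lambda>x. snd (inv\<^bsub>Ghat\<^esub> (f x)))"
    by (rule smooth_map_cong[OF N q]) (simp add: Ghat_snd_inv fH)
  show "(\<lambda>x. inv\<^bsub>Ghat\<^esub> (f x)) \<in> topspace (mtop N) \<rightarrow> carrier Ghat"
    using fH by auto
qed

theorem lie_group_Ghat: "lie_group Ghat MHat"
  unfolding lie_group_def
proof (intro conjI group_Ghat MHat topspace_MHat)
  note P = smooth_manifold_prod_manifold[OF MHat MHat]
  show "smooth_map (prod_manifold MHat MHat) MHat (\<lambda>(x, y). x \<otimes>\<^bsub>Ghat\<^esub> y)"
    using smooth_Ghat_mult[OF P smooth_map_fst[OF MHat MHat] smooth_map_snd[OF MHat MHat]]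
    by (simp add: case_prod_unfold)
  show "smooth_map MHat MHat (m_inv Ghat)"
    by (rule smooth_Ghat_inv[OF MHat smooth_map_id[OF MHat]])
qed

lemma iota_smooth: "smooth_map MGL MHat \<iota>"
  by (rule smooth_into_MHat[OF MGL])
    (use matrix_of_smooth smooth_map_const[OF MGL MG(1), of "\<one>\<^bsub>G\<^esub>"] in \<open>simp_all add: MG(2) topspace_MGL carrier_GL Pi_iff\<close>)

lemma smooth_into_MGL_iota:
  assumes N: "smooth_manifold N" and f: "smooth_map N MHat (\<lambda>x. \<iota> (f x))"
  shows "smooth_map N MGL f"
proof (rule smooth_into_MGL[OF N])
  show "smooth_map N VM (\<lambda>x. matrix_of (f x))"
    using smooth_map_compose[OF N MHat VM f Mat_smooth] by simp
  show "f \<in> topspace (mtop N) \<rightarrow> carrier GL"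
    using smooth_map_in[OF f] by (auto simp: topspace_MHat carrier_GL)
qed

theorem lie_group_GL: "lie_group GL MGL"
  unfolding lie_group_def
proof (intro conjI group_GL MGL topspace_MGL)
  note P = smooth_manifold_prod_manifold[OF MGL MGL]
  have "smooth_map (prod_manifold MGL MGL) MHat (\<lambda>z. \<iota> (fst z) \<otimes>\<^bsub>Ghat\<^esub> \<iota> (snd z))"
    by (intro smooth_Ghat_mult[OF P] smooth_map_compose[OF P MGL MHat _ iota_smooth]
        smooth_map_fst[OF MGL MGL] smooth_map_snd[OF MGL MGL])
  then have "smooth_map (prod_manifold MGL MGL) MHat (\<lambda>z. \<iota> (fst z \<otimes>\<^bsub>GL\<^esub> snd z))"
    by (simp add: Ghat_mult GL_mult)
  from smooth_into_MGL_iota[OF P this]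
  show "smooth_map (prod_manifold MGL MGL) MGL (\<lambda>(x, y). x \<otimes>\<^bsub>GL\<^esub> y)"
    by (simp add: case_prod_unfold)
  have "smooth_map MGL MHat (\<lambda>\<phi>. \<iota> (inv\<^bsub>GL\<^esub> \<phi>))"
    by (rule smooth_map_cong[OF MGL smooth_Ghat_inv[OF MGL iota_smooth]]) (simp add: topspace_MGL GL_inv)
  from smooth_into_MGL_iota[OF MGL this]
  show "smooth_map MGL MGL (m_inv GL)" .
qed

subsection \<open>Local sections\<close>

definition local_section :: "('e \<Rightarrow> 'e) \<times> 'g \<Rightarrow> 'g \<Rightarrow> ('e \<Rightarrow> 'e) \<times> 'g" where "local_section h0 g = of_mat (Sig h0 g) g"

lemma
  assumes h0: "h0 \<in> carrier Ghat" and g: "g \<in> Omega (snd h0)"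
  shows local_section_in: "local_section h0 g \<in> carrier Ghat" and Mat_local_section: "Mat (local_section h0 g) = Sig h0 g" and snd_local_section: "snd (local_section h0 g) = g"
  using of_mat_Sig_in[OF h0 g p_corner_unit(1)] mat_of_mat_Sig[OF h0 g p_corner_unit(1)]
  by (simp_all add: p_Sig[OF h0 g] local_section_def)

lemma local_section_smooth:
  assumes h0: "h0 \<in> carrier Ghat" and N: "smooth_manifold N" and q: "smooth_map N MG q"
    and Omega: "q \<in> topspace (mtop N) \<rightarrow> Omega (snd h0)"
  shows "smooth_map N MHat (\<lambda>x. local_section h0 (q x))"
proof (rule smooth_into_MHat[OF N])
  show "smooth_map N VM (\<lambda>x. Mat (local_section h0 (q x)))"
    by (rule smooth_map_cong[OF N Sig_smooth[OF N q, of h0]]) (simp add: Mat_local_section[OF h0 funcset_mem[OF Omega]])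
  show "smooth_map N MG (\<lambda>x. snd (local_section h0 (q x)))"
    by (rule smooth_map_cong[OF N q]) (simp add: snd_local_section[OF h0 funcset_mem[OF Omega]])
  show "(\<lambda>x. local_section h0 (q x)) \<in> topspace (mtop N) \<rightarrow> carrier Ghat"
    using local_section_in[OF h0] Omega by auto
qed

lemma iota_in: "\<phi> \<in> carrier GL \<Longrightarrow> \<iota> \<phi> \<in> carrier Ghat"
  by (simp add: carrier_GL)

lemma iota_fst:
  assumes "h \<in> carrier Ghat" "snd h = \<one>\<^bsub>G\<^esub>"
  shows "\<iota> (fst h) = h" and "fst h \<in> carrier GL"
proof -
  show "\<iota> (fst h) = h" using assms(2) by (simp add: prod_eq_iff)
  then show "fst h \<in> carrier GL" using assms(1) by (simp add: carrier_GL)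
qed

lemma smooth_snd_sub:
  assumes N: "smooth_manifold N" and "openin (mtop MG) U" and q: "smooth_map N (open_submanifold MG U) q"
  shows "smooth_map N MG q" "q \<in> topspace (mtop N) \<rightarrow> U"
  using q by (simp_all add: smooth_map_into_open_submanifold[OF N MG(1)])

lemma openin_over: "openin (mtop MG) U \<Longrightarrow> openin (mtop MHat) {h \<in> carrier Ghat. snd h \<in> U}"
  using openin_continuous_map_preimage[OF smooth_map_continuous[OF snd_smooth]] by (simp add: topspace_MHat)

lemma over_submanifold:
  fixes h0 defines "Q \<equiv> {h \<in> carrier Ghat. snd h \<in> Omega (snd h0)}"
  assumes h0: "h0 \<in> carrier Ghat"
  shows "smooth_manifold (open_submanifold MHat Q)" and "topspace (mtop (open_submanifold MHat Q)) = Q"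
    and "smooth_map (open_submanifold MHat Q) MHat (\<lambda>h. h)"
    and "smooth_map (open_submanifold MHat Q) (open_submanifold MG (Omega (snd h0))) snd"
    and "smooth_map (open_submanifold MHat Q) MHat (\<lambda>h. inv\<^bsub>Ghat\<^esub> (local_section h0 (snd h)))"
proof -
  have Q: "openin (mtop MHat) Q" unfolding Q_def by (rule openin_over[OF openin_Omega])
  show N: "smooth_manifold (open_submanifold MHat Q)" by (rule smooth_manifold_open_submanifold[OF MHat Q])
  show top: "topspace (mtop (open_submanifold MHat Q)) = Q" using topspace_MHat by (auto simp: Q_def)
  show "smooth_map (open_submanifold MHat Q) MHat (\<lambda>h. h)"
    by (rule smooth_map_restrict[OF MHat MHat Q smooth_map_id[OF MHat]])
  have s: "smooth_map (open_submanifold MHat Q) MG snd"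
    by (rule smooth_map_restrict[OF MHat MG(1) Q snd_smooth])
  have sO: "snd \<in> topspace (mtop (open_submanifold MHat Q)) \<rightarrow> Omega (snd h0)"
    unfolding top by (auto simp: Q_def)
  show "smooth_map (open_submanifold MHat Q) (open_submanifold MG (Omega (snd h0))) snd"
    unfolding smooth_map_into_open_submanifold[OF N MG(1)] using s sO by (rule conjI)
  show "smooth_map (open_submanifold MHat Q) MHat (\<lambda>h. inv\<^bsub>Ghat\<^esub> (local_section h0 (snd h)))"
    by (rule smooth_Ghat_inv[OF N local_section_smooth[OF h0 N s sO]])
qed

text \<open>The inverse divides by the section from the right. With the section through the unit this
  is the map that characterizes the natural structure.\<close>

theorem trivialization_left:
  assumes h0: "h0 \<in> carrier Ghat"
  shows "diffeomorphism (prod_manifold MGL (open_submanifold MG (Omega (snd h0))))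
    (open_submanifold MHat {h \<in> carrier Ghat. snd h \<in> Omega (snd h0)})
    (\<lambda>z. \<iota> (fst z) \<otimes>\<^bsub>Ghat\<^esub> local_section h0 (snd z))"
proof -
  let ?U = "Omega (snd h0)" and ?Q = "{h \<in> carrier Ghat. snd h \<in> Omega (snd h0)}"
  let ?MU = "open_submanifold MG ?U" and ?MQ = "open_submanifold MHat ?Q"
  let ?P = "prod_manifold MGL ?MU"
  note MU = smooth_manifold_open_submanifold[OF MG(1) openin_Omega]
  note P = smooth_manifold_prod_manifold[OF MGL MU]
  note Q = over_submanifold[OF h0]
  have top: "fst z \<in> carrier GL" "snd z \<in> ?U" if "z \<in> topspace (mtop ?P)" for z
    using that by (auto simp: topspace_MGL)
  note s = smooth_snd_sub[OF P openin_Omega smooth_map_snd[OF MGL MU]]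
  let ?f = "\<lambda>z. \<iota> (fst z) \<otimes>\<^bsub>Ghat\<^esub> local_section h0 (snd z)"
  let ?g = "\<lambda>h. (fst (h \<otimes>\<^bsub>Ghat\<^esub> inv\<^bsub>Ghat\<^esub> (local_section h0 (snd h))), snd h)"
  have snd_f: "snd (?f z) = snd z" if "z \<in> topspace (mtop ?P)" for z
    using snd_local_section[OF h0 top(2)[OF that]] Ghat_snd[OF local_section_in[OF h0 top(2)[OF that]]] by (simp add: Ghat_snd_mult)
  have f_in: "?f z \<in> ?Q" if "z \<in> topspace (mtop ?P)" for z
    using snd_f[OF that] top[OF that] iota_in[of "fst z"] local_section_in[OF h0, of "snd z"] by simp
  have snd_g: "snd (h \<otimes>\<^bsub>Ghat\<^esub> inv\<^bsub>Ghat\<^esub> (local_section h0 (snd h))) = \<one>\<^bsub>G\<^esub>" if "h \<in> ?Q" for h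
    using that local_section_in[OF h0, of "snd h"] snd_local_section[OF h0, of "snd h"] Ghat_snd[of h]
    by (simp add: Ghat_snd_mult Ghat_snd_inv)
  have iota_g: "\<iota> (fst (h \<otimes>\<^bsub>Ghat\<^esub> inv\<^bsub>Ghat\<^esub> (local_section h0 (snd h)))) = h \<otimes>\<^bsub>Ghat\<^esub> inv\<^bsub>Ghat\<^esub> (local_section h0 (snd h))"
    if "h \<in> ?Q" for h
    using that local_section_in[OF h0, of "snd h"] by (intro iota_fst(1)[OF _ snd_g[OF that]]) simp
  show ?thesis
  proof (rule diffeomorphismI[where g = ?g])
    show "smooth_manifold ?MQ" by (rule Q(1))
    have "smooth_map ?P MHat ?f"
      by (intro smooth_Ghat_mult[OF P] smooth_map_compose[OF P MGL MHat smooth_map_fst[OF MGL MU] iota_smooth]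
          local_section_smooth[OF h0 P s])
    then show "smooth_map ?P ?MQ ?f"
      unfolding smooth_map_into_open_submanifold[OF P MHat] using f_in by blast
    have "smooth_map ?MQ MHat (\<lambda>h. h \<otimes>\<^bsub>Ghat\<^esub> inv\<^bsub>Ghat\<^esub> (local_section h0 (snd h)))"
      by (rule smooth_Ghat_mult[OF Q(1) Q(3) Q(5)])
    then have "smooth_map ?MQ MHat (\<lambda>h. \<iota> (fst (h \<otimes>\<^bsub>Ghat\<^esub> inv\<^bsub>Ghat\<^esub> (local_section h0 (snd h)))))"
      by (rule smooth_map_cong[OF Q(1)]) (unfold Q(2), rule iota_g[symmetric])
    then show "smooth_map ?MQ ?P ?g"
      by (intro smooth_map_Pair[OF Q(1) MGL MU _ Q(4)] smooth_into_MGL_iota[OF Q(1)])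
    show "?g (?f z) = z" if z: "z \<in> topspace (mtop ?P)" for z
    proof -
      have "?f z \<otimes>\<^bsub>Ghat\<^esub> inv\<^bsub>Ghat\<^esub> (local_section h0 (snd z)) = \<iota> (fst z)"
        using iota_in[OF top(1)[OF z]] local_section_in[OF h0 top(2)[OF z]] by (simp add: Gh.m_assoc)
      then show ?thesis unfolding snd_f[OF z] by (simp add: prod_eq_iff)
    qed
    show "?f (?g h) = h" if "h \<in> topspace (mtop ?MQ)" for h
    proof -
      have h: "h \<in> ?Q" using that unfolding Q(2) .
      then show ?thesis
        using local_section_in[OF h0, of "snd h"] unfolding fst_conv snd_conv iota_g[OF h] by (simp add: Gh.m_assoc)
    qed
  qed
qed

text \<open>With the linear automorphisms on the right, the trivialization is equivariant for the
  right action of the principal bundle.\<close>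

theorem trivialization_right:
  assumes h0: "h0 \<in> carrier Ghat"
  shows "diffeomorphism (prod_manifold (open_submanifold MG (Omega (snd h0))) MGL)
    (open_submanifold MHat {h \<in> carrier Ghat. snd h \<in> Omega (snd h0)})
    (\<lambda>z. local_section h0 (fst z) \<otimes>\<^bsub>Ghat\<^esub> \<iota> (snd z))"
proof -
  let ?U = "Omega (snd h0)" and ?Q = "{h \<in> carrier Ghat. snd h \<in> Omega (snd h0)}"
  let ?MU = "open_submanifold MG ?U" and ?MQ = "open_submanifold MHat ?Q"
  let ?P = "prod_manifold ?MU MGL"
  note MU = smooth_manifold_open_submanifold[OF MG(1) openin_Omega]
  note P = smooth_manifold_prod_manifold[OF MU MGL]
  note Q = over_submanifold[OF h0]
  have top: "snd z \<in> carrier GL" "fst z \<in> ?U" if "z \<in> topspace (mtop ?P)" for z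
    using that by (auto simp: topspace_MGL)
  note s = smooth_snd_sub[OF P openin_Omega smooth_map_fst[OF MU MGL]]
  let ?f = "\<lambda>z. local_section h0 (fst z) \<otimes>\<^bsub>Ghat\<^esub> \<iota> (snd z)"
  let ?g = "\<lambda>h. (snd h, fst (inv\<^bsub>Ghat\<^esub> (local_section h0 (snd h)) \<otimes>\<^bsub>Ghat\<^esub> h))"
  have snd_f: "snd (?f z) = fst z" if "z \<in> topspace (mtop ?P)" for z
    using snd_local_section[OF h0 top(2)[OF that]] Ghat_snd[OF local_section_in[OF h0 top(2)[OF that]]] by (simp add: Ghat_snd_mult)
  have f_in: "?f z \<in> ?Q" if "z \<in> topspace (mtop ?P)" for z
    using snd_f[OF that] top[OF that] iota_in[of "snd z"] local_section_in[OF h0, of "fst z"] by simp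
  have snd_g: "snd (inv\<^bsub>Ghat\<^esub> (local_section h0 (snd h)) \<otimes>\<^bsub>Ghat\<^esub> h) = \<one>\<^bsub>G\<^esub>" if "h \<in> ?Q" for h
    using that local_section_in[OF h0, of "snd h"] snd_local_section[OF h0, of "snd h"] Ghat_snd[of h]
    by (simp add: Ghat_snd_mult Ghat_snd_inv)
  have iota_g: "\<iota> (fst (inv\<^bsub>Ghat\<^esub> (local_section h0 (snd h)) \<otimes>\<^bsub>Ghat\<^esub> h)) = inv\<^bsub>Ghat\<^esub> (local_section h0 (snd h)) \<otimes>\<^bsub>Ghat\<^esub> h"
    if "h \<in> ?Q" for h
    using that local_section_in[OF h0, of "snd h"] by (intro iota_fst(1)[OF _ snd_g[OF that]]) simp
  show ?thesis
  proof (rule diffeomorphismI[where g = ?g])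
    show "smooth_manifold ?MQ" by (rule Q(1))
    have "smooth_map ?P MHat ?f"
      by (intro smooth_Ghat_mult[OF P] smooth_map_compose[OF P MGL MHat smooth_map_snd[OF MU MGL] iota_smooth]
          local_section_smooth[OF h0 P s])
    then show "smooth_map ?P ?MQ ?f"
      unfolding smooth_map_into_open_submanifold[OF P MHat] using f_in by blast
    have "smooth_map ?MQ MHat (\<lambda>h. inv\<^bsub>Ghat\<^esub> (local_section h0 (snd h)) \<otimes>\<^bsub>Ghat\<^esub> h)"
      by (rule smooth_Ghat_mult[OF Q(1) Q(5) Q(3)])
    then have "smooth_map ?MQ MHat (\<lambda>h. \<iota> (fst (inv\<^bsub>Ghat\<^esub> (local_section h0 (snd h)) \<otimes>\<^bsub>Ghat\<^esub> h)))"
      by (rule smooth_map_cong[OF Q(1)]) (unfold Q(2), rule iota_g[symmetric])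
    then show "smooth_map ?MQ ?P ?g"
      by (intro smooth_map_Pair[OF Q(1) MU MGL Q(4)] smooth_into_MGL_iota[OF Q(1)])
    show "?g (?f z) = z" if z: "z \<in> topspace (mtop ?P)" for z
    proof -
      have "inv\<^bsub>Ghat\<^esub> (local_section h0 (fst z)) \<otimes>\<^bsub>Ghat\<^esub> ?f z = \<iota> (snd z)"
        using iota_in[OF top(1)[OF z]] local_section_in[OF h0 top(2)[OF z]] by (simp flip: Gh.m_assoc)
      then show ?thesis unfolding snd_f[OF z] by (simp add: prod_eq_iff)
    qed
    show "?f (?g h) = h" if "h \<in> topspace (mtop ?MQ)" for h
    proof -
      have h: "h \<in> ?Q" using that unfolding Q(2) .
      then show ?thesis
        using local_section_in[OF h0, of "snd h"] unfolding fst_conv snd_conv iota_g[OF h] by (simp flip: Gh.m_assoc)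
    qed
  qed
qed

lemma Omega_one: "Omega \<one>\<^bsub>G\<^esub> = U_G G \<mu> p"
  unfolding Omega_def U_G_def gamma_at_def gamma_mat_def star_unit ..

text \<open>On vectors of the form \<open>g \<sharp> (p v)\<close> the matrices \<open>\<gamma>\<close> and \<open>\<gamma> (g * p) = p (g * p)\<close> agree.\<close>

lemma local_section_one:
  assumes "g \<in> U_G G \<mu> p"
  shows "local_section \<one>\<^bsub>Ghat\<^esub> g = sigma_section \<mu> p \<theta> g"
proof -
  have g: "g \<in> carrier G" using assms unfolding U_G_def by simp
  have "gamma_mat \<mu> p g *v sharp g (\<theta> s) = (p ** star g p) *v sharp g (\<theta> s)" for s
  proof -
    have "gamma_mat \<mu> p g *v sharp g (\<theta> s) = gamma_mat \<mu> p g *v sharp g (p *v \<theta> s)" by (simp add: p_theta)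
    also have "\<dots> = (gamma_mat \<mu> p g ** star g p) *v sharp g (\<theta> s)"
      by (simp add: sharp_mult[OF g] matrix_vector_mul_assoc)
    finally show ?thesis
      unfolding gamma_mat_def idempotent_pair(1)[OF p_idem star_p_idem[OF g]] .
  qed
  then show ?thesis
    unfolding local_section_def of_mat_def sigma_section_def S_E_def Sig_def mat_one theta_inv_def
    by (simp add: sharp_def[symmetric])
qed

theorem natural_structure: "natural_structure_G_hat scaleK act p \<theta> G MG \<mu> MHat"
  unfolding natural_structure_G_hat_def Let_def
proof (intro conjI)
  let ?U = "U_G G \<mu> p" and ?Q = "{h \<in> carrier Ghat. snd h \<in> U_G G \<mu> p}"
  show U: "openin (mtop MG) ?U" unfolding Omega_one[symmetric] by (rule openin_Omega)
  show "openin (mtop MHat) ?Q" by (rule openin_over[OF U])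
  have one: "snd \<one>\<^bsub>Ghat\<^esub> = \<one>\<^bsub>G\<^esub>" by (simp add: Ghat_one)
  let ?P = "prod_manifold MGL (open_submanifold MG ?U)"
  have P: "smooth_manifold ?P"
    by (intro smooth_manifold_prod_manifold MGL smooth_manifold_open_submanifold[OF MG(1) U])
  note d = trivialization_left[OF Gh.one_closed, unfolded one Omega_one]
  have "smooth_manifold (open_submanifold MHat ?Q)"
    by (rule smooth_manifold_open_submanifold[OF MHat openin_over[OF U]])
  then show "diffeomorphism ?P (open_submanifold MHat ?Q) (\<lambda>(\<phi>, g). \<iota> \<phi> \<otimes>\<^bsub>Ghat\<^esub> sigma_section \<mu> p \<theta> g)"
    by (rule diffeomorphism_cong[OF P _ d]) (use local_section_one in auto)
qed

theorem extension: "lie_group_extension GL MGL \<iota> Ghat MHat snd G MG"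
  unfolding lie_group_extension_def lie_group_morphism_def principal_bundle_def
proof (intro conjI ballI lie_group_GL lie_group_Ghat lie_group_G iota_hom iota_smooth snd_hom snd_smooth
    kernel_snd snd_surj MHat MG(1))
  show "inj_on \<iota> (carrier GL)" by (rule inj_onI) simp
  note P = smooth_manifold_prod_manifold[OF MHat MGL]
  show "smooth_map (prod_manifold MHat MGL) MHat (\<lambda>(x, n). x \<otimes>\<^bsub>Ghat\<^esub> \<iota> n)"
    using smooth_Ghat_mult[OF P smooth_map_fst[OF MHat MGL]
        smooth_map_compose[OF P MGL MHat smooth_map_snd[OF MHat MGL] iota_smooth]]
    by (simp add: case_prod_unfold)
  show "x \<otimes>\<^bsub>Ghat\<^esub> \<iota> \<one>\<^bsub>GL\<^esub> = x" if "x \<in> topspace (mtop MHat)" for x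
    using that by (simp add: topspace_MHat GL_one flip: Ghat_one)
  have iota_mult: "\<iota> (n \<otimes>\<^bsub>GL\<^esub> n') = \<iota> n \<otimes>\<^bsub>Ghat\<^esub> \<iota> n'" for n n'
    by (simp add: Ghat_mult GL_mult)
  show assoc: "x \<otimes>\<^bsub>Ghat\<^esub> \<iota> (n \<otimes>\<^bsub>GL\<^esub> n') = x \<otimes>\<^bsub>Ghat\<^esub> \<iota> n \<otimes>\<^bsub>Ghat\<^esub> \<iota> n'"
    if "x \<in> topspace (mtop MHat)" "n \<in> carrier GL" "n' \<in> carrier GL" for x n n'
    using that unfolding iota_mult by (simp add: topspace_MHat Gh.m_assoc iota_in)
  fix b assume "b \<in> topspace (mtop MG)"
  then have "b \<in> snd ` carrier Ghat" unfolding snd_surj MG(2) .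
  then obtain h0 where h0: "h0 \<in> carrier Ghat" "snd h0 = b" by (elim imageE) simp
  let ?\<tau> = "\<lambda>z. local_section h0 (fst z) \<otimes>\<^bsub>Ghat\<^esub> \<iota> (snd z)"
  show "\<exists>U \<tau>. openin (mtop MG) U \<and> b \<in> U \<and>
      diffeomorphism (prod_manifold (open_submanifold MG U) MGL)
        (open_submanifold MHat {x \<in> topspace (mtop MHat). snd x \<in> U}) \<tau> \<and>
      (\<forall>u\<in>U. \<forall>n\<in>carrier GL. snd (\<tau> (u, n)) = u) \<and>
      (\<forall>u\<in>U. \<forall>n\<in>carrier GL. \<forall>n'\<in>carrier GL. \<tau> (u, n \<otimes>\<^bsub>GL\<^esub> n') = \<tau> (u, n) \<otimes>\<^bsub>Ghat\<^esub> \<iota> n')"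
  proof (intro exI[of _ "Omega b"] exI[of _ ?\<tau>] conjI ballI)
    show "openin (mtop MG) (Omega b)" by (rule openin_Omega)
    show "b \<in> Omega b" using Omega_self[OF Ghat_snd[OF h0(1)]] h0(2) by simp
    show "diffeomorphism (prod_manifold (open_submanifold MG (Omega b)) MGL)
        (open_submanifold MHat {x \<in> topspace (mtop MHat). snd x \<in> Omega b}) ?\<tau>"
      unfolding topspace_MHat using trivialization_right[OF h0(1)] unfolding h0(2) .
    fix u n assume u: "u \<in> Omega b" and n: "n \<in> carrier GL"
    have u': "u \<in> Omega (snd h0)" using u h0(2) by simp
    show "snd (?\<tau> (u, n)) = u"
      using snd_local_section[OF h0(1) u'] Ghat_snd[OF local_section_in[OF h0(1) u']] by (simp add: Ghat_snd_mult)
    show "?\<tau> (u, n \<otimes>\<^bsub>GL\<^esub> n') = ?\<tau> (u, n) \<otimes>\<^bsub>Ghat\<^esub> \<iota> n'" if "n' \<in> carrier GL" for n'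
      using assoc[OF _ n that, of "local_section h0 u"] local_section_in[OF h0(1) u'] by (simp add: topspace_MHat)
  qed
qed

end

theorem theorem3p3:
  fixes scaleK :: "'k::real_or_complex \<Rightarrow> 'a::{real_algebra_1,t2_space} \<Rightarrow> 'a"
    and G :: "('g, 'b) monoid_scheme"
    and MG :: "('g, 'm::{real_vector,t2_space}) manifold"
    and \<mu> :: "'g \<Rightarrow> 'a \<Rightarrow> 'a"
    and act :: "'e::{ab_group_add,topological_space} \<Rightarrow> 'a \<Rightarrow> 'e"
    and p :: "'a^'n^'n"
    and \<theta> :: "'e \<Rightarrow> 'a^'n"
  assumes "continuous_inverse_algebra scaleK"
    and "mackey_complete TYPE('a)"
    and "lie_group G MG"
    and "smooth_action scaleK G MG \<mu>"
    and "fg_projective_via act p \<theta>"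
    and "\<mu> ` carrier G \<subseteq> Aut_alg_mod scaleK act"
  shows "lie_group (GL_mod act) (GL_mod_manifold act p \<theta>) \<and>
    (\<exists>MH :: (('e \<Rightarrow> 'e) \<times> 'g, ('a^'n^'n) \<times> 'm) manifold.
       lie_group (G_hat scaleK act G \<mu>) MH \<and>
       natural_structure_G_hat scaleK act p \<theta> G MG \<mu> MH \<and>
       lie_group_extension
         (GL_mod act) (GL_mod_manifold act p \<theta>) (\<lambda>\<phi>. (\<phi>, \<one>\<^bsub>G\<^esub>))
         (G_hat scaleK act G \<mu>) MH snd
         G MG)"
proof -
  interpret continuous_inverse_algebra scaleK by (rule assms(1))
  interpret projective_module scaleK G MG \<mu> act p \<theta>
    by unfold_locales (rule assms)+
  show ?thesis
    by (intro conjI exI[of _ MHat] lie_group_GL lie_group_Ghat natural_structure extension)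
qed

end
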